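(* Let $F$ be an algebraically closed field of characteristic $0$, let $H$ be a Hopf algebra over $F$, and let $L$ be a nonzero finite dimensional $H$-module Lie algebra over $F$. Suppose the nilpotent radical $N$ of $L$ is $H$-invariant. Then $\mathrm{PIexp}^H(L)=\dim L$ if and only if $L$ is an $H$-simple semisimple algebra.
   Context: A Lie algebra $L$ over $F$ is an $H$-module Lie algebra if it is endowed with a unital algebra homomorphism $H\to\mathrm{End}_F(L)$ such that $h[a,b]=[h_{(1)}a,h_{(2)}b]$ for all $h\in H$, $a,b\in L$ (Sweedler notation $\Delta h=h_{(1)}\otimes h_{(2)}$). The nilpotent radical $N$ is the maximal nilpotent ideal. $L$ is $H$-simple if $[L,L]\ne0$ and its only $H$-invariant ideals are $0$ and $L$. $H$-codimensions. Let $F\{X\}=\bigoplus_{n\geqslant1}F\{X\}^{(n)}$ be the absolutely free nonassociative algebra on $X=\{x_1,x_2,\ldots\}$, graded by total degree. Let $F\{X|H\}:=\bigoplus_{n\geqslant1}H^{\otimes n}\otimes F\{X\}^{(n)}$ with multiplication $(u_1\otimes w_1)(u_2\otimes w_2)=(u_1\otimes u_2)\otimes w_1w_2$; write $x_{i_1}^{h_1}\cdots x_{i_n}^{h_n}:=(h_1\otimes\cdots\otimes h_n)\otimes x_{i_1}\cdots x_{i_n}$ (same bracket arrangement on both sides). $H$ acts by $h(x_{i_1}^{h_1}\cdots x_{i_n}^{h_n})=x_{i_1}^{h_{(1)}h_1}\cdots x_{i_n}^{h_{(n)}h_n}$. Let $I$ be the $H$-invariant ideal generated by all $u(vw)+v(wu)+w(uv)$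 and $u^2$, $u,v,w\in F\{X|H\}$. Then $L(X|H):=F\{X|H\}/I$ is the free $H$-module Lie algebra on $X$. Let $\mathrm{Id}^H(L)$ be the set of $f\in L(X|H)$ with $\psi(f)=0$ for all homomorphisms $\psi:L(X|H)\to L$ of algebras and $H$-modules; let $V_n^H\subset L(X|H)$ be the span of all $[x_{\sigma(1)}^{h_1},\ldots,x_{\sigma(n)}^{h_n}]$ (long commutators), $h_i\in H$, $\sigma\in S_n$. Put $c_n^H(L):=\dim\bigl(V_n^H/(V_n^H\cap\mathrm{Id}^H(L))\bigr)$. (Equivalently, this is the dimension of the space of $n$-linear functions on $L$ represented by elements of $V_n^H$.) $\mathrm{PIexp}^H(L):=\lim_{n\to\infty}\sqrt[n]{c_n^H(L)}$; the equality $\mathrm{PIexp}^H(L)=\dim L$ means that the limit exists and equals $\dim L$. *)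

theory Defs
  imports Complex_Main
    "HOL-Library.Poly_Mapping"
    "HOL-Combinatorics.Permutations"
    "HOL-Computational_Algebra.Polynomial"
begin

section \<open>Free vector spaces and their quotients\<close>

text \<open>The type \<open>'b \<Rightarrow>\<^sub>0 'f\<close> is the vector space with basis \<open>'b\<close>.\<close>

definition smult_free :: "'f::field \<Rightarrow> ('b \<Rightarrow>\<^sub>0 'f) \<Rightarrow> ('b \<Rightarrow>\<^sub>0 'f)" where
  "smult_free c p = Poly_Mapping.map ((*) c) p"

abbreviation basis_vec :: "'b \<Rightarrow> ('b \<Rightarrow>\<^sub>0 'f::field)" where
  "basis_vec b \<equiv> Poly_Mapping.single b 1"

lemma lookup_smult_free [simp]:
  "Poly_Mapping.lookup (smult_free c p) b = c * Poly_Mapping.lookup p b"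
  unfolding smult_free_def by (simp add: Poly_Mapping.map.rep_eq when_def)

interpretation free: vector_space "smult_free :: 'f::field \<Rightarrow> ('b \<Rightarrow>\<^sub>0 'f) \<Rightarrow> ('b \<Rightarrow>\<^sub>0 'f)"
  by standard (auto intro!: poly_mapping_eqI simp: lookup_add algebra_simps)

definition coset :: "('b \<Rightarrow>\<^sub>0 'f::field) set \<Rightarrow> ('b \<Rightarrow>\<^sub>0 'f) \<Rightarrow> ('b \<Rightarrow>\<^sub>0 'f) set" where
  "coset W v = {v + w |w. w \<in> W}"

text \<open>\<open>B\<close> is a system of representatives of a basis of \<open>U/W\<close>.\<close>

definition quotient_basis ::
  "('b \<Rightarrow>\<^sub>0 'f::field) set \<Rightarrow> ('b \<Rightarrow>\<^sub>0 'f) set \<Rightarrow> ('b \<Rightarrow>\<^sub>0 'f) set \<Rightarrow> bool" where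
  "quotient_basis U W B \<longleftrightarrow>
     B \<subseteq> U \<and> U \<subseteq> free.span (B \<union> W) \<and>
     (\<forall>t u. finite t \<and> t \<subseteq> B \<and> (\<Sum>v\<in>t. smult_free (u v) v) \<in> W \<longrightarrow> (\<forall>v\<in>t. u v = 0))"

definition quotient_dim :: "('b \<Rightarrow>\<^sub>0 'f::field) set \<Rightarrow> ('b \<Rightarrow>\<^sub>0 'f) set \<Rightarrow> nat" where
  "quotient_dim U W = card (SOME B. quotient_basis U W B)"

section \<open>Hopf algebras\<close>

locale unital_algebra = vector_space scale
  for scale :: "'f::field \<Rightarrow> 'h::ring_1 \<Rightarrow> 'h" +
  assumes scale_mult_left: "scale c x * y = scale c (x * y)"
    and scale_mult_right: "x * scale c y = scale c (x * y)"
begin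

text \<open>The list \<open>[h\<^sub>1, \<dots>, h\<^sub>n]\<close> stands for the tensor \<open>h\<^sub>1 \<otimes> \<dots> \<otimes> h\<^sub>n\<close>; the sum over \<open>n\<close> of
  the tensor powers of \<open>H\<close> is the free vector space on all lists modulo \<open>tensor_rel\<close>.\<close>

definition tensor_rel :: "('h list \<Rightarrow>\<^sub>0 'f) set" where
  "tensor_rel = free.span
     ({basis_vec (xs @ (a + b) # ys) - basis_vec (xs @ a # ys) - basis_vec (xs @ b # ys)
         |xs a b ys. True} \<union>
      {basis_vec (xs @ scale c a # ys) - smult_free c (basis_vec (xs @ a # ys))
         |xs c a ys. True})"

text \<open>A list of pure tensors stands for their sum; every tensor is of this form.\<close>

definition tensor_eq :: "'h list list \<Rightarrow> 'h list list \<Rightarrow> bool" where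
  "tensor_eq ts us \<longleftrightarrow>
     (\<Sum>t\<leftarrow>ts. basis_vec t) - (\<Sum>t\<leftarrow>us. basis_vec t) \<in> tensor_rel"

end

text \<open>\<open>comult h = [(a\<^sub>1, b\<^sub>1), \<dots>, (a\<^sub>k, b\<^sub>k)]\<close> stands for \<open>\<Delta> h = a\<^sub>1 \<otimes> b\<^sub>1 + \<dots> + a\<^sub>k \<otimes> b\<^sub>k\<close>.
  The list is an arbitrary representative, so all identities between tensors are
  stated with \<open>tensor_eq\<close>. Sweedler sums \<open>\<Sum> f h\<^sub>(\<^sub>1\<^sub>) h\<^sub>(\<^sub>2\<^sub>)\<close> with \<open>f\<close> bilinear become
  \<open>\<Sum>(a, b)\<leftarrow>comult h. f a b\<close>.\<close>

locale hopf_algebra = unital_algebra scale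
  for scale :: "'f::field \<Rightarrow> 'h::ring_1 \<Rightarrow> 'h" +
  fixes comult :: "'h \<Rightarrow> ('h \<times> 'h) list"
    and counit :: "'h \<Rightarrow> 'f"
    and antipode :: "'h \<Rightarrow> 'h"
  assumes comult_add:
      "tensor_eq [[a, b]. (a, b) \<leftarrow> comult (g + h)] [[a, b]. (a, b) \<leftarrow> comult g @ comult h]"
    and comult_scale:
      "tensor_eq [[a, b]. (a, b) \<leftarrow> comult (scale c h)] [[scale c a, b]. (a, b) \<leftarrow> comult h]"
    and comult_one: "tensor_eq [[a, b]. (a, b) \<leftarrow> comult 1] [[1, 1]]"
    and comult_mult:
      "tensor_eq [[a, b]. (a, b) \<leftarrow> comult (g * h)]
         [[a * a', b * b']. (a, b) \<leftarrow> comult g, (a', b') \<leftarrow> comult h]"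
    and coassoc:
      "tensor_eq [[p, q, b]. (a, b) \<leftarrow> comult h, (p, q) \<leftarrow> comult a]
         [[a, p, q]. (a, b) \<leftarrow> comult h, (p, q) \<leftarrow> comult b]"
    and counit_add: "counit (g + h) = counit g + counit h"
    and counit_scale: "counit (scale c h) = c * counit h"
    and counit_one: "counit 1 = 1"
    and counit_mult: "counit (g * h) = counit g * counit h"
    and counit_left: "(\<Sum>(a, b)\<leftarrow>comult h. scale (counit a) b) = h"
    and counit_right: "(\<Sum>(a, b)\<leftarrow>comult h. scale (counit b) a) = h"
    and antipode_add: "antipode (g + h) = antipode g + antipode h"
    and antipode_scale: "antipode (scale c h) = scale c (antipode h)"
    and antipode_left: "(\<Sum>(a, b)\<leftarrow>comult h. antipode a * b) = scale (counit h) 1"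
    and antipode_right: "(\<Sum>(a, b)\<leftarrow>comult h. a * antipode b) = scale (counit h) 1"

section \<open>Lie algebras\<close>

locale lie_algebra = vector_space scale
  for scale :: "'f::field \<Rightarrow> 'l::ab_group_add \<Rightarrow> 'l" +
  fixes bracket :: "'l \<Rightarrow> 'l \<Rightarrow> 'l"
  assumes bracket_add_left: "bracket (a + b) c = bracket a c + bracket b c"
    and bracket_add_right: "bracket a (b + c) = bracket a b + bracket a c"
    and bracket_scale_left: "bracket (scale k a) b = scale k (bracket a b)"
    and bracket_scale_right: "bracket a (scale k b) = scale k (bracket a b)"
    and bracket_self: "bracket a a = 0"
    and jacobi: "bracket a (bracket b c) + bracket b (bracket c a) + bracket c (bracket a b) = 0"
begin

definition lie_ideal :: "'l set \<Rightarrow> bool" where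
  "lie_ideal J \<longleftrightarrow> subspace J \<and> (\<forall>a. \<forall>b\<in>J. bracket a b \<in> J)"

definition bracket_space :: "'l set \<Rightarrow> 'l set \<Rightarrow> 'l set" where
  "bracket_space A B = span {bracket a b |a b. a \<in> A \<and> b \<in> B}"

primrec lower_central :: "'l set \<Rightarrow> nat \<Rightarrow> 'l set" where
  "lower_central J 0 = J"
| "lower_central J (Suc n) = bracket_space (lower_central J n) J"

primrec derived_series :: "'l set \<Rightarrow> nat \<Rightarrow> 'l set" where
  "derived_series J 0 = J"
| "derived_series J (Suc n) = bracket_space (derived_series J n) (derived_series J n)"

definition nilpotent_radical :: "'l set" where
  "nilpotent_radical = (GREATEST J. lie_ideal J \<and> (\<exists>n. lower_central J n = {0}))"

definition solvable_radical :: "'l set" where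
  "solvable_radical = (GREATEST J. lie_ideal J \<and> (\<exists>n. derived_series J n = {0}))"

definition semisimple :: bool where
  "semisimple \<longleftrightarrow> solvable_radical = {0}"

end

section \<open>\<open>H\<close>-module Lie algebras\<close>

locale H_module_lie_algebra =
  H: hopf_algebra scaleH comult counit antipode + L: lie_algebra scaleL bracket
  for scaleH :: "'f::field \<Rightarrow> 'h::ring_1 \<Rightarrow> 'h"
    and comult :: "'h \<Rightarrow> ('h \<times> 'h) list"
    and counit :: "'h \<Rightarrow> 'f"
    and antipode :: "'h \<Rightarrow> 'h"
    and scaleL :: "'f \<Rightarrow> 'l::ab_group_add \<Rightarrow> 'l"
    and bracket :: "'l \<Rightarrow> 'l \<Rightarrow> 'l" +
  fixes act :: "'h \<Rightarrow> 'l \<Rightarrow> 'l"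
  assumes act_add_right: "act h (a + b) = act h a + act h b"
    and act_scale_right: "act h (scaleL c a) = scaleL c (act h a)"
    and act_add_left: "act (g + h) a = act g a + act h a"
    and act_scale_left: "act (scaleH c h) a = scaleL c (act h a)"
    and act_one: "act 1 a = a"
    and act_mult: "act (g * h) a = act g (act h a)"
    and act_bracket: "act h (bracket a b) = (\<Sum>(p, q)\<leftarrow>comult h. bracket (act p a) (act q b))"
begin

definition H_invariant :: "'l set \<Rightarrow> bool" where
  "H_invariant J \<longleftrightarrow> (\<forall>h. \<forall>a\<in>J. act h a \<in> J)"

definition H_simple :: bool where
  "H_simple \<longleftrightarrow> L.bracket_space UNIV UNIV \<noteq> {0} \<and>
     (\<forall>J. L.lie_ideal J \<and> H_invariant J \<longrightarrow> J = {0} \<or> J = UNIV)"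

end

section \<open>The free \<open>H\<close>-module Lie algebra\<close>

text \<open>A nonassociative monomial in the decorated letters \<open>x\<^sub>i\<^sup>h\<close>: with \<open>n\<close> letters it stands
  for the element \<open>(h\<^sub>1 \<otimes> \<dots> \<otimes> h\<^sub>n) \<otimes> w\<close> of \<open>H\<^sup>\<otimes>\<^sup>n \<otimes> F{X}\<^sup>(\<^sup>n\<^sup>)\<close>, where \<open>w\<close> is the underlying
  bracketed monomial in the letters \<open>x\<^sub>i\<close>. The set \<open>X\<close> is indexed by the natural numbers
  including \<open>0\<close>.\<close>

datatype 'h monomial = Letter nat 'h | Prod "'h monomial" "'h monomial"

definition mult_free ::
  "('h monomial \<Rightarrow>\<^sub>0 'f::field) \<Rightarrow> ('h monomial \<Rightarrow>\<^sub>0 'f) \<Rightarrow> ('h monomial \<Rightarrow>\<^sub>0 'f)" where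
  "mult_free p q = (\<Sum>s\<in>Poly_Mapping.keys p. \<Sum>t\<in>Poly_Mapping.keys q.
     Poly_Mapping.single (Prod s t) (Poly_Mapping.lookup p s * Poly_Mapping.lookup q t))"

lemma mult_free_superset:
  assumes "finite A" "finite B" "Poly_Mapping.keys p \<subseteq> A" "Poly_Mapping.keys q \<subseteq> B"
  shows "mult_free p q = (\<Sum>s\<in>A. \<Sum>t\<in>B.
     Poly_Mapping.single (Prod s t) (Poly_Mapping.lookup p s * Poly_Mapping.lookup q t))"
proof -
  have "mult_free p q = (\<Sum>s\<in>Poly_Mapping.keys p. \<Sum>t\<in>B.
     Poly_Mapping.single (Prod s t) (Poly_Mapping.lookup p s * Poly_Mapping.lookup q t))"
    unfolding mult_free_def using assms
    by (intro sum.cong refl sum.mono_neutral_left) (auto simp: in_keys_iff)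
  also have "\<dots> = (\<Sum>s\<in>A. \<Sum>t\<in>B.
     Poly_Mapping.single (Prod s t) (Poly_Mapping.lookup p s * Poly_Mapping.lookup q t))"
    using assms by (intro sum.mono_neutral_left) (auto simp: in_keys_iff)
  finally show ?thesis .
qed

lemma mult_free_diff_left: "mult_free (p - p') q = mult_free p q - mult_free p' q"
proof -
  let ?A = "Poly_Mapping.keys p \<union> Poly_Mapping.keys p'" and ?B = "Poly_Mapping.keys q"
  have A: "Poly_Mapping.keys (p - p') \<subseteq> ?A" by (rule keys_diff)
  show ?thesis
    by (subst (1 2 3) mult_free_superset[where A = ?A and B = ?B])
       (use A in \<open>auto simp: sum_subtractf[symmetric] lookup_minus left_diff_distrib
          single_diff intro!: sum.cong\<close>)
qed

lemma mult_free_diff_right: "mult_free p (q - q') = mult_free p q - mult_free p q'"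
proof -
  let ?B = "Poly_Mapping.keys q \<union> Poly_Mapping.keys q'" and ?A = "Poly_Mapping.keys p"
  have B: "Poly_Mapping.keys (q - q') \<subseteq> ?B" by (rule keys_diff)
  show ?thesis
    by (subst (1 2 3) mult_free_superset[where A = ?A and B = ?B])
       (use B in \<open>auto simp: sum_subtractf[symmetric] lookup_minus right_diff_distrib
          single_diff intro!: sum.cong\<close>)
qed

text \<open>Since the monomials \<open>w\<close> with \<open>n\<close> letters form a basis of \<open>F{X}\<^sup>(\<^sup>n\<^sup>)\<close>, the algebra \<open>F{X|H}\<close>
  is the free vector space on decorated monomials modulo multilinearity in the decorations.\<close>

inductive_set decoration_rel :: "('f::field \<Rightarrow> 'h::ring_1 \<Rightarrow> 'h) \<Rightarrow> ('h monomial \<Rightarrow>\<^sub>0 'f) set"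
  for scaleH :: "'f \<Rightarrow> 'h \<Rightarrow> 'h"
where
  add: "basis_vec (Letter i (g + h)) - basis_vec (Letter i g) - basis_vec (Letter i h)
          \<in> decoration_rel scaleH"
| scale: "basis_vec (Letter i (scaleH c h)) - smult_free c (basis_vec (Letter i h))
          \<in> decoration_rel scaleH"
| left: "r \<in> decoration_rel scaleH \<Longrightarrow> mult_free (basis_vec m) r \<in> decoration_rel scaleH"
| right: "r \<in> decoration_rel scaleH \<Longrightarrow> mult_free r (basis_vec m) \<in> decoration_rel scaleH"

context hopf_algebra
begin

text \<open>By coassociativity the iterated coproduct can be computed along the bracket arrangement.\<close>

primrec act_monomial :: "'h monomial \<Rightarrow> 'h \<Rightarrow> ('h monomial \<Rightarrow>\<^sub>0 'f)" where
  "act_monomial (Letter i g) = (\<lambda>h. basis_vec (Letter i (h * g)))"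
| "act_monomial (Prod s t) =
     (\<lambda>h. \<Sum>(a, b)\<leftarrow>comult h. mult_free (act_monomial s a) (act_monomial t b))"

definition act_free :: "'h \<Rightarrow> ('h monomial \<Rightarrow>\<^sub>0 'f) \<Rightarrow> ('h monomial \<Rightarrow>\<^sub>0 'f)" where
  "act_free h p =
     (\<Sum>m\<in>Poly_Mapping.keys p. smult_free (Poly_Mapping.lookup p m) (act_monomial m h))"

lemma act_free_diff: "act_free h (p - q) = act_free h p - act_free h q"
proof -
  let ?A = "Poly_Mapping.keys p \<union> Poly_Mapping.keys q"
  have *: "act_free h r =
      (\<Sum>m\<in>?A. smult_free (Poly_Mapping.lookup r m) (act_monomial m h))"
    if "Poly_Mapping.keys r \<subseteq> ?A" for r
    unfolding act_free_def using that
    by (intro sum.mono_neutral_left) (auto simp: in_keys_iff)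
  show ?thesis
    by (subst (1 2 3) *)
       (use keys_diff[of p q] in \<open>auto simp: sum_subtractf[symmetric] lookup_minus
          free.scale_left_diff_distrib\<close>)
qed

definition H_ideal :: "('h monomial \<Rightarrow>\<^sub>0 'f) set \<Rightarrow> bool" where
  "H_ideal J \<longleftrightarrow> free.subspace J \<and>
     (\<forall>p\<in>J. \<forall>q. mult_free p q \<in> J \<and> mult_free q p \<in> J) \<and>
     (\<forall>h. \<forall>p\<in>J. act_free h p \<in> J)"

text \<open>The preimage of the ideal \<open>I\<close> of \<open>F{X|H}\<close> in the space of decorated monomials.\<close>

definition lie_rel :: "('h monomial \<Rightarrow>\<^sub>0 'f) set" where
  "lie_rel = \<Inter> {J. H_ideal J \<and> decoration_rel scale \<subseteq> J \<and>
     (\<forall>u v w. mult_free u (mult_free v w) + mult_free v (mult_free w u)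
        + mult_free w (mult_free u v) \<in> J) \<and>
     (\<forall>u. mult_free u u \<in> J)}"

text \<open>The class of \<open>p\<close> in \<open>L(X|H)\<close>. The operations of \<open>L(X|H)\<close> are those induced on classes by
  \<open>+\<close>, \<^const>\<open>smult_free\<close>, \<^const>\<open>mult_free\<close> and \<^const>\<open>act_free\<close>.\<close>

abbreviation cls :: "('h monomial \<Rightarrow>\<^sub>0 'f) \<Rightarrow> ('h monomial \<Rightarrow>\<^sub>0 'f) set" where
  "cls \<equiv> coset lie_rel"

lemma H_ideal_lie_rel: "H_ideal lie_rel"
  unfolding H_ideal_def lie_rel_def free.subspace_def by blast

lemma cls_eq_iff: "cls p = cls q \<longleftrightarrow> p - q \<in> lie_rel"
proof
  have sub: "free.subspace lie_rel"
    using H_ideal_lie_rel by (simp add: H_ideal_def)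
  show "p - q \<in> lie_rel" if "cls p = cls q"
  proof -
    have "p \<in> cls p"
      unfolding coset_def using free.subspace_0[OF sub] by force
    then have "p \<in> cls q" using that by simp
    then obtain w where "p = q + w" "w \<in> lie_rel"
      unfolding coset_def by blast
    then show ?thesis by simp
  qed
  show "cls p = cls q" if "p - q \<in> lie_rel"
  proof (intro equalityI subsetI)
    show "x \<in> cls q" if "x \<in> cls p" for x
    proof -
      from that obtain w where w: "x = p + w" "w \<in> lie_rel" by (auto simp: coset_def)
      then have "x = q + ((p - q) + w)" by simp
      then show ?thesis
        using free.subspace_add[OF sub \<open>p - q \<in> lie_rel\<close> w(2)]
        unfolding coset_def by blast
    qed
    show "x \<in> cls p" if "x \<in> cls q" for x
    proof -
      from that obtain w where w: "x = q + w" "w \<in> lie_rel" by (auto simp: coset_def)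
      then have "x = p + (w - (p - q))" by simp
      then show ?thesis
        using free.subspace_diff[OF sub w(2) \<open>p - q \<in> lie_rel\<close>]
        unfolding coset_def by blast
    qed
  qed
qed

lemma cls_operations_well_defined:
  assumes "cls p = cls p'" "cls q = cls q'"
  shows "cls (p + q) = cls (p' + q')"
    and "cls (smult_free c p) = cls (smult_free c p')"
    and "cls (mult_free p q) = cls (mult_free p' q')"
    and "cls (act_free h p) = cls (act_free h p')"
proof -
  have p: "p - p' \<in> lie_rel" and q: "q - q' \<in> lie_rel"
    using assms by (simp_all add: cls_eq_iff)
  have sub: "free.subspace lie_rel"
    and ideal: "\<And>r s. r \<in> lie_rel \<Longrightarrow> mult_free r s \<in> lie_rel \<and> mult_free s r \<in> lie_rel"
    and inv: "\<And>r. r \<in> lie_rel \<Longrightarrow> act_free h r \<in> lie_rel"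
    using H_ideal_lie_rel by (auto simp: H_ideal_def)
  show "cls (p + q) = cls (p' + q')"
    using free.subspace_add[OF sub p q] by (simp add: cls_eq_iff algebra_simps)
  show "cls (smult_free c p) = cls (smult_free c p')"
    using free.subspace_scale[OF sub p, of c]
    by (simp add: cls_eq_iff free.scale_right_diff_distrib)
  have "mult_free p q - mult_free p' q' = mult_free (p - p') q + mult_free p' (q - q')"
    by (simp add: mult_free_diff_left mult_free_diff_right)
  then show "cls (mult_free p q) = cls (mult_free p' q')"
    using free.subspace_add[OF sub] ideal[OF p] ideal[OF q] by (simp add: cls_eq_iff)
  show "cls (act_free h p) = cls (act_free h p')"
    using inv[OF p] by (simp add: cls_eq_iff act_free_diff)
qed

definition free_H_lie :: "('h monomial \<Rightarrow>\<^sub>0 'f) set set" where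
  "free_H_lie = range cls"

text \<open>The commutator \<open>[\<dots>[[x\<^bsub>\<sigma> 0\<^esub>\<^bsup>h 0\<^esup>, x\<^bsub>\<sigma> 1\<^esub>\<^bsup>h 1\<^esup>], x\<^bsub>\<sigma> 2\<^esub>\<^bsup>h 2\<^esup>], \<dots>]\<close> of length \<open>n \<ge> 1\<close>.\<close>

definition long_commutator :: "nat \<Rightarrow> (nat \<Rightarrow> nat) \<Rightarrow> (nat \<Rightarrow> 'h) \<Rightarrow> 'h monomial" where
  "long_commutator n \<sigma> h =
     foldl Prod (Letter (\<sigma> 0) (h 0)) (map (\<lambda>i. Letter (\<sigma> i) (h i)) [1..<n])"

definition multilinear_H_polys :: "nat \<Rightarrow> ('h monomial \<Rightarrow>\<^sub>0 'f) set set" where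
  "multilinear_H_polys n =
     cls ` free.span {basis_vec (long_commutator n \<sigma> h) |\<sigma> h. \<sigma> permutes {..<n}}"

end

section \<open>Polynomial \<open>H\<close>-identities and codimensions\<close>

context H_module_lie_algebra
begin

definition H_lie_hom :: "(('h monomial \<Rightarrow>\<^sub>0 'f) set \<Rightarrow> 'l) \<Rightarrow> bool" where
  "H_lie_hom \<psi> \<longleftrightarrow>
     (\<forall>p q. \<psi> (H.cls (p + q)) = \<psi> (H.cls p) + \<psi> (H.cls q)) \<and>
     (\<forall>c p. \<psi> (H.cls (smult_free c p)) = scaleL c (\<psi> (H.cls p))) \<and>
     (\<forall>p q. \<psi> (H.cls (mult_free p q)) = bracket (\<psi> (H.cls p)) (\<psi> (H.cls q))) \<and>
     (\<forall>h p. \<psi> (H.cls (H.act_free h p)) = act h (\<psi> (H.cls p)))"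

definition H_identities :: "('h monomial \<Rightarrow>\<^sub>0 'f) set set" where
  "H_identities = {f \<in> H.free_H_lie. \<forall>\<psi>. H_lie_hom \<psi> \<longrightarrow> \<psi> f = 0}"

text \<open>The dimension of a quotient \<open>V/W\<close> of subspaces of \<open>L(X|H)\<close> is computed from the
  preimages of \<open>V\<close> and \<open>W\<close> in the space of decorated monomials.\<close>

definition H_codim :: "nat \<Rightarrow> nat" where
  "H_codim n = quotient_dim
     (H.cls -` H.multilinear_H_polys n)
     (H.cls -` (H.multilinear_H_polys n \<inter> H_identities))"

end

end

theory Submission
  imports Defs "HOL-Combinatorics.Multiset_Permutations"
begin

text \<open>
  Let \<open>d\<close> be the dimension of \<open>L\<close>. Homomorphisms from the free \<open>H\<close>-module Lie algebra to \<open>L\<close> are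
  the same as evaluations of the variables, so the \<open>n\<close>-th codimension is the dimension of the space
  of \<open>n\<close>-linear functions on \<open>L\<close> that are represented by long commutators (\<open>H_codim_eq\<close>). It is
  at most \<open>d\<^bsup>n+1\<^esup>\<close>, and the question is whether a smaller exponential bound holds.

  \<^bold>\<open>Maximal growth implies that \<open>L\<close> is \<open>H\<close>-simple and semisimple.\<close> A multilinear function is
  determined by its values on words in a basis. If the nilpotent radical \<open>N\<close> is nonzero, take a basis
  that contains an element \<open>x\<close> of \<open>N\<close>. Since \<open>N\<close> is an \<open>H\<close>-invariant nilpotent ideal, commutators
  vanish on words with more than \<open>p\<close> occurrences of \<open>x\<close> for some \<open>p\<close>, and at most
  \<open>2\<^sup>p (d - 1/2)\<^sup>n\<close> words remain (\<open>codim_growth_nilpotent_ideal\<close>). So \<open>N = 0\<close>; then \<open>L\<close> has no abelian ideals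
  and is semisimple. If \<open>J\<close> is a proper nonzero \<open>H\<close>-invariant ideal, then its centralizer \<open>C\<close> is
  \<open>H\<close>-invariant because of the antipode, meets \<open>J\<close> in \<open>0\<close>, and is nonzero because it contains the
  orthogonal complement of \<open>J\<close> for the Killing form. Commutators with entries in both \<open>J\<close> and \<open>C\<close>
  vanish, and the bound becomes \<open>2 d (d - 1)\<^sup>n\<close> (\<open>codim_growth_disjoint_ideals\<close>).

  \<^bold>\<open>An \<open>H\<close>-simple semisimple algebra has maximal growth.\<close> By \<open>H\<close>-simplicity and Schur's lemma the
  operators \<open>ad z\<close> and the action of \<open>H\<close> generate all linear operators (\<open>density\<close>). Hence there is
  a polynomial \<open>F\<close>, not an identity, that alternates in \<open>d\<close> of its variables
  (\<open>exists_alternating_poly\<close>). Substituting \<open>T x\<^sub>i\<close> for each alternating variable in turn multiplies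
  \<open>F\<close> by the trace of \<open>T\<close>; with \<open>T = ad u \<circ> ad v\<close> this gives \<open>\<kappa>(u, v) F\<close> for the Killing form
  \<open>\<kappa>\<close>. The determinant of a matrix of such values is \<open>\<gamma> det(u) det(v)\<close> with \<open>\<gamma> \<noteq> 0\<close>, as \<open>\<kappa>\<close> is
  nondegenerate. So the product of \<open>F\<close> with determinants \<open>det(x\<^bsub>p\<^sub>1\<^esub>, \<dots>, x\<^bsub>p\<^sub>d\<^esub>)\<close> over an even number of
  disjoint blocks of new variables is represented by a polynomial, for every choice of blocks
  (\<open>H_poly_many_dets\<close>). It remains to find many independent products among these. They are indexed
  by words in which each letter occurs equally often in each chunk of bounded length, with the
  blocks chosen in such a way that the product for one word vanishes at every other word
  (\<open>words_eq_if_blocks_injective\<close>); by Stirling's bounds the number of words is at least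
  \<open>C \<rho>\<^sup>n\<close> for any \<open>\<rho> < d\<close>.

  Both directions rest on Cartan's criterion in the following form: if \<open>L\<close> has no abelian ideals,
  then an ideal on which the Killing form vanishes is zero (\<open>killing_zero_ideal\<close>).
\<close>

section \<open>Linear algebra\<close>

lemma homogeneous_system_nontrivial_solution:
  fixes A :: "'i \<Rightarrow> 'j \<Rightarrow> 'f::field"
  assumes "finite I" "finite J" "card I < card J"
  shows "\<exists>c. (\<exists>j\<in>J. c j \<noteq> 0) \<and> (\<forall>i\<in>I. (\<Sum>j\<in>J. A i j * c j) = 0)"
  using assms
proof (induction I arbitrary: J A rule: finite_induct)
  case empty
  then obtain j where "j \<in> J" by fastforce
  then show ?case by (intro exI[of _ "\<lambda>_. 1"]) auto
next
  case (insert i I)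
  show ?case
  proof (cases "\<forall>j\<in>J. A i j = 0")
    case True
    have "card I < card J" using insert by simp
    then obtain c where "\<exists>j\<in>J. c j \<noteq> 0" "\<forall>i\<in>I. (\<Sum>j\<in>J. A i j * c j) = 0"
      using insert.IH[of J A] insert.prems by auto
    then show ?thesis using True by (intro exI[of _ c]) auto
  next
    case False
    then obtain k where k: "k \<in> J" "A i k \<noteq> 0" by auto
    define J' where "J' = J - {k}"
    \<comment> \<open>Gaussian elimination of the unknown \<open>k\<close> with the equation \<open>i\<close>.\<close>
    have J': "finite J'" "J = insert k J'" "k \<notin> J'" using k insert.prems by (auto simp: J'_def)
    then have "card I < card J'" using insert by simp
    then obtain c where c: "\<exists>j\<in>J'. c j \<noteq> 0"
        "\<forall>l\<in>I. (\<Sum>j\<in>J'. (A l j - A l k * A i j / A i k) * c j) = 0"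
      using insert.IH[of J' "\<lambda>l j. A l j - A l k * A i j / A i k"] J' by auto
    define S where "S = (\<Sum>j\<in>J'. A i j * c j)"
    define c' where "c' = c(k := - S / A i k)"
    have same: "(\<Sum>j\<in>J'. A l j * c' j) = (\<Sum>j\<in>J'. A l j * c j)" for l
      using J'(3) by (intro sum.cong) (auto simp: c'_def)
    have "(\<Sum>j\<in>J. A l j * c' j) = 0" if "l \<in> insert i I" for l
    proof (cases "l = i")
      case True
      then show ?thesis using J' same k by (simp add: c'_def S_def)
    next
      case False
      have "0 = (\<Sum>j\<in>J'. A l j * c j - A l k / A i k * (A i j * c j))"
        using c(2) that False by (auto simp: algebra_simps)
      also have "\<dots> = (\<Sum>j\<in>J'. A l j * c j) - A l k / A i k * S"
        by (simp add: sum_subtractf sum_distrib_left S_def)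
      finally show ?thesis using J' same by (simp add: c'_def)
    qed
    moreover have "\<exists>j\<in>J. c' j \<noteq> 0" using c(1) J' by (auto simp: c'_def)
    ultimately show ?thesis by blast
  qed
qed

text \<open>A field of characteristic zero is a rational vector space; a coordinate in a rational basis
  through the given element is the required functional.\<close>

lemma exists_rational_functional:
  fixes a :: "'f::field_char_0"
  assumes "a \<noteq> 0"
  shows "\<exists>f :: 'f \<Rightarrow> rat. (\<forall>x y. f (x + y) = f x + f y) \<and>
           (\<forall>r x. f (of_rat r * x) = r * f x) \<and> f a = 1"
proof -
  interpret Q: vector_space "\<lambda>(r::rat) (x::'f). of_rat r * x"
    by standard (auto simp: algebra_simps of_rat_add of_rat_mult)
  interpret QQ: vector_space "\<lambda>(r::rat) (x::rat). r * x"
    by standard (auto simp: algebra_simps)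
  interpret P: vector_space_pair "\<lambda>(r::rat) (x::'f). of_rat r * x" "\<lambda>(r::rat) (x::rat). r * x" ..
  have "Q.independent {a}" using assms by simp
  from P.linear_independent_extend[OF this, of "\<lambda>_. 1"]
  obtain f where f: "Vector_Spaces.linear (\<lambda>(r::rat) (x::'f). of_rat r * x) (*) f" "f a = 1" by auto
  interpret f: Vector_Spaces.linear "\<lambda>(r::rat) (x::'f). of_rat r * x" "\<lambda>(r::rat) (x::rat). r * x" f
    by (rule f)
  show ?thesis using f(2) f.add f.scale by (intro exI[of _ f]) auto
qed

context finite_dimensional_vector_space
begin

lemma linearI:
  assumes "\<And>x y. f (x + y) = f x + f y" "\<And>c x. f (scale c x) = scale c (f x)"
  shows "Vector_Spaces.linear scale scale f"
  using assms by (simp add: Vector_Spaces.linear_iff vector_space_axioms)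

abbreviation endo :: "('b \<Rightarrow> 'b) \<Rightarrow> bool" where
  "endo \<equiv> Vector_Spaces.linear scale scale"

lemma endo_add: "endo f \<Longrightarrow> f (x + y) = f x + f y"
  and endo_scale: "endo f \<Longrightarrow> f (scale c x) = scale c (f x)"
  and endo_0: "endo f \<Longrightarrow> f 0 = 0"
  and endo_diff: "endo f \<Longrightarrow> f (x - y) = f x - f y"
  and endo_sum: "endo f \<Longrightarrow> f (\<Sum>i\<in>I. g i) = (\<Sum>i\<in>I. f (g i))"
proof -
  assume f: "endo f"
  interpret f: Vector_Spaces.linear scale scale f by (rule f)
  show "f (x + y) = f x + f y" "f (scale c x) = scale c (f x)" "f 0 = 0" "f (x - y) = f x - f y"
    "f (\<Sum>i\<in>I. g i) = (\<Sum>i\<in>I. f (g i))"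
    by (simp_all add: f.add f.scale f.zero f.diff f.sum)
qed

text \<open>The fixed basis of the locale serves for coordinates; other bases are adapted to ideals or to
  an operator.\<close>

definition is_basis :: "'b set \<Rightarrow> bool" where
  "is_basis B \<longleftrightarrow> independent B \<and> span B = UNIV"

lemma is_basis_finite: "is_basis B \<Longrightarrow> finite B"
  by (simp add: is_basis_def finiteI_independent)

lemma is_basis_card: "is_basis B \<Longrightarrow> card B = dim UNIV"
  by (metis is_basis_def dim_UNIV dim_eq_card_independent dim_span)

lemma is_basis_extend:
  assumes "independent S"
  shows "\<exists>B. S \<subseteq> B \<and> is_basis B"
proof -
  obtain B where "S \<subseteq> B" "independent B" "UNIV \<subseteq> span B"
    using maximal_independent_subset_extend[OF subset_UNIV assms] by metis
  then show ?thesis unfolding is_basis_def by blast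
qed

lemma is_basis_Basis: "is_basis Basis"
  by (simp add: is_basis_def independent_Basis span_Basis)

context
  fixes B
  assumes B: "is_basis B"
begin

lemma coord_expand: "(\<Sum>b\<in>B. scale (representation B v b) b) = v"
  using B by (intro sum_representation_eq) (auto simp: is_basis_def is_basis_finite)

lemma coord_add: "representation B (u + v) b = representation B u b + representation B v b"
  using B by (subst representation_add) (auto simp: is_basis_def)

lemma coord_scale: "representation B (scale c v) b = c * representation B v b"
  using B by (subst representation_scale) (auto simp: is_basis_def)

lemma coord_0: "representation B 0 b = 0"
  by (rule representation_zero[THEN fun_cong])

lemma coord_sum: "representation B (\<Sum>i\<in>I. g i) b = (\<Sum>i\<in>I. representation B (g i) b)"
  by (induction I rule: infinite_finite_induct) (auto simp: coord_add coord_0)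

lemma coord_minus: "representation B (- v) b = - representation B v b"
  using coord_add[of v "- v" b] by (simp add: coord_0 add_eq_0_iff)

lemma coord_diff: "representation B (u - v) b = representation B u b - representation B v b"
  using coord_add[of u "- v" b] by (simp add: coord_minus)

lemma coord_basis: "b \<in> B \<Longrightarrow> representation B b c = (if c = b then 1 else 0)"
  using B by (simp add: representation_basis is_basis_def)

lemma coord_eqI: "(\<And>b. b \<in> B \<Longrightarrow> representation B u b = representation B v b) \<Longrightarrow> u = v"
  by (subst (1 2) coord_expand[symmetric]) (simp cong: sum.cong)

end

subsection \<open>The trace\<close>

definition trace :: "('b \<Rightarrow> 'b) \<Rightarrow> 'a" where
  "trace T = (\<Sum>b\<in>Basis. representation Basis (T b) b)"

text \<open>Expanding the vectors of each basis in the other one turns both traces into the same double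
  sum.\<close>

lemma trace_basis:
  assumes B: "is_basis B" and T: "endo T"
  shows "trace T = (\<Sum>b\<in>B. representation B (T b) b)"
proof -
  let ?r = "representation Basis" and ?s = "representation B"
  note E = is_basis_Basis
  have "trace T = (\<Sum>e\<in>Basis. ?r (\<Sum>b\<in>B. scale (?s e b) (T b)) e)"
    unfolding trace_def
    by (subst (2) coord_expand[OF B, symmetric], simp add: endo_sum[OF T] endo_scale[OF T])
  also have "\<dots> = (\<Sum>e\<in>Basis. \<Sum>b\<in>B. ?s e b * ?r (T b) e)"
    by (simp add: coord_sum[OF E] coord_scale[OF E])
  also have "\<dots> = (\<Sum>b\<in>B. \<Sum>e\<in>Basis. ?s e b * ?r (T b) e)" by (rule sum.swap)
  also have "\<dots> = (\<Sum>b\<in>B. ?s (\<Sum>e\<in>Basis. scale (?r (T b) e) e) b)"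
    by (simp add: coord_sum[OF B] coord_scale[OF B] mult.commute)
  also have "\<dots> = (\<Sum>b\<in>B. ?s (T b) b)"
    by (simp add: coord_expand[OF E])
  finally show ?thesis .
qed

lemma trace_add: "trace (\<lambda>x. S x + T x) = trace S + trace T"
  by (simp add: trace_def coord_add[OF is_basis_Basis] sum.distrib)

lemma trace_diff: "trace (\<lambda>x. S x - T x) = trace S - trace T"
  by (simp add: trace_def coord_diff[OF is_basis_Basis] sum_subtractf)

lemma trace_scale: "trace (\<lambda>x. scale c (T x)) = c * trace T"
  by (simp add: trace_def coord_scale[OF is_basis_Basis] sum_distrib_left)

lemma trace_commute:
  assumes "endo S" "endo T"
  shows "trace (\<lambda>x. S (T x)) = trace (\<lambda>x. T (S x))"
proof -
  note E = is_basis_Basis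
  let ?r = "representation Basis"
  have *: "trace (\<lambda>x. S (T x)) = (\<Sum>b\<in>Basis. \<Sum>e\<in>Basis. ?r (T b) e * ?r (S e) b)"
    if "endo S" for S T :: "'b \<Rightarrow> 'b"
    unfolding trace_def
    by (subst (2) coord_expand[OF E, symmetric])
       (simp add: endo_sum[OF that] endo_scale[OF that] coord_sum[OF E] coord_scale[OF E])
  show ?thesis
    unfolding *[OF assms(1), of T] *[OF assms(2), of S]
    by (subst sum.swap) (simp add: mult.commute)
qed

subsection \<open>Generalised eigenspaces\<close>

definition shift :: "('b \<Rightarrow> 'b) \<Rightarrow> 'a \<Rightarrow> 'b \<Rightarrow> 'b" where
  "shift D a v = D v - scale a v"

definition gen_eig :: "('b \<Rightarrow> 'b) \<Rightarrow> 'a \<Rightarrow> 'b set" where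
  "gen_eig D a = {v. \<exists>m. (shift D a ^^ m) v = 0}"

context
  fixes D
  assumes D: "endo D"
begin

lemma endo_shift: "endo (shift D a)"
  by (rule linearI)
     (auto simp: shift_def endo_add[OF D] endo_scale[OF D] algebra_simps)

lemma endo_shift_pow: "endo (shift D a ^^ m)"
proof (induction m)
  case 0
  show ?case by (rule linearI) auto
next
  case (Suc m)
  show ?case
    by (rule linearI) (auto simp: endo_add[OF Suc] endo_scale[OF Suc] endo_add[OF endo_shift]
        endo_scale[OF endo_shift])
qed

lemma shift_commute: "shift D a (shift D b v) = shift D b (shift D a v)"
  by (simp add: shift_def endo_diff[OF D] endo_scale[OF D] algebra_simps)

lemma shift_pow_commute: "shift D a ((shift D b ^^ m) v) = (shift D b ^^ m) (shift D a v)"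
proof (induction m)
  case (Suc m)
  have "shift D a (shift D b ((shift D b ^^ m) v)) = shift D b (shift D a ((shift D b ^^ m) v))"
    by (rule shift_commute)
  then show ?case using Suc by simp
qed simp

lemma shift_pow_zero_mono:
  assumes "(shift D a ^^ m) v = 0"
  shows "(shift D a ^^ (m + k)) v = 0"
  using assms by (induction k) (auto simp: endo_0[OF endo_shift])

lemma gen_eig_shift_iff: "shift D a v \<in> gen_eig D a \<longleftrightarrow> v \<in> gen_eig D a"
proof
  assume "shift D a v \<in> gen_eig D a"
  then obtain m where "(shift D a ^^ m) (shift D a v) = 0" by (auto simp: gen_eig_def)
  then have "(shift D a ^^ Suc m) v = 0" by (simp add: funpow_swap1)
  then show "v \<in> gen_eig D a" unfolding gen_eig_def by blast
next
  assume "v \<in> gen_eig D a"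
  then obtain m where "(shift D a ^^ m) v = 0" by (auto simp: gen_eig_def)
  then have "(shift D a ^^ m) (shift D a v) = 0"
    by (simp add: shift_pow_commute[symmetric] endo_0[OF endo_shift])
  then show "shift D a v \<in> gen_eig D a" unfolding gen_eig_def by blast
qed

lemma gen_eig_induct [consumes 1, case_names zero step]:
  assumes "v \<in> gen_eig D a" "P 0"
    and "\<And>w. w \<in> gen_eig D a \<Longrightarrow> P (shift D a w) \<Longrightarrow> P w"
  shows "P v"
proof -
  obtain m where "(shift D a ^^ m) v = 0" using assms(1) by (auto simp: gen_eig_def)
  then show ?thesis using assms(1)
  proof (induction m arbitrary: v)
    case 0
    then show ?case using assms(2) by simp
  next
    case (Suc m)
    have "(shift D a ^^ m) (shift D a v) = 0" using Suc.prems(1) by (simp add: funpow_swap1)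
    then have "P (shift D a v)" using Suc gen_eig_shift_iff by blast
    then show ?case using assms(3) Suc.prems(2) by blast
  qed
qed

lemma subspace_gen_eig: "subspace (gen_eig D a)"
proof (rule subspaceI)
  show "0 \<in> gen_eig D a" unfolding gen_eig_def by (auto intro: exI[of _ 0])
next
  fix x y assume "x \<in> gen_eig D a" "y \<in> gen_eig D a"
  then obtain m k where "(shift D a ^^ m) x = 0" "(shift D a ^^ k) y = 0" by (auto simp: gen_eig_def)
  then have "(shift D a ^^ (m + k)) x = 0" "(shift D a ^^ (m + k)) y = 0"
    using shift_pow_zero_mono[of m a x k] shift_pow_zero_mono[of k a y m] by (auto simp: add.commute)
  then show "x + y \<in> gen_eig D a"
    unfolding gen_eig_def by (auto simp: endo_add[OF endo_shift_pow] intro!: exI[of _ "m + k"])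
next
  fix c x assume "x \<in> gen_eig D a"
  then show "scale c x \<in> gen_eig D a"
    unfolding gen_eig_def by (auto simp: endo_scale[OF endo_shift_pow])
qed

lemma gen_eig_shift_closed:
  assumes "v \<in> gen_eig D b"
  shows "shift D a v \<in> gen_eig D b"
proof -
  obtain m where "(shift D b ^^ m) v = 0" using assms by (auto simp: gen_eig_def)
  then have "(shift D b ^^ m) (shift D a v) = 0"
    by (simp add: shift_pow_commute[symmetric] endo_0[OF endo_shift])
  then show ?thesis unfolding gen_eig_def by blast
qed

lemma shift_injective_on_gen_eig:
  assumes "v \<in> gen_eig D c" "shift D a v = 0" "a \<noteq> c"
  shows "v = 0"
proof -
  obtain m where m: "(shift D c ^^ m) v = 0" using assms by (auto simp: gen_eig_def)
  have "shift D c v = scale (a - c) v" using assms(2) by (simp add: shift_def algebra_simps)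
  then have "(shift D c ^^ m) v = scale ((a - c) ^ m) v"
    by (induction m) (auto simp: endo_scale[OF endo_shift] mult.commute)
  then show ?thesis using m assms by auto
qed

lemma shift_pow_injective_on_gen_eig:
  assumes "v \<in> gen_eig D c" "(shift D a ^^ m) v = 0" "a \<noteq> c"
  shows "v = 0"
  using assms(1,2)
proof (induction m arbitrary: v)
  case (Suc m)
  then have "(shift D a ^^ m) (shift D a v) = 0" by (simp add: funpow_swap1)
  then have "shift D a v = 0" using Suc gen_eig_shift_closed by blast
  then show ?case using shift_injective_on_gen_eig assms(3) Suc by blast
qed auto

text \<open>Induction on the number of eigenvalues: a power of \<open>D - a\<close> kills the summand for \<open>a\<close>, and it is
  injective on the generalised eigenspaces of the other eigenvalues.\<close>

lemma gen_eig_direct: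
  assumes "finite C" "\<And>c. c \<in> C \<Longrightarrow> u c \<in> gen_eig D c" "(\<Sum>c\<in>C. u c) = 0" "c \<in> C"
  shows "u c = 0"
  using assms
proof (induction C arbitrary: u c rule: finite_induct)
  case (insert a C)
  obtain m where m: "(shift D a ^^ m) (u a) = 0" using insert.prems(1)[of a] by (auto simp: gen_eig_def)
  have pow_closed: "(shift D a ^^ k) v \<in> gen_eig D c" if "v \<in> gen_eig D c" for k c v
    using that by (induction k) (auto intro: gen_eig_shift_closed)
  have "(\<Sum>c\<in>C. (shift D a ^^ m) (u c)) = (shift D a ^^ m) (\<Sum>c\<in>insert a C. u c)"
    using insert.hyps m by (simp add: endo_add[OF endo_shift_pow] endo_sum[OF endo_shift_pow])
  also have "\<dots> = 0" using insert.prems(2) by (simp add: endo_0[OF endo_shift_pow])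
  finally have "(shift D a ^^ m) (u c) = 0" if "c \<in> C" for c
    using insert.IH[of "\<lambda>c. (shift D a ^^ m) (u c)" c] insert.prems(1) pow_closed that by blast
  then have C: "u c = 0" if "c \<in> C" for c
    using shift_pow_injective_on_gen_eig[where v = "u c" and c = c and a = a and m = m] insert.prems(1) insert.hyps that by blast
  then have "u a = 0" using insert by simp
  then show ?case using C insert.prems(3) by auto
qed auto

text \<open>Division by \<open>D - a\<close> on the generalised eigenspace of another eigenvalue:
  \<open>(D - a) w = (D - b) w + (b - a) w\<close>, and \<open>(D - b) w\<close> can be divided by induction.\<close>

lemma shift_surjective_on_gen_eig:
  assumes K: "subspace K" "\<And>v. v \<in> K \<Longrightarrow> D v \<in> K"
    and "w \<in> gen_eig D b" "w \<in> K" "a \<noteq> b"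
  shows "\<exists>u\<in>gen_eig D b \<inter> K. shift D a u = w"
proof -
  have "w \<in> K \<longrightarrow> (\<exists>u\<in>gen_eig D b \<inter> K. shift D a u = w)"
    using assms(3)
  proof (induction rule: gen_eig_induct)
    case zero
    show ?case
      using subspace_0[OF K(1)] subspace_0[OF subspace_gen_eig] endo_0[OF endo_shift] by auto
  next
    case (step w)
    show ?case
    proof
      assume w: "w \<in> K"
      then have "shift D b w \<in> K"
        using K subspace_diff[OF K(1)] subspace_scale[OF K(1)] by (simp add: shift_def)
      then obtain u where u: "u \<in> gen_eig D b \<inter> K" "shift D a u = shift D b w" using step by auto
      define v where "v = scale (1 / (b - a)) (w - u)"
      have "shift D a (w - u) = scale (b - a) w"
        using u by (simp add: endo_diff[OF endo_shift]) (simp add: shift_def algebra_simps)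
      then have "shift D a v = w" using assms(5) by (simp add: v_def endo_scale[OF endo_shift])
      moreover have "v \<in> gen_eig D b \<inter> K"
        unfolding v_def using u w step K(1) subspace_gen_eig
        by (auto intro!: subspace_scale subspace_diff)
      ultimately show "\<exists>u\<in>gen_eig D b \<inter> K. shift D a u = w" by blast
    qed
  qed
  then show ?thesis using assms(4) by blast
qed

text \<open>If a product of factors \<open>D - a\<close> kills \<open>v\<close>, then \<open>v\<close> is a sum of generalised eigenvectors. By
  induction this holds for \<open>(D - a) v\<close>, and the quotient by \<open>D - a\<close> is determined up to a
  generalised eigenvector for \<open>a\<close>. The invariant subspace \<open>K\<close> is carried along, so that the summands
  stay in \<open>K\<close>.\<close>

lemma gen_eig_span_of_annihilated:
  assumes K: "subspace K" "\<And>v. v \<in> K \<Longrightarrow> D v \<in> K"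
    and "v \<in> K" "fold (shift D) as v = 0"
  shows "v \<in> span (\<Union>a. gen_eig D a \<inter> K)"
  using assms(3,4)
proof (induction as arbitrary: v)
  case Nil
  then show ?case by (simp add: span_zero)
next
  case (Cons a as)
  let ?S = "span (\<Union>a. gen_eig D a \<inter> K)"
  have "shift D a v \<in> K"
    using K Cons.prems(1) subspace_diff[OF K(1)] subspace_scale[OF K(1)] by (simp add: shift_def)
  then have "shift D a v \<in> ?S" using Cons by simp
  \<comment> \<open>Up to an element of the eigenspace for \<open>a\<close>, everything in the span can be divided
    by \<open>D - a\<close>.\<close>
  then have "\<exists>u\<in>?S. \<exists>g\<in>gen_eig D a \<inter> K. u \<in> K \<and> shift D a v = shift D a u + g"
  proof (induction rule: span_induct_alt)
    case base
    show ?case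
      using subspace_0[OF subspace_gen_eig] subspace_0[OF K(1)]
      by (intro bexI[of _ 0]) (auto simp: endo_0[OF endo_shift] span_zero)
  next
    case (step c x y)
    then obtain u g where ug: "u \<in> ?S" "g \<in> gen_eig D a \<inter> K" "u \<in> K" "y = shift D a u + g" by auto
    from step obtain b where x: "x \<in> gen_eig D b" "x \<in> K" by auto
    show ?case
    proof (cases "b = a")
      case True
      have "scale c x + g \<in> gen_eig D a \<inter> K"
        using x ug True K(1) subspace_gen_eig by (auto intro!: subspace_add subspace_scale)
      then show ?thesis using ug
        by (intro bexI[OF _ ug(1)] bexI[of _ "scale c x + g"]) (auto simp: algebra_simps)
    next
      case False
      then obtain z where z: "z \<in> gen_eig D b \<inter> K" "shift D a z = x"
        using shift_surjective_on_gen_eig[OF K] x by metis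
      have "z \<in> ?S" using z by (intro span_base) auto
      then have "scale c z + u \<in> ?S" using ug by (auto intro: span_add span_scale)
      then show ?thesis using ug z K(1)
        by (intro bexI[of _ "scale c z + u"] bexI[of _ g])
           (auto simp: endo_add[OF endo_shift] endo_scale[OF endo_shift] algebra_simps
            intro!: subspace_add subspace_scale)
    qed
  qed
  then obtain u g where ug: "u \<in> ?S" "g \<in> gen_eig D a" "g \<in> K" "u \<in> K"
    "shift D a v = shift D a u + g" by auto
  then have "shift D a (v - u) \<in> gen_eig D a" by (simp add: endo_diff[OF endo_shift])
  then have "v - u \<in> gen_eig D a" using gen_eig_shift_iff by blast
  moreover have "v - u \<in> K" using ug Cons.prems(1) K(1) by (auto intro: subspace_diff)
  ultimately have "v - u \<in> ?S" by (intro span_base) auto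
  then show ?case using ug(1) span_add by fastforce
qed

end

text \<open>The value at \<open>v\<close> of the polynomial \<open>p\<close> in the operator \<open>D\<close>, by Horner's rule.\<close>

definition poly_apply :: "('b \<Rightarrow> 'b) \<Rightarrow> 'a poly \<Rightarrow> 'b \<Rightarrow> 'b" where
  "poly_apply D p v = fold_coeffs (\<lambda>c w. scale c v + D w) p 0"

context
  fixes D
  assumes D: "endo D"
begin

lemma poly_apply_0 [simp]: "poly_apply D 0 v = 0"
  by (simp add: poly_apply_def)

lemma poly_apply_pCons: "poly_apply D (pCons c p) v = scale c v + D (poly_apply D p v)"
  by (cases "p = 0 \<and> c = 0") (auto simp: poly_apply_def endo_0[OF D])

lemma poly_apply_add: "poly_apply D (p + q) v = poly_apply D p v + poly_apply D q v"
proof (induction p arbitrary: q)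
  case (pCons c p)
  show ?case
  proof (cases q)
    case q: (pCons c' q')
    show ?thesis unfolding q by (simp add: poly_apply_pCons pCons.IH endo_add[OF D] algebra_simps)
  qed
qed auto

lemma poly_apply_smult: "poly_apply D (smult c p) v = scale c (poly_apply D p v)"
  by (induction p) (auto simp: poly_apply_pCons endo_scale[OF D] algebra_simps)

lemma poly_apply_linear_factor:
  "poly_apply D ([:- a, 1:] * p) v = poly_apply D p (shift D a v)"
proof -
  have "[:- a, 1:] * p = smult (- a) p + pCons 0 p" by simp
  then have "poly_apply D ([:- a, 1:] * p) v = shift D a (poly_apply D p v)"
    by (simp only: poly_apply_add poly_apply_smult) (simp add: poly_apply_add poly_apply_smult poly_apply_pCons shift_def)
  also have "\<dots> = poly_apply D p (shift D a v)"
    by (induction p)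
       (auto simp: poly_apply_pCons endo_add[OF endo_shift[OF D]] endo_scale[OF endo_shift[OF D]]
         endo_0[OF endo_shift[OF D]] endo_0[OF D] shift_def endo_diff[OF D] endo_scale[OF D] endo_add[OF D]
         algebra_simps)
  finally show ?thesis .
qed

lemma poly_apply_monom_sum:
  "poly_apply D (\<Sum>i\<in>I. monom (c i) i) v = (\<Sum>i\<in>I. scale (c i) ((D ^^ i) v))"
proof -
  have "poly_apply D (monom a i) v = scale a ((D ^^ i) v)" for a i
    by (induction i) (auto simp: monom_0 monom_Suc poly_apply_pCons endo_0[OF D] endo_scale[OF D])
  then show ?thesis
    by (induction I rule: infinite_finite_induct) (auto simp: poly_apply_add)
qed

text \<open>The vectors \<open>v, D v, \<dots>, D\<^sup>d v\<close> are more in number than the dimension.\<close>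

lemma exists_annihilating_poly: "\<exists>p. p \<noteq> 0 \<and> poly_apply D p v = 0"
proof -
  obtain c where c: "\<exists>i\<in>{..card Basis}. c i \<noteq> 0"
    "\<forall>b\<in>Basis. (\<Sum>i\<in>{..card Basis}. representation Basis ((D ^^ i) v) b * c i) = 0"
    using homogeneous_system_nontrivial_solution
      [of Basis "{..card Basis}" "\<lambda>b i. representation Basis ((D ^^ i) v) b"] finite_Basis by auto
  define p where "p = (\<Sum>i\<in>{..card Basis}. monom (c i) i)"
  have "coeff p i = c i" if "i \<le> card Basis" for i
    using that by (simp add: p_def coeff_sum)
  then have "p \<noteq> 0" using c(1) by auto
  moreover have "poly_apply D p v = 0"
    unfolding p_def poly_apply_monom_sum
    using c(2) by (intro coord_eqI[OF is_basis_Basis])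
      (auto simp: coord_sum[OF is_basis_Basis] coord_scale[OF is_basis_Basis]
        coord_0[OF is_basis_Basis] mult.commute)
  ultimately show ?thesis by blast
qed

end

end

locale alg_closed_fd_space = finite_dimensional_vector_space scale Basis
  for scale :: "'f::{alg_closed_field, field_char_0} \<Rightarrow> 'b::ab_group_add \<Rightarrow> 'b" and Basis
begin

lemma exists_annihilating_shifts:
  fixes v :: 'b
  assumes D: "endo D"
  shows "\<exists>as. fold (shift D) as v = 0"
proof -
  obtain p where "p \<noteq> 0" "poly_apply D p v = 0" using exists_annihilating_poly[OF D] by blast
  then show ?thesis
  proof (induction "degree p" arbitrary: p v)
    case 0
    then obtain c where "p = [:c:]" "c \<noteq> 0" by (metis degree_eq_zeroE pCons_eq_0_iff)
    then have "v = 0" using 0 by (auto simp: poly_apply_pCons[OF D] poly_apply_0[OF D] endo_0[OF D])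
    then show ?case by (intro exI[of _ "[]"]) auto
  next
    case (Suc n)
    then obtain a where "poly p a = 0" using alg_closed_imp_poly_has_root[of p] by auto
    then obtain q where q: "p = [:- a, 1:] * q" by (auto simp: poly_eq_0_iff_dvd)
    then have "q \<noteq> 0" using Suc by auto
    then have "degree p = Suc (degree q)" unfolding q by (subst degree_mult_eq) auto
    moreover have "poly_apply D q (shift D a v) = 0"
      using Suc q poly_apply_linear_factor[OF D] by metis
    ultimately obtain as where "fold (shift D) as (shift D a v) = 0"
      using Suc \<open>q \<noteq> 0\<close> by (metis nat.inject)
    then show ?case by (intro exI[of _ "a # as"]) auto
  qed
qed

lemma gen_eig_span:
  assumes "endo D" "subspace K" "\<And>v. v \<in> K \<Longrightarrow> D v \<in> K" "v \<in> K"
  shows "v \<in> span (\<Union>a. gen_eig D a \<inter> K)"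
  using gen_eig_span_of_annihilated[OF assms] exists_annihilating_shifts[OF assms(1), of v] by blast

lemma exists_eigenvector:
  fixes v :: 'b
  assumes D: "endo D" and "v \<noteq> 0"
  shows "\<exists>a w. w \<noteq> 0 \<and> D w = scale a w"
proof -
  obtain as where "fold (shift D) as v = 0" using exists_annihilating_shifts[OF D] by blast
  then show ?thesis using assms(2)
  proof (induction as arbitrary: v)
    case (Cons a as)
    then show ?case by (cases "shift D a v = 0") (auto simp: shift_def)
  qed simp
qed

text \<open>The basis is triangular for \<open>D\<close> in a suitable order; the statement records only that the
  diagonal entry at \<open>b\<close> is the eigenvalue of \<open>b\<close>. A maximal independent family with invariant span
  has this property: if its span were proper, some generalised eigenvector would lie outside, and
  the last of its images under \<open>D - a\<close> that lies outside could be adjoined.\<close>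

lemma exists_triangular_basis:
  assumes D: "endo D"
  shows "\<exists>B. is_basis B \<and> (\<forall>b\<in>B. b \<in> gen_eig D (representation B (D b) b))"
proof -
  define Q where "Q B \<longleftrightarrow> independent B \<and> (\<forall>v\<in>span B. D v \<in> span B) \<and>
    (\<forall>b\<in>B. b \<in> gen_eig D (representation B (D b) b))" for B
  have Q0: "Q {}" unfolding Q_def by (simp add: independent_empty endo_0[OF D])
  have bound: "\<forall>B. Q B \<longrightarrow> card B \<le> card Basis"
  proof (intro allI impI)
    fix B assume "Q B"
    then show "card B \<le> card Basis" using independent_card_le_dim[of B UNIV] by (simp add: Q_def)
  qed
  obtain B where "Q B" and max: "\<forall>B'. Q B' \<longrightarrow> card B' \<le> card B"
    using ex_has_greatest_nat[of Q "{}" card "Suc (card Basis)"] Q0 bound less_Suc_eq_le by blast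
  have indep: "independent B" and inv: "\<And>v. v \<in> span B \<Longrightarrow> D v \<in> span B"
    and eig: "\<And>b. b \<in> B \<Longrightarrow> b \<in> gen_eig D (representation B (D b) b)"
    using \<open>Q B\<close> unfolding Q_def by blast+
  have "span B = UNIV"
  proof (rule ccontr)
    assume ne: "span B \<noteq> UNIV"
    have "\<exists>a. \<exists>v\<in>gen_eig D a. v \<notin> span B"
    proof (rule ccontr)
      assume "\<not> ?thesis"
      then have "span (\<Union>a. gen_eig D a \<inter> UNIV) \<subseteq> span B"
        by (intro span_minimal subspace_span) blast
      then show False using gen_eig_span[OF D subspace_UNIV UNIV_I UNIV_I] ne by blast
    qed
    then obtain a v where v: "v \<in> gen_eig D a" "v \<notin> span B" by blast
    have "v \<notin> span B \<longrightarrow> (\<exists>w\<in>gen_eig D a. w \<notin> span B \<and> shift D a w \<in> span B)"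
    proof (rule gen_eig_induct[OF D v(1)], goal_cases)
      case 1
      show ?case by (simp add: span_zero)
    next
      case (2 w)
      then show ?case by (cases "shift D a w \<in> span B") blast+
    qed
    then obtain w where w: "w \<in> gen_eig D a" "w \<notin> span B" "shift D a w \<in> span B" using v by blast
    let ?B = "insert w B"
    have indep': "independent ?B" using w indep by (simp add: independent_insertI)
    have Dw: "D w = shift D a w + scale a w" by (simp add: shift_def)
    have sub: "span B \<subseteq> span ?B" by (intro span_mono) auto
    have "representation ?B (D w) w = representation ?B (shift D a w) w + a * representation ?B w w"
      unfolding Dw using sub w indep'
      by (subst representation_add) (auto simp: representation_scale span_scale span_base)
    moreover have "representation ?B (shift D a w) w = 0"
      using representation_extend[OF indep' w(3) subset_insertI] w(2) representation_ne_zero[of B "shift D a w" w]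
        span_base[of w B] by metis
    ultimately have rw: "representation ?B (D w) w = a"
      by (simp add: representation_basis[OF indep'])
    have "Q ?B"
      unfolding Q_def
    proof (intro conjI ballI)
      fix v assume "v \<in> span ?B"
      then show "D v \<in> span ?B"
      proof (induction rule: span_induct_alt)
        case (step c x y)
        have "D x \<in> span ?B"
          proof (cases "x = w")
          case True
          then show ?thesis unfolding True Dw
            using w(3) sub by (intro span_add span_scale) (auto intro: span_base)
        next
          case False
          then show ?thesis using step(1) inv[OF span_base[of x B]] sub by blast
        qed
        then show ?case using step by (simp add: endo_add[OF D] endo_scale[OF D] span_add span_scale)
      qed (simp add: endo_0[OF D] span_zero)
    next
      fix b assume "b \<in> ?B"
      show "b \<in> gen_eig D (representation ?B (D b) b)"
      proof (cases "b = w")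
        case True
        then show ?thesis using rw w by simp
      next
        case False
        then have "b \<in> B" using \<open>b \<in> ?B\<close> by simp
        then have "D b \<in> span B" using inv span_base by blast
        from representation_extend[OF indep' this subset_insertI] have "representation ?B (D b) = representation B (D b)" by auto
        then show ?thesis using eig[OF \<open>b \<in> B\<close>] by simp
      qed
    qed (rule indep')
    moreover have "w \<notin> B" using w span_base by blast
    moreover have "finite B" using indep finiteI_independent by blast
    ultimately show False using max by fastforce
  qed
  then show ?thesis using indep eig unfolding is_basis_def by blast
qed

end

section \<open>Radicals of Lie algebras\<close>

context lie_algebra
begin

lemma bracket_0_left [simp]: "bracket 0 a = 0"
  using bracket_add_left[of 0 0 a] by simp

lemma bracket_0_right [simp]: "bracket a 0 = 0"
  using bracket_add_right[of a 0 0] by simp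

lemma bracket_minus_left: "bracket (- a) b = - bracket a b"
  using bracket_add_left[of a "- a" b] by (simp add: add_eq_0_iff)

lemma bracket_minus_right: "bracket a (- b) = - bracket a b"
  using bracket_add_right[of a b "- b"] by (simp add: add_eq_0_iff)

lemma bracket_diff_left: "bracket (a - b) c = bracket a c - bracket b c"
  using bracket_add_left[of a "- b" c] by (simp add: bracket_minus_left)

lemma bracket_diff_right: "bracket a (b - c) = bracket a b - bracket a c"
  using bracket_add_right[of a b "- c"] by (simp add: bracket_minus_right)

lemma bracket_sum_left: "bracket (\<Sum>i\<in>I. f i) a = (\<Sum>i\<in>I. bracket (f i) a)"
  by (induction I rule: infinite_finite_induct) (auto simp: bracket_add_left)

lemma bracket_sum_right: "bracket a (\<Sum>i\<in>I. f i) = (\<Sum>i\<in>I. bracket a (f i))"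
  by (induction I rule: infinite_finite_induct) (auto simp: bracket_add_right)

lemma bracket_anticommute: "bracket a b = - bracket b a"
proof -
  have "bracket (a + b) (a + b) = bracket a b + bracket b a"
    by (simp only: bracket_add_left bracket_add_right) (simp add: bracket_self)
  then show ?thesis using bracket_self[of "a + b"] by (metis eq_neg_iff_add_eq_0)
qed

lemma bracket_derivation:
  "bracket x (bracket y z) = bracket (bracket x y) z + bracket y (bracket x z)"
proof -
  have "bracket x (bracket y z) = - bracket y (bracket z x) - bracket z (bracket x y)"
    using jacobi[of x y z] by (simp add: algebra_simps eq_neg_iff_add_eq_0)
  also have "bracket y (bracket z x) = - bracket y (bracket x z)"
    by (metis bracket_anticommute bracket_minus_right)
  also have "bracket z (bracket x y) = - bracket (bracket x y) z" by (rule bracket_anticommute)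
  finally show ?thesis by simp
qed

lemma lie_ideal_subspace: "lie_ideal J \<Longrightarrow> subspace J"
  and lie_ideal_bracket_right: "lie_ideal J \<Longrightarrow> b \<in> J \<Longrightarrow> bracket a b \<in> J"
  by (auto simp: lie_ideal_def)

lemma lie_ideal_bracket_left: "lie_ideal J \<Longrightarrow> b \<in> J \<Longrightarrow> bracket b a \<in> J"
  using bracket_anticommute[of b a] lie_ideal_bracket_right subspace_neg lie_ideal_subspace by metis

lemma lie_ideal_zero: "lie_ideal {0}"
  by (auto simp: lie_ideal_def)

lemma lie_ideal_UNIV: "lie_ideal UNIV"
  by (auto simp: lie_ideal_def)

lemma lie_ideal_Int: "lie_ideal J \<Longrightarrow> lie_ideal K \<Longrightarrow> lie_ideal (J \<inter> K)"
  by (auto simp: lie_ideal_def subspace_inter)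

definition sum_space :: "'l set \<Rightarrow> 'l set \<Rightarrow> 'l set" where
  "sum_space J K = {x + y |x y. x \<in> J \<and> y \<in> K}"

lemma subspace_sum_space: "subspace J \<Longrightarrow> subspace K \<Longrightarrow> subspace (sum_space J K)"
  unfolding sum_space_def by (rule subspace_sums)

lemma sum_space_upper:
  assumes "subspace J" "subspace K"
  shows "J \<subseteq> sum_space J K" "K \<subseteq> sum_space J K"
proof -
  show "J \<subseteq> sum_space J K"
    unfolding sum_space_def using subspace_0[OF assms(2)] by force
  show "K \<subseteq> sum_space J K"
    unfolding sum_space_def using subspace_0[OF assms(1)] by force
qed

lemma lie_ideal_sum_space: "lie_ideal J \<Longrightarrow> lie_ideal K \<Longrightarrow> lie_ideal (sum_space J K)"
  unfolding lie_ideal_def using subspace_sum_space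
  by (auto simp: sum_space_def) (metis bracket_add_right)

lemma bracket_spaceI: "a \<in> A \<Longrightarrow> b \<in> B \<Longrightarrow> bracket a b \<in> bracket_space A B"
  unfolding bracket_space_def by (intro span_base) auto

lemma subspace_bracket_space: "subspace (bracket_space A B)"
  by (simp add: bracket_space_def)

lemma bracket_space_minimal:
  assumes "subspace S" "\<And>a b. a \<in> A \<Longrightarrow> b \<in> B \<Longrightarrow> bracket a b \<in> S"
  shows "bracket_space A B \<subseteq> S"
  unfolding bracket_space_def using assms by (intro span_minimal) auto

lemma lie_ideal_bracket_space:
  assumes "lie_ideal A" "lie_ideal B"
  shows "lie_ideal (bracket_space A B)"
  unfolding lie_ideal_def
proof (intro conjI allI ballI)
  fix x v assume "v \<in> bracket_space A B"
  then show "bracket x v \<in> bracket_space A B"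
    unfolding bracket_space_def
  proof (induction rule: span_induct_alt)
    case (step c w y)
    then obtain a b where w: "w = bracket a b" "a \<in> A" "b \<in> B" by auto
    have "bracket x w \<in> bracket_space A B"
      unfolding w bracket_derivation[of x a b]
      using w assms by (intro subspace_add[OF subspace_bracket_space] bracket_spaceI)
        (auto intro: lie_ideal_bracket_right)
    then show ?case
      using step by (simp add: bracket_add_right bracket_scale_right span_add span_scale
          bracket_space_def)
  qed (simp add: span_zero)
qed (rule subspace_bracket_space)

lemma lie_ideal_lower_central: "lie_ideal J \<Longrightarrow> lie_ideal (lower_central J n)"
  by (induction n) (auto intro: lie_ideal_bracket_space)

lemma lie_ideal_derived_series: "lie_ideal J \<Longrightarrow> lie_ideal (derived_series J n)"
  by (induction n) (auto intro: lie_ideal_bracket_space)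

lemma derived_series_mono: "J \<subseteq> K \<Longrightarrow> derived_series J n \<subseteq> derived_series K n"
proof (induction n)
  case (Suc n)
  then have "derived_series J n \<subseteq> derived_series K n" by blast
  then show ?case
    unfolding derived_series.simps
    by (intro bracket_space_minimal subspace_bracket_space) (blast intro: bracket_spaceI)
qed simp

lemma derived_series_add: "derived_series (derived_series J m) n = derived_series J (m + n)"
  by (induction n) auto

lemma derived_series_sum_space:
  assumes "lie_ideal A" "lie_ideal B"
  shows "derived_series (sum_space A B) k \<subseteq> sum_space (derived_series A k) B"
proof (induction k)
  case (Suc k)
  note sub = lie_ideal_subspace[OF assms(2)]
  have "bracket x y \<in> sum_space (derived_series A (Suc k)) B"
    if xy: "x \<in> derived_series (sum_space A B) k" "y \<in> derived_series (sum_space A B) k" for x y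
  proof -
    obtain a b a' b' where *: "x = a + b" "y = a' + b'" "a \<in> derived_series A k"
        "a' \<in> derived_series A k" "b \<in> B" "b' \<in> B"
      using Suc xy unfolding sum_space_def by blast
    have "bracket x y = bracket a a' + (bracket a b' + bracket b (a' + b'))"
      unfolding * by (simp add: bracket_add_left bracket_add_right algebra_simps)
    moreover have "bracket a a' \<in> derived_series A (Suc k)" using * by (auto intro: bracket_spaceI)
    moreover have "bracket a b' + bracket b (a' + b') \<in> B"
      using * assms by (intro subspace_add[OF sub] lie_ideal_bracket_left lie_ideal_bracket_right)
    ultimately show ?thesis unfolding sum_space_def by blast
  qed
  moreover have "subspace (sum_space (derived_series A (Suc k)) B)"
    using sub by (intro subspace_sum_space) (auto intro: subspace_bracket_space)
  ultimately show ?case using bracket_space_minimal by (metis derived_series.simps(2))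
qed auto

lemma solvable_sum_space:
  assumes "lie_ideal A" "lie_ideal B" "derived_series A m = {0}" "derived_series B n = {0}"
  shows "\<exists>k. derived_series (sum_space A B) k = {0}"
proof -
  have "derived_series (sum_space A B) m \<subseteq> B"
    using derived_series_sum_space[OF assms(1,2), of m] assms(3) by (auto simp: sum_space_def)
  then have "derived_series (sum_space A B) (m + n) \<subseteq> {0}"
    using derived_series_mono[of "derived_series (sum_space A B) m" B n] assms(4)
    by (simp add: derived_series_add)
  moreover have "0 \<in> derived_series (sum_space A B) (m + n)"
    using lie_ideal_derived_series lie_ideal_sum_space assms(1,2) lie_ideal_subspace subspace_0
    by blast
  ultimately show ?thesis by blast
qed

text \<open>The power of an ideal with the convention that the zeroth power is the whole algebra; the
  lower central series starts with the first power.\<close>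

definition ideal_power :: "'l set \<Rightarrow> nat \<Rightarrow> 'l set" where
  "ideal_power J i = (case i of 0 \<Rightarrow> UNIV | Suc k \<Rightarrow> lower_central J k)"

lemma lie_ideal_ideal_power: "lie_ideal J \<Longrightarrow> lie_ideal (ideal_power J i)"
  by (auto simp: ideal_power_def lie_ideal_UNIV lie_ideal_lower_central split: nat.split)

lemma bracket_ideal_power:
  "lie_ideal J \<Longrightarrow> x \<in> ideal_power J i \<Longrightarrow> a \<in> J \<Longrightarrow> bracket x a \<in> ideal_power J (Suc i)"
  by (cases i) (auto simp: ideal_power_def lie_ideal_bracket_right intro: bracket_spaceI)

text \<open>A product of \<open>i + j\<close> factors from \<open>A\<close> or \<open>B\<close> contains \<open>i\<close> factors from \<open>A\<close> or \<open>j\<close>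
  factors from \<open>B\<close>. Multiplying by one more factor from \<open>A\<close> uses the splitting with \<open>i\<close> smaller
  by one, and similarly for \<open>B\<close>.\<close>

lemma lower_central_sum_space:
  assumes A: "lie_ideal A" and B: "lie_ideal B"
  shows "i + j = Suc k \<Longrightarrow>
    lower_central (sum_space A B) k \<subseteq> sum_space (ideal_power A i) (ideal_power B j)"
proof (induction k arbitrary: i j)
  case 0
  then consider "i = 1" "j = 0" | "i = 0" "j = 1" by linarith
  then show ?case by cases (auto simp: ideal_power_def sum_space_def)
next
  case (Suc k)
  let ?S = "sum_space (ideal_power A i) (ideal_power B j)"
  have sub: "subspace (ideal_power A i)" "subspace (ideal_power B j)" for i j
    using A B lie_ideal_ideal_power lie_ideal_subspace by blast+
  show ?case
  proof (cases "i = 0 \<or> j = 0")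
    case True
    then have "?S = UNIV"
      using sum_space_upper[OF sub(1)[of i] sub(2)[of j]] by (auto simp: ideal_power_def)
    then show ?thesis by simp
  next
    case False
    then obtain i' j' where ij: "i = Suc i'" "j = Suc j'" by (meson not0_implies_Suc)
    have "bracket x c \<in> ?S" if x: "x \<in> lower_central (sum_space A B) k" and c: "c \<in> sum_space A B" for x c
    proof -
      obtain a b where ab: "c = a + b" "a \<in> A" "b \<in> B" using c by (auto simp: sum_space_def)
      have "x \<in> sum_space (ideal_power A i') (ideal_power B j)"
        using Suc.IH[of i' j] Suc.prems x ij by auto
      then obtain p q where pq: "x = p + q" "p \<in> ideal_power A i'" "q \<in> ideal_power B j"
        by (auto simp: sum_space_def)
      have "bracket p a \<in> ideal_power A i" using bracket_ideal_power[OF A] pq ab ij by simp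
      moreover have "bracket q a \<in> ideal_power B j"
        using pq lie_ideal_ideal_power[OF B] lie_ideal_bracket_left by blast
      ultimately have xa: "bracket x a \<in> ?S"
        unfolding pq bracket_add_left sum_space_def by blast
      have "x \<in> sum_space (ideal_power A i) (ideal_power B j')"
        using Suc.IH[of i j'] Suc.prems x ij by auto
      then obtain p q where pq: "x = p + q" "p \<in> ideal_power A i" "q \<in> ideal_power B j'"
        by (auto simp: sum_space_def)
      have "bracket q b \<in> ideal_power B j" using bracket_ideal_power[OF B] pq ab ij by simp
      moreover have "bracket p b \<in> ideal_power A i"
        using pq lie_ideal_ideal_power[OF A] lie_ideal_bracket_left by blast
      ultimately have xb: "bracket x b \<in> ?S"
        unfolding pq bracket_add_left sum_space_def by blast
      show ?thesis unfolding ab bracket_add_right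
        using xa xb sub subspace_sum_space subspace_add by blast
    qed
    then show ?thesis using bracket_space_minimal[OF subspace_sum_space[OF sub]] by simp
  qed
qed

lemma nilpotent_sum_space:
  assumes "lie_ideal A" "lie_ideal B" "lower_central A m = {0}" "lower_central B n = {0}"
  shows "\<exists>k. lower_central (sum_space A B) k = {0}"
proof -
  have "lower_central (sum_space A B) (Suc (m + n)) \<subseteq> {0}"
    using lower_central_sum_space[OF assms(1,2), of "Suc m" "Suc n" "Suc (m + n)"] assms(3,4)
    by (auto simp: sum_space_def ideal_power_def)
  moreover have "0 \<in> lower_central (sum_space A B) (Suc (m + n))"
    using subspace_bracket_space subspace_0 by simp
  ultimately show ?thesis by blast
qed

definition no_abelian_ideals :: bool where
  "no_abelian_ideals \<longleftrightarrow>
     (\<forall>A. lie_ideal A \<and> (\<forall>a\<in>A. \<forall>b\<in>A. bracket a b = 0) \<longrightarrow> A = {0})"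

lemma no_abelian_idealsD:
  "no_abelian_ideals \<Longrightarrow> lie_ideal A \<Longrightarrow> (\<And>a b. a \<in> A \<Longrightarrow> b \<in> A \<Longrightarrow> bracket a b = 0) \<Longrightarrow> A = {0}"
  by (simp add: no_abelian_ideals_def)

lemma bracket_space_abelian:
  assumes "subspace A" "\<And>a b. a \<in> A \<Longrightarrow> b \<in> A \<Longrightarrow> bracket a b = 0"
  shows "bracket_space A A = {0}"
proof -
  have "bracket_space A A \<subseteq> {0}" using assms by (intro bracket_space_minimal) auto
  then show ?thesis using subspace_0[OF subspace_bracket_space] by blast
qed

text \<open>The last nonzero term of the derived series of a solvable ideal is abelian.\<close>

lemma no_abelian_ideals_solvable:
  assumes "no_abelian_ideals" "lie_ideal J" "derived_series J n = {0}"
  shows "J = {0}"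
  using assms(3)
proof (induction n)
  case (Suc n)
  have "bracket a b = 0" if "a \<in> derived_series J n" "b \<in> derived_series J n" for a b
    using bracket_spaceI[OF that] Suc.prems by simp
  then have "derived_series J n = {0}"
    using no_abelian_idealsD[OF assms(1) lie_ideal_derived_series[OF assms(2)]] by blast
  then show ?case by (rule Suc.IH)
qed simp

end

locale fd_lie_algebra = lie_algebra scale bracket + alg_closed_fd_space scale Basis
  for scale :: "'f::{alg_closed_field, field_char_0} \<Rightarrow> 'b::ab_group_add \<Rightarrow> 'b"
    and bracket Basis
begin

text \<open>In finite dimension a family of subspaces closed under sums has a greatest member, so the
  two radicals are what their names say.\<close>

lemma greatest_subspace:
  assumes P0: "P {0}" and sub: "\<And>J. P J \<Longrightarrow> subspace J"
    and sum: "\<And>J K. P J \<Longrightarrow> P K \<Longrightarrow> P (sum_space J K)"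
  shows "P (GREATEST J. P J)" "P K \<Longrightarrow> K \<subseteq> (GREATEST J. P J)"
proof -
  have "\<forall>J. P J \<longrightarrow> dim J < Suc (card Basis)"
    using dim_subset_UNIV by (simp add: dimension_def less_Suc_eq_le)
  then obtain J where J: "P J" "\<forall>K. P K \<longrightarrow> dim K \<le> dim J"
    using ex_has_greatest_nat[of P "{0}" dim "Suc (card Basis)"] P0 by blast
  have max: "K \<subseteq> J" if "P K" for K
  proof -
    have "J = sum_space J K"
      using J sum[OF J(1) that] sub sum_space_upper(1)[OF sub[OF J(1)] sub[OF that]]
      by (intro subspace_dim_equal) auto
    then show ?thesis using sum_space_upper(2)[OF sub[OF J(1)] sub[OF that]] by simp
  qed
  have eq: "(GREATEST J. P J) = J" using J(1) max by (intro Greatest_equality) auto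
  show "P (GREATEST J. P J)" "P K \<Longrightarrow> K \<subseteq> (GREATEST J. P J)" using J(1) max by (simp_all add: eq)
qed

lemma nilpotent_radical:
  shows "lie_ideal nilpotent_radical" "\<exists>n. lower_central nilpotent_radical n = {0}"
    "lie_ideal J \<Longrightarrow> lower_central J n = {0} \<Longrightarrow> J \<subseteq> nilpotent_radical"
proof -
  let ?P = "\<lambda>J. lie_ideal J \<and> (\<exists>n. lower_central J n = {0})"
  have 0: "?P {0}" using lie_ideal_zero by (auto intro: exI[of _ 0])
  have sub: "subspace J" if "?P J" for J using that lie_ideal_subspace by simp
  have sum: "?P (sum_space J K)" if J: "?P J" and K: "?P K" for J K
  proof -
    obtain m n where "lower_central J m = {0}" "lower_central K n = {0}" using J K by auto
    then show ?thesis using nilpotent_sum_space[of J K m n] lie_ideal_sum_space[of J K] J K by simp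
  qed
  have "?P nilpotent_radical"
    using greatest_subspace(1)[of ?P, OF 0 sub sum] by (simp add: nilpotent_radical_def)
  then show "lie_ideal nilpotent_radical" "\<exists>n. lower_central nilpotent_radical n = {0}" by simp_all
  assume J: "lie_ideal J" "lower_central J n = {0}"
  then have "?P J" by auto
  then show "J \<subseteq> nilpotent_radical"
    using greatest_subspace(2)[of ?P, OF 0 sub sum] by (simp add: nilpotent_radical_def)
qed

lemma solvable_radical:
  shows "lie_ideal solvable_radical" "\<exists>n. derived_series solvable_radical n = {0}"
    "lie_ideal J \<Longrightarrow> derived_series J n = {0} \<Longrightarrow> J \<subseteq> solvable_radical"
proof -
  let ?P = "\<lambda>J. lie_ideal J \<and> (\<exists>n. derived_series J n = {0})"
  have 0: "?P {0}" using lie_ideal_zero by (auto intro: exI[of _ 0])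
  have sub: "subspace J" if "?P J" for J using that lie_ideal_subspace by simp
  have sum: "?P (sum_space J K)" if J: "?P J" and K: "?P K" for J K
  proof -
    obtain m n where "derived_series J m = {0}" "derived_series K n = {0}" using J K by auto
    then show ?thesis using solvable_sum_space[of J K m n] lie_ideal_sum_space[of J K] J K by simp
  qed
  have "?P solvable_radical"
    using greatest_subspace(1)[of ?P, OF 0 sub sum] by (simp add: solvable_radical_def)
  then show "lie_ideal solvable_radical" "\<exists>n. derived_series solvable_radical n = {0}" by simp_all
  assume J: "lie_ideal J" "derived_series J n = {0}"
  then have "?P J" by auto
  then show "J \<subseteq> solvable_radical"
    using greatest_subspace(2)[of ?P, OF 0 sub sum] by (simp add: solvable_radical_def)
qed

lemma semisimple_iff_no_abelian_ideals: "semisimple \<longleftrightarrow> no_abelian_ideals"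
proof
  assume ss: "semisimple"
  show "no_abelian_ideals"
    unfolding no_abelian_ideals_def
  proof (intro allI impI)
    fix A assume A: "lie_ideal A \<and> (\<forall>a\<in>A. \<forall>b\<in>A. bracket a b = 0)"
    then have "derived_series A 1 = {0}"
      using bracket_space_abelian[of A] lie_ideal_subspace by simp
    then have "A \<subseteq> {0}" using solvable_radical(3)[of A 1] A ss by (simp add: semisimple_def)
    then show "A = {0}" using A lie_ideal_subspace subspace_0 by blast
  qed
next
  assume "no_abelian_ideals"
  then show "semisimple"
    unfolding semisimple_def using no_abelian_ideals_solvable solvable_radical(1,2) by blast
qed

lemma no_abelian_ideals_if_nilpotent_radical_zero:
  assumes "nilpotent_radical = {0}"
  shows "no_abelian_ideals"
  unfolding no_abelian_ideals_def
proof (intro allI impI)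
  fix A assume A: "lie_ideal A \<and> (\<forall>a\<in>A. \<forall>b\<in>A. bracket a b = 0)"
  then have "lower_central A 1 = {0}"
    using bracket_space_abelian[of A] lie_ideal_subspace by simp
  then have "A \<subseteq> {0}" using nilpotent_radical(3)[of A 1] A assms by simp
  then show "A = {0}" using A lie_ideal_subspace subspace_0 by blast
qed

section \<open>The theorem of Engel\<close>

text \<open>Engel's theorem for the module \<open>W / U\<close>. If \<open>M'\<close> is a maximal proper subalgebra of \<open>M\<close>, then
  the theorem for the \<open>M'\<close>-module \<open>M / M'\<close> shows that \<open>M\<close> is spanned by \<open>M'\<close> and one element \<open>w\<close>
  normalising \<open>M'\<close>. The space of vectors killed by \<open>M'\<close> modulo \<open>U\<close> is stable under \<open>w\<close>, and \<open>w\<close> acts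
  on it nilpotently.\<close>

lemma engel_relative:
  assumes "subspace M" "\<And>x y. x \<in> M \<Longrightarrow> y \<in> M \<Longrightarrow> bracket x y \<in> M"
    and "\<And>x v. x \<in> M \<Longrightarrow> \<exists>k. (bracket x ^^ k) v = 0"
    and "subspace U" "U \<subseteq> W" "U \<noteq> W"
    and "\<And>x v. x \<in> M \<Longrightarrow> v \<in> W \<Longrightarrow> bracket x v \<in> W"
    and "\<And>x v. x \<in> M \<Longrightarrow> v \<in> U \<Longrightarrow> bracket x v \<in> U"
  shows "\<exists>w\<in>W - U. \<forall>x\<in>M. bracket x w \<in> U"
  using assms
proof (induction "dim M" arbitrary: M U W rule: less_induct)
  case less
  show ?case
  proof (cases "M = {0}")
    case True
    then show ?thesis using less.prems(4,5,6) subspace_0 by fastforce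
  next
    case False
    define P where "P M' \<longleftrightarrow> subspace M' \<and> (\<forall>x\<in>M'. \<forall>y\<in>M'. bracket x y \<in> M') \<and> M' \<subset> M" for M'
    have "P {0}" using False subspace_0[OF less.prems(1)] by (auto simp: P_def)
    moreover have "\<forall>M'. P M' \<longrightarrow> dim M' < Suc (card Basis)"
      using dim_subset_UNIV by (simp add: dimension_def less_Suc_eq_le)
    ultimately obtain M' where PM': "P M'" and max: "\<forall>N. P N \<longrightarrow> dim N \<le> dim M'"
      using ex_has_greatest_nat[of P "{0}" dim "Suc (card Basis)"] by blast
    have M': "subspace M'" "\<And>x y. x \<in> M' \<Longrightarrow> y \<in> M' \<Longrightarrow> bracket x y \<in> M'" "M' \<subset> M"
      using PM' by (auto simp: P_def)
    have dim: "dim M' < dim M"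
      using M' less.prems(1) by (intro dim_psubset) (simp add: span_eq_iff[THEN iffD2])
    have IH: "\<exists>w\<in>W - U. \<forall>x\<in>M'. bracket x w \<in> U"
      if "subspace U" "U \<subseteq> W" "U \<noteq> W" "\<And>x v. x \<in> M' \<Longrightarrow> v \<in> W \<Longrightarrow> bracket x v \<in> W"
        "\<And>x v. x \<in> M' \<Longrightarrow> v \<in> U \<Longrightarrow> bracket x v \<in> U" for U W
    proof (rule less.hyps[OF dim M'(1,2) _ that])
      show "\<exists>k. (bracket x ^^ k) v = 0" if "x \<in> M'" for x v
        using less.prems(3) M'(3) that by (meson psubsetD)
    qed
    obtain w where w: "w \<in> M" "w \<notin> M'" "\<And>x. x \<in> M' \<Longrightarrow> bracket x w \<in> M'"
    proof -
      have "\<exists>w\<in>M - M'. \<forall>x\<in>M'. bracket x w \<in> M'"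
        by (rule IH) (use M' less.prems(2) in auto)
      then show ?thesis using that by auto
    qed
    define N where "N = span (insert w M')"
    have N: "\<exists>c. \<exists>m\<in>M'. x = m + scale c w" if xN: "x \<in> N" for x
    proof -
      obtain c where "x - scale c w \<in> span M'" using xN span_breakdown_eq[of x w M'] unfolding N_def by blast
      then have "x - scale c w \<in> M'" using M'(1) by (simp add: span_eq_iff[THEN iffD2])
      then show ?thesis by (intro exI[of _ c] bexI[of _ "x - scale c w"]) auto
    qed
    have M'N: "M' \<subseteq> N" "w \<in> N" unfolding N_def by (auto intro: span_base)
    have "N \<subseteq> M" unfolding N_def using w M' less.prems(1) by (intro span_minimal) auto
    have "bracket x y \<in> M'" if xy: "x \<in> N" "y \<in> N" for x y
    proof -
      obtain a m b n where *: "x = m + scale a w" "y = n + scale b w" "m \<in> M'" "n \<in> M'"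
        using N[OF xy(1)] N[OF xy(2)] by auto
      have "bracket w n \<in> M'" using w(3)[OF *(4)] subspace_neg[OF M'(1)] bracket_anticommute[of w n] by metis
      then show ?thesis unfolding * using * w M'
        by (auto simp: bracket_add_left bracket_add_right bracket_scale_left bracket_scale_right
            bracket_self intro!: subspace_add subspace_scale)
    qed
    then have closed: "\<forall>x\<in>N. \<forall>y\<in>N. bracket x y \<in> N" using M'N by blast
    have "N = M"
    proof (rule ccontr)
      assume "N \<noteq> M"
      then have "P N" using closed \<open>N \<subseteq> M\<close> by (auto simp: P_def N_def)
      moreover have "dim M' < dim N"
        using M'N w M'(1) by (intro dim_psubset) (auto simp: N_def span_eq_iff[THEN iffD2])
      ultimately show False using max by fastforce
    qed
    define W0 where "W0 = {v\<in>W. \<forall>x\<in>M'. bracket x v \<in> U}"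
    have W0_closed: "bracket w v \<in> W0" if "v \<in> W0" for v
    proof -
      have "bracket x (bracket w v) \<in> U" if x: "x \<in> M'" for x
        unfolding bracket_derivation[of x w v]
        using \<open>v \<in> W0\<close> w x less.prems(4) less.prems(8)[OF w(1)]
        by (intro subspace_add) (auto simp: W0_def)
      then show ?thesis using that w less.prems(7) by (auto simp: W0_def)
    qed
    obtain v0 where v0: "v0 \<in> W0" "v0 \<notin> U"
    proof -
      have "\<exists>w\<in>W - U. \<forall>x\<in>M'. bracket x w \<in> U"
        by (rule IH) (use M' less.prems in auto)
      then show ?thesis using that by (auto simp: W0_def)
    qed
    have pow: "(bracket w ^^ k) v0 \<in> W0" for k
      by (induction k) (auto simp: v0 W0_closed)
    define k where "k = (LEAST k. (bracket w ^^ k) v0 \<in> U)"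
    have "\<exists>k. (bracket w ^^ k) v0 \<in> U"
      using less.prems(3)[OF w(1), of v0] subspace_0[OF less.prems(4)] by metis
    then have k: "(bracket w ^^ k) v0 \<in> U" unfolding k_def by (rule LeastI_ex)
    then obtain l where l: "k = Suc l" using v0 by (cases k) auto
    define v where "v = (bracket w ^^ l) v0"
    have v: "v \<notin> U" "v \<in> W0" "bracket w v \<in> U"
      using not_less_Least[of l "\<lambda>k. (bracket w ^^ k) v0 \<in> U"] l k pow
      by (auto simp: v_def k_def[symmetric])
    have "bracket x v \<in> U" if x: "x \<in> M" for x
    proof -
      obtain c m where "x = m + scale c w" "m \<in> M'" using N x \<open>N = M\<close> by blast
      then show ?thesis using v less.prems(4)
        by (auto simp: bracket_add_left bracket_scale_left W0_def intro!: subspace_add subspace_scale)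
    qed
    then show ?thesis using v by (auto simp: W0_def)
  qed
qed

section \<open>The Killing form and Cartan's criterion\<close>

lemma endo_bracket: "endo (bracket x)"
  by (rule linearI) (auto simp: bracket_add_right bracket_scale_right)

lemma endo_comp: "endo f \<Longrightarrow> endo g \<Longrightarrow> endo (\<lambda>x. f (g x))"
  by (rule linearI) (auto simp: endo_add endo_scale)

definition killing :: "'b \<Rightarrow> 'b \<Rightarrow> 'f" where
  "killing x y = trace (\<lambda>z. bracket x (bracket y z))"

lemma killing_add_left: "killing (x + y) z = killing x z + killing y z"
  by (simp add: killing_def bracket_add_left trace_add)

lemma killing_scale_left: "killing (scale c x) z = c * killing x z"
  by (simp add: killing_def bracket_scale_left trace_scale)

lemma killing_commute: "killing x y = killing y x"
  unfolding killing_def by (rule trace_commute) (rule endo_bracket)+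

lemma killing_add_right: "killing x (y + z) = killing x y + killing x z"
  by (metis killing_add_left killing_commute)

lemma killing_scale_right: "killing x (scale c z) = c * killing x z"
  by (metis killing_scale_left killing_commute)

lemma killing_invariant: "killing (bracket x y) z = killing x (bracket y z)"
proof -
  have "killing (bracket x y) z
      = trace (\<lambda>v. bracket x (bracket y (bracket z v)) - bracket y (bracket x (bracket z v)))"
    unfolding killing_def by (simp add: bracket_derivation[of x y])
  also have "\<dots> = trace (\<lambda>v. bracket x (bracket y (bracket z v)))
      - trace (\<lambda>v. bracket y (bracket x (bracket z v)))" by (rule trace_diff)
  also have "trace (\<lambda>v. bracket y (bracket x (bracket z v))) = trace (\<lambda>v. bracket x (bracket z (bracket y v)))"
    by (rule trace_commute[OF endo_bracket endo_comp[OF endo_bracket endo_bracket]])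
  also have "trace (\<lambda>v. bracket x (bracket y (bracket z v))) - trace (\<lambda>v. bracket x (bracket z (bracket y v)))
      = trace (\<lambda>v. bracket x (bracket y (bracket z v)) - bracket x (bracket z (bracket y v)))"
    by (rule trace_diff[symmetric])
  also have "\<dots> = killing x (bracket y z)"
    unfolding killing_def bracket_diff_right[symmetric] by (simp add: bracket_derivation[of y z])
  finally show ?thesis .
qed

text \<open>By the Leibniz rule \<open>(D - a - b) [u, v] = [(D - a) u, v] + [u, (D - b) v]\<close> for the derivation
  \<open>D = ad x\<close>.\<close>

lemma bracket_gen_eig:
  assumes "u \<in> gen_eig (bracket x) a" "v \<in> gen_eig (bracket x) b"
  shows "bracket u v \<in> gen_eig (bracket x) (a + b)"
proof -
  note D = endo_bracket[of x] and sub = subspace_gen_eig[OF endo_bracket[of x]]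
  have "\<forall>v\<in>gen_eig (bracket x) b. bracket u v \<in> gen_eig (bracket x) (a + b)"
  proof (rule gen_eig_induct[OF D assms(1)], goal_cases)
    case 1
    show ?case using subspace_0[OF sub] by simp
  next
    case u: (2 u)
    show ?case
    proof
      fix v assume v: "v \<in> gen_eig (bracket x) b"
      show "bracket u v \<in> gen_eig (bracket x) (a + b)"
      proof (rule gen_eig_induct[OF D v], goal_cases)
        case 1
        show ?case using subspace_0[OF sub] by simp
      next
        case v: (2 v)
        have "shift (bracket x) (a + b) (bracket u v)
            = bracket (shift (bracket x) a u) v + bracket u (shift (bracket x) b v)"
          by (simp add: shift_def bracket_derivation[of x u v] bracket_diff_left bracket_diff_right
              bracket_scale_left bracket_scale_right algebra_simps)
        then have "shift (bracket x) (a + b) (bracket u v) \<in> gen_eig (bracket x) (a + b)"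
          using u v subspace_add[OF sub] by simp
        then show ?case using gen_eig_shift_iff[OF D] by blast
      qed
    qed
  qed
  then show ?thesis using assms(2) by blast
qed

text \<open>Let \<open>x\<close> be a sum of commutators of elements of \<open>K\<close>. If \<open>f\<close> is an additive function on the
  field, then the operator \<open>y\<close> that multiplies the generalised eigenspace of \<open>ad x\<close> for \<open>a\<close> by
  \<open>f(a)\<close> is a derivation, and invariance of the trace form gives \<open>tr (ad x \<circ> y) = 0\<close>. In a
  triangular basis this trace is \<open>\<Sum> a f(a)\<close> over the eigenvalues with multiplicities. If \<open>f\<close> has
  rational values and is linear over the rationals, then \<open>f\<close> maps the sum to \<open>\<Sum> f(a)\<^sup>2 = 0\<close>, whence
  \<open>f\<close> vanishes on all eigenvalues.\<close>

lemma killing_zero_imp_ad_nilpotent: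
  assumes K: "lie_ideal K" and zero: "\<And>p q. p \<in> K \<Longrightarrow> q \<in> K \<Longrightarrow> killing p q = 0"
    and x: "x \<in> bracket_space K K"
  shows "\<exists>m. (bracket x ^^ m) v = 0"
proof -
  note D = endo_bracket[of x]
  let ?V = "gen_eig (bracket x)"
  obtain B where B: "is_basis B" and eig: "\<And>b. b \<in> B \<Longrightarrow> b \<in> ?V (representation B (bracket x b) b)"
    using exists_triangular_basis[OF D] by auto
  define \<alpha> where "\<alpha> b = representation B (bracket x b) b" for b
  have eig: "b \<in> ?V (\<alpha> b)" if "b \<in> B" for b using eig[OF that] by (simp add: \<alpha>_def)
  have finB: "finite B" using B by (rule is_basis_finite)
  have "\<alpha> b0 = 0" if b0: "b0 \<in> B" for b0
  proof (rule ccontr)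
    assume \<alpha>: "\<alpha> b0 \<noteq> 0"
    obtain f :: "'f \<Rightarrow> rat" where f: "\<And>x y. f (x + y) = f x + f y"
        "\<And>r x. f (of_rat r * x) = r * f x" "f (\<alpha> b0) = 1"
      using exists_rational_functional[OF \<alpha>] by auto
    define \<phi> where "\<phi> a = (of_rat (f a) :: 'f)" for a
    have \<phi>_add: "\<phi> (a + b) = \<phi> a + \<phi> b" for a b by (simp add: \<phi>_def f of_rat_add)
    define y where "y v = (\<Sum>b\<in>B. scale (representation B v b * \<phi> (\<alpha> b)) b)" for v
    have y: "endo y"
      by (rule linearI) (simp_all add: y_def coord_add[OF B] coord_scale[OF B] sum.distrib
          scale_left_distrib distrib_right scale_sum_right mult.assoc)
    have y_eig: "y v = scale (\<phi> a) v" if v: "v \<in> ?V a" for v a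
    proof -
      define C where "C = insert a (\<alpha> ` B)"
      define part where "part c = (\<Sum>b\<in>{b\<in>B. \<alpha> b = c}. scale (representation B v b) b)" for c
      have finC: "finite C" using finB by (simp add: C_def)
      have part_eig: "part c \<in> ?V c" for c
        unfolding part_def using eig
        by (intro subspace_sum[OF subspace_gen_eig[OF D]] subspace_scale[OF subspace_gen_eig[OF D]]) auto
      have "(\<Sum>c\<in>C. part c) = v"
        unfolding part_def
        by (subst sum.group) (use finB finC coord_expand[OF B] in \<open>auto simp: C_def\<close>)
      then have "(\<Sum>c\<in>C. part c - (if c = a then v else 0)) = 0"
        using finC by (simp add: sum_subtractf sum.delta C_def)
      then have "part c - (if c = a then v else 0) = 0" if "c \<in> C" for c
        using part_eig v that subspace_diff[OF subspace_gen_eig[OF D]]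
        by (intro gen_eig_direct[OF D finC, of "\<lambda>c. part c - (if c = a then v else 0)"]) auto
      then have part: "part c = (if c = a then v else 0)" if "c \<in> C" for c using that by auto
      have "y v = (\<Sum>c\<in>C. \<Sum>b\<in>{b\<in>B. \<alpha> b = c}. scale (representation B v b * \<phi> (\<alpha> b)) b)"
        unfolding y_def by (subst sum.group) (use finB finC in \<open>auto simp: C_def\<close>)
      also have "\<dots> = (\<Sum>c\<in>C. scale (\<phi> c) (part c))"
        unfolding part_def by (intro sum.cong) (auto simp: scale_sum_right mult.commute)
      also have "\<dots> = scale (\<phi> a) v"
        using finC part by (simp add: if_distrib[of "scale _"] sum.delta C_def cong: if_cong)
      finally show ?thesis .
    qed
    \<comment> \<open>For a derivation \<open>y\<close> the commutator of \<open>ad q\<close> and \<open>y\<close> is \<open>- ad (y q)\<close>, and here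
      \<open>y q = \<phi> c q\<close>.\<close>
    have y_comm: "bracket q (y v) - y (bracket q v) = scale (- \<phi> c) (bracket q v)"
      if q: "q \<in> ?V c" for q c v
    proof -
      have "v \<in> span B" using B by (simp add: is_basis_def)
      then show ?thesis
      proof (induction rule: span_induct_alt)
        case (step r b w)
        have "bracket q (y b) = scale (\<phi> (\<alpha> b)) (bracket q b)"
          using y_eig[OF eig[OF step(1)]] by (simp add: bracket_scale_right)
        moreover have "y (bracket q b) = scale (\<phi> (c + \<alpha> b)) (bracket q b)"
          using y_eig[OF bracket_gen_eig[OF q eig[OF step(1)]]] .
        ultimately have "bracket q (y b) - y (bracket q b) = scale (- \<phi> c) (bracket q b)"
          by (simp add: \<phi>_add scale_left_distrib)
        then have b: "bracket q (y b) = y (bracket q b) + scale (- \<phi> c) (bracket q b)"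
          by (simp add: algebra_simps)
        have w: "bracket q (y w) = y (bracket q w) + scale (- \<phi> c) (bracket q w)"
          using step(2) by (simp add: algebra_simps)
        show ?case
          by (simp add: bracket_add_right bracket_scale_right endo_add[OF y] endo_scale[OF y] b w
              scale_right_distrib scale_right_diff_distrib mult.commute)
      qed (simp add: endo_0[OF y])
    qed
    define \<tau> where "\<tau> z = trace (\<lambda>v. bracket z (y v))" for z
    have \<tau>_add: "\<tau> (z + w) = \<tau> z + \<tau> w" for z w
      by (simp add: \<tau>_def bracket_add_left trace_add)
    have \<tau>_scale: "\<tau> (scale c z) = c * \<tau> z" for c z
      by (simp add: \<tau>_def bracket_scale_left trace_scale)
    have \<tau>_0: "\<tau> 0 = 0" using \<tau>_scale[of 0 0] by simp
    have eig_case: "\<tau> (bracket p q) = 0" if p: "p \<in> K" and q: "q \<in> ?V c \<inter> K" for p q c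
    proof -
      have "\<tau> (bracket p q) = trace (\<lambda>v. bracket p (bracket q (y v)) - bracket q (bracket p (y v)))"
        unfolding \<tau>_def by (simp add: bracket_derivation[of p q])
      also have "\<dots> = trace (\<lambda>v. bracket p (bracket q (y v))) - trace (\<lambda>v. bracket q (bracket p (y v)))"
        by (rule trace_diff)
      also have "trace (\<lambda>v. bracket q (bracket p (y v))) = trace (\<lambda>v. bracket p (y (bracket q v)))"
        by (rule trace_commute[OF endo_bracket endo_comp[OF endo_bracket y]])
      also have "trace (\<lambda>v. bracket p (bracket q (y v))) - trace (\<lambda>v. bracket p (y (bracket q v)))
          = trace (\<lambda>v. bracket p (bracket q (y v) - y (bracket q v)))"
        unfolding bracket_diff_right by (rule trace_diff[symmetric])
      also have "\<dots> = - \<phi> c * killing p q"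
        using q by (simp only: y_comm[of q c] Int_iff bracket_scale_right killing_def trace_scale)
      finally show ?thesis using zero p q by simp
    qed
    have comm_case: "\<tau> (bracket p q) = 0" if p: "p \<in> K" and q: "q \<in> K" for p q
    proof -
      have "q \<in> span (\<Union>a. ?V a \<inter> K)"
        using K q by (intro gen_eig_span[OF D]) (auto simp: lie_ideal_def)
      then show ?thesis
      proof (induction rule: span_induct_alt)
        case (step c z w)
        then show ?case using eig_case[OF p] by (auto simp: bracket_add_right bracket_scale_right \<tau>_add \<tau>_scale)
      qed (simp add: \<tau>_0)
    qed
    have "\<tau> x = 0"
      using x unfolding bracket_space_def
    proof (induction rule: span_induct_alt)
      case (step c z w)
      then show ?case using comm_case by (auto simp: \<tau>_add \<tau>_scale)
    qed (simp add: \<tau>_0)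
    moreover have "\<tau> x = (\<Sum>b\<in>B. \<phi> (\<alpha> b) * \<alpha> b)"
      unfolding \<tau>_def
      by (subst trace_basis[OF B endo_comp[OF D y]], intro sum.cong)
         (auto simp: y_eig[OF eig] bracket_scale_right coord_scale[OF B] \<alpha>_def)
    ultimately have sum0: "(\<Sum>b\<in>B. \<phi> (\<alpha> b) * \<alpha> b) = 0" by simp
    have "f 0 = 0" using f(2)[of 0 0] by simp
    then have "f (\<Sum>b\<in>A. \<phi> (\<alpha> b) * \<alpha> b) = (\<Sum>b\<in>A. f (\<alpha> b) * f (\<alpha> b))" for A
      by (induction A rule: infinite_finite_induct) (auto simp: f(1,2) \<phi>_def)
    then have "(\<Sum>b\<in>B. f (\<alpha> b) * f (\<alpha> b)) = 0" using sum0 \<open>f 0 = 0\<close> by metis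
    then have "f (\<alpha> b0) * f (\<alpha> b0) = 0"
      using b0 finB by (subst (asm) sum_nonneg_eq_0_iff) auto
    then show False using f(3) by simp
  qed
  then have "B \<subseteq> ?V 0" using eig by force
  then have "span B \<subseteq> ?V 0" by (intro span_minimal subspace_gen_eig[OF D])
  then have "v \<in> ?V 0" using B by (auto simp: is_basis_def)
  moreover have "shift (bracket x) 0 = bracket x" by (auto simp: shift_def)
  ultimately show ?thesis by (simp add: gen_eig_def)
qed

text \<open>Cartan's criterion. The elements of \<open>K' = [K, K]\<close> act nilpotently, so by Engel's theorem
  \<open>K'\<close> has a nonzero center unless \<open>K' = 0\<close>. That center is an abelian ideal of the whole algebra.\<close>

lemma killing_zero_ideal:
  assumes ss: "no_abelian_ideals" and K: "lie_ideal K"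
    and zero: "\<And>p q. p \<in> K \<Longrightarrow> q \<in> K \<Longrightarrow> killing p q = 0"
  shows "K = {0}"
proof -
  define K' where "K' = bracket_space K K"
  have K': "lie_ideal K'" unfolding K'_def using K by (intro lie_ideal_bracket_space)
  have nil: "\<exists>m. (bracket x ^^ m) v = 0" if "x \<in> K'" for x v
    using killing_zero_imp_ad_nilpotent[OF K zero] that by (simp add: K'_def)
  have "K' = {0}"
  proof (rule ccontr)
    assume "K' \<noteq> {0}"
    then have "\<exists>w\<in>K' - {0}. \<forall>x\<in>K'. bracket x w \<in> {0}"
      using K' nil subspace_0[OF lie_ideal_subspace[OF K']]
      by (intro engel_relative) (auto simp: lie_ideal_def)
    then obtain w where w: "w \<in> K'" "w \<noteq> 0" "\<And>x. x \<in> K' \<Longrightarrow> bracket x w = 0" by auto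
    define Z where "Z = {z\<in>K'. \<forall>x\<in>K'. bracket x z = 0}"
    have "lie_ideal Z"
      unfolding lie_ideal_def
    proof (intro conjI allI ballI)
      show "subspace Z"
        using lie_ideal_subspace[OF K'] unfolding Z_def
        by (auto simp: subspace_def bracket_add_right bracket_scale_right)
    next
      fix a z assume z: "z \<in> Z"
      have "bracket x (bracket a z) = 0" if "x \<in> K'" for x
        using z that lie_ideal_bracket_left[OF K' that, of a]
        by (simp add: bracket_derivation[of x a z] Z_def)
      then show "bracket a z \<in> Z" using z lie_ideal_bracket_right[OF K'] by (auto simp: Z_def)
    qed
    moreover have "bracket a b = 0" if "a \<in> Z" "b \<in> Z" for a b using that by (auto simp: Z_def)
    ultimately have "Z = {0}" using no_abelian_idealsD[OF ss] by blast
    then show False using w by (auto simp: Z_def)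
  qed
  then have "bracket a b = 0" if "a \<in> K" "b \<in> K" for a b
    using bracket_spaceI[OF that] by (simp add: K'_def)
  then show ?thesis using no_abelian_idealsD[OF ss K] by blast
qed

lemma lie_ideal_killing_orthogonal:
  assumes J: "lie_ideal J"
  shows "lie_ideal {x. \<forall>j\<in>J. killing x j = 0}"
  unfolding lie_ideal_def
proof (intro conjI allI ballI)
  show "subspace {x. \<forall>j\<in>J. killing x j = 0}"
    using killing_scale_left[of 0 0]
    by (auto simp: subspace_def killing_add_left killing_scale_left)
next
  fix a b assume b: "b \<in> {x. \<forall>j\<in>J. killing x j = 0}"
  have "killing (bracket a b) j = 0" if "j \<in> J" for j
  proof -
    have "killing (bracket a b) j = - killing b (bracket a j)"
      using killing_scale_left[of "-1" "bracket b a" j]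
      by (subst bracket_anticommute) (simp add: killing_invariant)
    then show ?thesis using b lie_ideal_bracket_right[OF J that] by simp
  qed
  then show "bracket a b \<in> {x. \<forall>j\<in>J. killing x j = 0}" by simp
qed

lemma killing_nondegenerate:
  assumes "no_abelian_ideals" "\<And>y. killing x y = 0"
  shows "x = 0"
proof -
  have "{x. \<forall>j\<in>UNIV. killing x j = 0} = {0}"
    using lie_ideal_killing_orthogonal[OF lie_ideal_UNIV] by (intro killing_zero_ideal[OF assms(1)]) auto
  then show ?thesis using assms(2) by blast
qed

lemma center_zero:
  assumes "no_abelian_ideals" "\<And>y. bracket x y = 0"
  shows "x = 0"
proof (rule killing_nondegenerate[OF assms(1)])
  show "killing x y = 0" for y
    using trace_scale[of 0 "\<lambda>_. 0"] by (simp add: killing_def assms(2))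
qed

text \<open>The orthogonal complement of \<open>J\<close> with respect to the Killing form is nonzero for
  dimension reasons, and meets \<open>J\<close> in \<open>0\<close> by Cartan's criterion.\<close>

lemma proper_ideal_centralizer_nonzero:
  assumes ss: "no_abelian_ideals" and J: "lie_ideal J" and "J \<noteq> UNIV"
  shows "\<exists>c. c \<noteq> 0 \<and> (\<forall>j\<in>J. bracket c j = 0)"
proof -
  obtain S where S: "S \<subseteq> J" "independent S" "J \<subseteq> span S" "card S = dim J"
    using basis_exists by blast
  have fin: "finite S" using S finiteI_independent by blast
  have "dim J < dim UNIV"
    using \<open>J \<noteq> UNIV\<close> lie_ideal_subspace[OF J] by (intro dim_psubset) (auto simp: span_eq_iff[THEN iffD2])
  then have "card S < card Basis" using S by (simp add: dim_UNIV)
  then obtain c where c: "\<exists>b\<in>Basis. c b \<noteq> 0"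
      "\<forall>s\<in>S. (\<Sum>b\<in>Basis. killing b s * c b) = 0"
    using homogeneous_system_nontrivial_solution[of S Basis "\<lambda>s b. killing b s"] fin finite_Basis
    by auto
  define v where "v = (\<Sum>b\<in>Basis. scale (c b) b)"
  have "v \<noteq> 0"
    using c(1) independent_Basis finite_Basis unfolding v_def
    by (metis independentD subset_refl)
  have k0: "killing 0 y = 0" for y using killing_scale_left[of 0 0 y] by simp
  have ksum: "killing (\<Sum>b\<in>A. scale (c b) b) s = (\<Sum>b\<in>A. killing b s * c b)" for s A
    by (induction A rule: infinite_finite_induct) (auto simp: k0 killing_add_left killing_scale_left)
  let ?O = "{x. \<forall>j\<in>J. killing x j = 0}"
  have "killing v j = 0" if "j \<in> J" for j
  proof -
    have "j \<in> span S" using S that by auto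
    then show ?thesis
    proof (induction rule: span_induct_alt)
      case base
      show ?case using killing_scale_right[of v 0 0] by simp
    next
      case (step r s w)
      then show ?case using c(2) ksum[of Basis s]
        by (simp add: v_def killing_add_right killing_scale_right)
    qed
  qed
  then have v: "v \<in> ?O" by simp
  have "J \<inter> ?O = {0}"
    using lie_ideal_Int[OF J lie_ideal_killing_orthogonal[OF J]]
    by (intro killing_zero_ideal[OF ss]) (auto simp: killing_commute)
  moreover have "bracket v j \<in> J \<inter> ?O" if "j \<in> J" for j
    using that v lie_ideal_bracket_right[OF J] lie_ideal_bracket_left[OF lie_ideal_killing_orthogonal[OF J]]
    by blast
  ultimately show ?thesis using \<open>v \<noteq> 0\<close> by blast
qed

end

section \<open>Dimensions of quotients\<close>

definition independent_mod ::
  "('b \<Rightarrow>\<^sub>0 'f::field) set \<Rightarrow> ('b \<Rightarrow>\<^sub>0 'f) set \<Rightarrow> bool" where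
  "independent_mod W B \<longleftrightarrow>
     (\<forall>t u. finite t \<and> t \<subseteq> B \<and> (\<Sum>v\<in>t. smult_free (u v) v) \<in> W \<longrightarrow> (\<forall>v\<in>t. u v = 0))"

lemma quotient_basis_iff:
  "quotient_basis U W B \<longleftrightarrow> B \<subseteq> U \<and> U \<subseteq> free.span (B \<union> W) \<and> independent_mod W B"
  by (simp add: quotient_basis_def independent_mod_def)

text \<open>Finitely many functionals that separate \<open>U\<close> modulo \<open>W\<close> make \<open>U/W\<close> finite dimensional. A
  quotient basis then exists; its size is at most the number of functionals, and at least the size
  of any family independent modulo \<open>W\<close>.\<close>

locale coordinate_functionals =
  fixes U W :: "('b \<Rightarrow>\<^sub>0 'f::field) set" and S :: "'s set" and \<phi> :: "'s \<Rightarrow> ('b \<Rightarrow>\<^sub>0 'f) \<Rightarrow> 'f"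
  assumes S: "finite S"
    and U: "free.subspace U" and W: "free.subspace W"
    and \<phi>_add: "\<And>s x y. \<phi> s (x + y) = \<phi> s x + \<phi> s y"
    and \<phi>_scale: "\<And>s c x. \<phi> s (smult_free c x) = c * \<phi> s x"
    and separate: "\<And>u. u \<in> U \<Longrightarrow> (\<And>s. s \<in> S \<Longrightarrow> \<phi> s u = 0) \<Longrightarrow> u \<in> W"
begin

lemma independent_mod_finite:
  assumes "B \<subseteq> U" "independent_mod W B"
  shows "finite B \<and> card B \<le> card S"
proof -
  have bound: "card t \<le> card S" if t: "finite t" "t \<subseteq> B" for t
  proof (rule ccontr)
    assume "\<not> ?thesis"
    then obtain c where c: "\<exists>v\<in>t. c v \<noteq> 0" "\<forall>s\<in>S. (\<Sum>v\<in>t. \<phi> s v * c v) = 0"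
      using homogeneous_system_nontrivial_solution[of S t \<phi>] S t by auto
    define z where "z = (\<Sum>v\<in>t. smult_free (c v) v)"
    have \<phi>0: "\<phi> s 0 = 0" for s using \<phi>_scale[of s 0 0] by simp
    have "\<phi> s (\<Sum>v\<in>A. smult_free (c v) v) = (\<Sum>v\<in>A. \<phi> s v * c v)" for s A
      by (induction A rule: infinite_finite_induct) (auto simp: \<phi>0 \<phi>_add \<phi>_scale)
    then have "\<phi> s z = 0" if "s \<in> S" for s using c(2) that by (simp add: z_def)
    moreover have "z \<in> U"
      unfolding z_def using t assms by (intro free.subspace_sum[OF U] free.subspace_scale[OF U]) auto
    ultimately have "z \<in> W" using separate by blast
    then show False using assms(2) t c(1) unfolding independent_mod_def z_def by blast
  qed
  have "finite B"
  proof (rule ccontr)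
    assume "infinite B"
    then obtain t where "t \<subseteq> B" "finite t" "card t = Suc (card S)"
      using infinite_arbitrarily_large by blast
    then show False using bound[of t] by simp
  qed
  then show ?thesis using bound by blast
qed

text \<open>A largest subset of \<open>U\<close> independent modulo \<open>W\<close> spans.\<close>

lemma exists_quotient_basis: "\<exists>B. quotient_basis U W B"
proof -
  define P where "P B \<longleftrightarrow> B \<subseteq> U \<and> independent_mod W B" for B
  have "P {}" by (auto simp: P_def independent_mod_def)
  moreover have "\<forall>B. P B \<longrightarrow> card B < Suc (card S)"
    using independent_mod_finite by (simp add: P_def less_Suc_eq_le)
  ultimately obtain B where B: "P B" "\<forall>C. P C \<longrightarrow> card C \<le> card B"
    using ex_has_greatest_nat[of P "{}" card "Suc (card S)"] by blast
  have fin: "finite B" using B(1) independent_mod_finite by (simp add: P_def)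
  have "u \<in> free.span (B \<union> W)" if u: "u \<in> U" for u
  proof (cases "u \<in> B")
    case True
    then show ?thesis by (intro free.span_base) auto
  next
    case False
    then have "\<not> P (insert u B)" using B(2) fin by fastforce
    then have "\<not> independent_mod W (insert u B)" using B(1) u by (auto simp: P_def)
    then obtain t c where t: "finite t" "t \<subseteq> insert u B" "(\<Sum>v\<in>t. smult_free (c v) v) \<in> W"
        "\<exists>v\<in>t. c v \<noteq> 0"
      unfolding independent_mod_def by blast
    define t' where "t' = t - {u}"
    have t': "finite t'" "t' \<subseteq> B" using t by (auto simp: t'_def)
    define r where "r = (if u \<in> t then c u else 0)"
    have split: "(\<Sum>v\<in>t. smult_free (c v) v) = smult_free r u + (\<Sum>v\<in>t'. smult_free (c v) v)"
      using t(1) sum.remove[of t u "\<lambda>v. smult_free (c v) v"] by (simp add: t'_def r_def)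
    have "r \<noteq> 0"
    proof
      assume r: "r = 0"
      then have "(\<Sum>v\<in>t'. smult_free (c v) v) \<in> W" using split t(3) by simp
      then have "\<forall>v\<in>t'. c v = 0"
        using B(1) t' unfolding P_def independent_mod_def by blast
      then show False using t(4) r by (auto simp: t'_def r_def split: if_splits)
    qed
    have "(\<Sum>v\<in>t'. smult_free (c v) v) \<in> free.span (B \<union> W)"
      using t' by (intro free.span_sum free.span_scale free.span_base) auto
    moreover have "(\<Sum>v\<in>t. smult_free (c v) v) \<in> free.span (B \<union> W)"
      using t(3) by (intro free.span_base) auto
    ultimately have "(\<Sum>v\<in>t. smult_free (c v) v) - (\<Sum>v\<in>t'. smult_free (c v) v) \<in> free.span (B \<union> W)"
      by (rule free.span_diff[rotated])
    then have "smult_free r u \<in> free.span (B \<union> W)" unfolding split by simp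
    then have "smult_free (1 / r) (smult_free r u) \<in> free.span (B \<union> W)" by (rule free.span_scale)
    then show ?thesis using \<open>r \<noteq> 0\<close> by simp
  qed
  then have "quotient_basis U W B" using B(1) by (auto simp: quotient_basis_iff P_def)
  then show ?thesis by blast
qed

lemma quotient_dim_le: "quotient_dim U W \<le> card S"
proof -
  define B where "B = (SOME B. quotient_basis U W B)"
  have "quotient_basis U W B" unfolding B_def by (rule someI_ex[OF exists_quotient_basis])
  then show ?thesis
    using independent_mod_finite[of B] by (simp add: quotient_basis_iff quotient_dim_def B_def)
qed

lemma quotient_dim_ge:
  assumes J: "finite J" "\<And>j. j \<in> J \<Longrightarrow> p j \<in> U"
    and indep: "\<And>c. (\<Sum>j\<in>J. smult_free (c j) (p j)) \<in> W \<Longrightarrow> \<forall>j\<in>J. c j = 0"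
  shows "card J \<le> quotient_dim U W"
proof (rule ccontr)
  define B where "B = (SOME B. quotient_basis U W B)"
  have B: "quotient_basis U W B" unfolding B_def by (rule someI_ex[OF exists_quotient_basis])
  then have fin: "finite B" using independent_mod_finite by (simp add: quotient_basis_iff)
  assume "\<not> ?thesis"
  then have less: "card B < card J" by (simp add: quotient_dim_def B_def)
  have "\<exists>a. p j - (\<Sum>b\<in>B. smult_free (a b) b) \<in> W" if j: "j \<in> J" for j
  proof -
    have "p j \<in> free.span (B \<union> W)" using J(2)[OF j] B by (auto simp: quotient_basis_iff)
    then obtain x y where xy: "p j = x + y" "x \<in> free.span B" "y \<in> free.span W"
      unfolding free.span_Un by blast
    then obtain a where "x = (\<Sum>b\<in>B. smult_free (a b) b)"
      using free.span_finite[OF fin] by auto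
    then show ?thesis using xy W by (intro exI[of _ a]) (simp add: free.span_eq_iff[THEN iffD2])
  qed
  then obtain a where a: "\<And>j. j \<in> J \<Longrightarrow> p j - (\<Sum>b\<in>B. smult_free (a j b) b) \<in> W" by metis
  obtain c where c: "\<exists>j\<in>J. c j \<noteq> 0" "\<forall>b\<in>B. (\<Sum>j\<in>J. a j b * c j) = 0"
    using homogeneous_system_nontrivial_solution[of B J "\<lambda>b j. a j b"] fin J(1) less by auto
  have "(\<Sum>j\<in>J. smult_free (c j) (\<Sum>b\<in>B. smult_free (a j b) b))
      = (\<Sum>b\<in>B. smult_free (\<Sum>j\<in>J. a j b * c j) b)"
    by (simp add: free.scale_sum_right free.scale_sum_left mult.commute) (rule sum.swap)
  also have "\<dots> = 0" using c(2) by simp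
  finally have "(\<Sum>j\<in>J. smult_free (c j) (p j))
      = (\<Sum>j\<in>J. smult_free (c j) (p j - (\<Sum>b\<in>B. smult_free (a j b) b)))"
    by (simp add: free.scale_right_diff_distrib sum_subtractf)
  also have "\<dots> \<in> W"
    using a by (intro free.subspace_sum[OF W] free.subspace_scale[OF W]) auto
  finally show False using indep c(1) by blast
qed

end

section \<open>Evaluation of polynomials\<close>

context lie_algebra
begin

definition lin_ext :: "('c \<Rightarrow> 'l) \<Rightarrow> ('c \<Rightarrow>\<^sub>0 'f) \<Rightarrow> 'l" where
  "lin_ext f p = (\<Sum>m\<in>Poly_Mapping.keys p. scale (Poly_Mapping.lookup p m) (f m))"

lemma lin_ext_superset:
  fixes p :: "'c \<Rightarrow>\<^sub>0 'f"
  assumes "finite A" "Poly_Mapping.keys p \<subseteq> A"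
  shows "lin_ext f p = (\<Sum>m\<in>A. scale (Poly_Mapping.lookup p m) (f m))"
  unfolding lin_ext_def using assms by (intro sum.mono_neutral_left) (auto simp: in_keys_iff)

lemma lin_ext_add: "lin_ext f (p + q) = lin_ext f p + lin_ext f q"
proof -
  let ?A = "Poly_Mapping.keys p \<union> Poly_Mapping.keys q"
  show ?thesis
    by (subst (1 2 3) lin_ext_superset[where A = ?A])
       (use Poly_Mapping.keys_add[of p q] in \<open>auto simp: lookup_add scale_left_distrib sum.distrib\<close>)
qed

lemma lin_ext_smult: "lin_ext f (smult_free c p) = scale c (lin_ext f p)"
  by (subst (1 2) lin_ext_superset[where A = "Poly_Mapping.keys p"])
     (auto simp: in_keys_iff scale_sum_right)

lemma lin_ext_single: "lin_ext f (Poly_Mapping.single m c) = scale c (f m)"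
  by (simp add: lin_ext_def)

lemma lin_ext_0 [simp]: "lin_ext f 0 = 0"
  by (simp add: lin_ext_def)

lemma lin_ext_minus: "lin_ext f (- p) = - lin_ext f p"
  using lin_ext_add[of f p "- p"] by (simp add: add_eq_0_iff)

lemma lin_ext_diff: "lin_ext f (p - q) = lin_ext f p - lin_ext f q"
  using lin_ext_add[of f p "- q"] by (simp add: lin_ext_minus)

lemma lin_ext_sum: "lin_ext f (\<Sum>i\<in>I. p i) = (\<Sum>i\<in>I. lin_ext f (p i))"
  by (induction I rule: infinite_finite_induct) (auto simp: lin_ext_add)

lemma lin_ext_sum_list: "lin_ext f (\<Sum>x\<leftarrow>xs. p x) = (\<Sum>x\<leftarrow>xs. lin_ext f (p x))"
  by (induction xs) (auto simp: lin_ext_add)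

lemma poly_mapping_expand:
  fixes p :: "'c \<Rightarrow>\<^sub>0 'f"
  shows "p = (\<Sum>m\<in>Poly_Mapping.keys p. smult_free (Poly_Mapping.lookup p m) (basis_vec m))"
  by (rule poly_mapping_eqI)
     (auto simp: lookup_sum lookup_single when_def in_keys_iff if_distrib[of "(*) _"] cong: if_cong)

end

definition multilin :: "('f \<Rightarrow> 'l \<Rightarrow> 'l::ab_group_add) \<Rightarrow> nat set \<Rightarrow> ((nat \<Rightarrow> 'l) \<Rightarrow> 'l) \<Rightarrow> bool" where
  "multilin s A F \<longleftrightarrow>
     (\<forall>a i x y c. i \<in> A \<longrightarrow> F (a(i := s c x + y)) = s c (F (a(i := x))) + F (a(i := y))) \<and>
     (\<forall>a b. (\<forall>i\<in>A. a i = b i) \<longrightarrow> F a = F b)"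

context lie_algebra
begin

lemma multilin_step:
  "multilin scale A F \<Longrightarrow> i \<in> A \<Longrightarrow>
    F (a(i := scale c x + y)) = scale c (F (a(i := x))) + F (a(i := y))"
  by (simp add: multilin_def)

lemma multilin_cong:
  "multilin scale A F \<Longrightarrow> (\<And>i. i \<in> A \<Longrightarrow> a i = b i) \<Longrightarrow> F a = F b"
  unfolding multilin_def by blast

lemma multilin_zero_slot: "multilin scale A F \<Longrightarrow> i \<in> A \<Longrightarrow> F (a(i := 0)) = 0"
  using multilin_step[of A F i a 1 0 0] by simp

lemma multilin_zero:
  assumes F: "multilin scale A F" and "finite A" and B: "span B = UNIV"
    and zero: "\<And>a. (\<forall>i\<in>A. a i \<in> B) \<Longrightarrow> F a = 0"
  shows "F a = 0"
proof -
  have "finite C \<Longrightarrow> C \<subseteq> A \<Longrightarrow> \<forall>i\<in>A - C. a i \<in> B \<Longrightarrow> F a = 0" for C a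
  proof (induction C arbitrary: a rule: finite_induct)
    case empty
    then show ?case using zero by blast
  next
    case (insert k C)
    define g where "g v = F (a(k := v))" for v
    have "g v = 0" if "v \<in> span B" for v
      using that
    proof (induction rule: span_induct_alt)
      case base
      show ?case unfolding g_def using multilin_zero_slot[OF F] insert.prems by blast
    next
      case (step c b w)
      have "g b = 0"
        unfolding g_def using insert.prems step(1) by (intro insert.IH) auto
      moreover have "g (scale c b + w) = scale c (g b) + g w"
        unfolding g_def using insert.prems by (intro multilin_step[OF F]) auto
      ultimately show ?case using step(2) by simp
    qed
    from this[of "a k"] B show ?case by (simp add: g_def)
  qed
  from this[of A a] \<open>finite A\<close> show ?thesis by simp
qed

lemma multilin_lincomb:
  assumes "multilin scale A F" "multilin scale A G"
  shows "multilin scale A (\<lambda>a. F a + scale c (G a))"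
  unfolding multilin_def
proof (intro conjI allI impI)
  fix a i x y r assume "i \<in> A"
  then show "F (a(i := scale r x + y)) + scale c (G (a(i := scale r x + y)))
      = scale r (F (a(i := x)) + scale c (G (a(i := x)))) + (F (a(i := y)) + scale c (G (a(i := y))))"
    unfolding multilin_step[OF assms(1) \<open>i \<in> A\<close>] multilin_step[OF assms(2) \<open>i \<in> A\<close>]
    by (simp add: scale_right_distrib mult.commute add.assoc add.left_commute)
next
  fix a b :: "nat \<Rightarrow> 'l" assume "\<forall>i\<in>A. a i = b i"
  then show "F a + scale c (G a) = F b + scale c (G b)"
    using multilin_cong[OF assms(1), of a b] multilin_cong[OF assms(2), of a b] by simp
qed

lemma multilin_bracket:
  assumes F: "multilin scale A F" and G: "multilin scale B G" and disj: "A \<inter> B = {}"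
  shows "multilin scale (A \<union> B) (\<lambda>a. bracket (F a) (G a))"
  unfolding multilin_def
proof (intro conjI allI impI)
  fix a i x y c assume i: "i \<in> A \<union> B"
  show "bracket (F (a(i := scale c x + y))) (G (a(i := scale c x + y)))
      = scale c (bracket (F (a(i := x))) (G (a(i := x)))) + bracket (F (a(i := y))) (G (a(i := y)))"
  proof (cases "i \<in> A")
    case True
    then have "G (a(i := v)) = G a" for v
      using disj by (intro multilin_cong[OF G]) auto
    then show ?thesis using True
      by (simp add: multilin_step[OF F] bracket_add_left bracket_scale_left)
  next
    case False
    then have "F (a(i := v)) = F a" for v
      by (intro multilin_cong[OF F]) auto
    moreover have "i \<in> B" using i False by simp
    ultimately show ?thesis
      by (simp add: multilin_step[OF G] bracket_add_right bracket_scale_right)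
  qed
next
  fix a b :: "nat \<Rightarrow> 'l" assume "\<forall>i\<in>A \<union> B. a i = b i"
  then show "bracket (F a) (G a) = bracket (F b) (G b)"
    using multilin_cong[OF F, of a b] multilin_cong[OF G, of a b] by auto
qed

lemma multilin_0: "multilin scale A (\<lambda>_. 0)"
  by (simp add: multilin_def)

end

primrec letters :: "'h monomial \<Rightarrow> nat list" where
  "letters (Letter i h) = [i]"
| "letters (Prod s t) = letters s @ letters t"

lemma letters_foldl:
  "letters (foldl Prod m (map (\<lambda>i. Letter (\<sigma> i) (h i)) is)) = letters m @ map \<sigma> is"
  by (induction "is" arbitrary: m) auto

context H_module_lie_algebra
begin

lemma act_0_right [simp]: "act h 0 = 0"
  using act_add_right[of h 0 0] by simp

lemma act_sum_list: "act (\<Sum>x\<leftarrow>xs. f x) v = (\<Sum>x\<leftarrow>xs. act (f x) v)"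
proof (induction xs)
  case Nil
  show ?case using act_add_left[of 0 0 v] by simp
qed (simp add: act_add_left)

lemma bracket_sum_list_left: "bracket (\<Sum>x\<leftarrow>xs. f x) v = (\<Sum>x\<leftarrow>xs. bracket (f x) v)"
  by (induction xs) (auto simp: L.bracket_add_left)

lemma bracket_sum_list_right: "bracket v (\<Sum>x\<leftarrow>xs. f x) = (\<Sum>x\<leftarrow>xs. bracket v (f x))"
  by (induction xs) (auto simp: L.bracket_add_right)

primrec eval_monomial :: "(nat \<Rightarrow> 'l) \<Rightarrow> 'h monomial \<Rightarrow> 'l" where
  "eval_monomial a (Letter i h) = act h (a i)"
| "eval_monomial a (Prod s t) = bracket (eval_monomial a s) (eval_monomial a t)"

abbreviation eval_poly :: "(nat \<Rightarrow> 'l) \<Rightarrow> ('h monomial \<Rightarrow>\<^sub>0 'f) \<Rightarrow> 'l" where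
  "eval_poly a \<equiv> L.lin_ext (eval_monomial a)"

lemma eval_mult_free: "eval_poly a (mult_free p q) = bracket (eval_poly a p) (eval_poly a q)"
proof -
  have "eval_poly a (mult_free p q) = (\<Sum>s\<in>Poly_Mapping.keys p. \<Sum>t\<in>Poly_Mapping.keys q.
     scaleL (Poly_Mapping.lookup p s * Poly_Mapping.lookup q t)
       (bracket (eval_monomial a s) (eval_monomial a t)))"
    by (simp add: mult_free_def L.lin_ext_sum L.lin_ext_single)
  also have "\<dots> = bracket (eval_poly a p) (eval_poly a q)"
    unfolding L.lin_ext_def L.bracket_sum_left L.bracket_sum_right
    by (simp add: L.bracket_scale_left L.bracket_scale_right mult.commute) (rule sum.swap)
  finally show ?thesis .
qed

lemma eval_act_monomial: "eval_poly a (H.act_monomial m h) = act h (eval_monomial a m)"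
proof (induction m arbitrary: h)
  case (Letter i g)
  show ?case by (simp add: L.lin_ext_single act_mult)
next
  case (Prod s t)
  show ?case
    by (simp add: L.lin_ext_sum_list eval_mult_free Prod act_bracket split_def)
qed

lemma eval_act_free: "eval_poly a (H.act_free h p) = act h (eval_poly a p)"
proof -
  have act_sum: "act h (\<Sum>m\<in>A. f m) = (\<Sum>m\<in>A. act h (f m))" for A and f :: "'h monomial \<Rightarrow> 'l"
    by (induction A rule: infinite_finite_induct) (auto simp: act_add_right)
  show ?thesis
    unfolding H.act_free_def L.lin_ext_sum L.lin_ext_smult eval_act_monomial
    by (simp add: L.lin_ext_def act_sum act_scale_right)
qed

lemma eval_decoration_rel: "r \<in> decoration_rel scaleH \<Longrightarrow> eval_poly a r = 0"
  by (induction rule: decoration_rel.induct)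
     (auto simp: L.lin_ext_diff L.lin_ext_smult L.lin_ext_single act_add_left act_scale_left
       eval_mult_free)

lemma eval_lie_rel:
  assumes "r \<in> H.lie_rel"
  shows "eval_poly a r = 0"
proof -
  let ?K = "{p. eval_poly a p = 0}"
  have "H.H_ideal ?K"
    unfolding H.H_ideal_def free.subspace_def
    by (auto simp: L.lin_ext_add L.lin_ext_smult eval_mult_free eval_act_free)
  moreover have "mult_free u (mult_free v w) + mult_free v (mult_free w u)
      + mult_free w (mult_free u v) \<in> ?K" for u v w
    by (simp add: L.lin_ext_add eval_mult_free L.jacobi)
  moreover have "mult_free u u \<in> ?K" for u
    by (simp add: eval_mult_free L.bracket_self)
  ultimately have "H.lie_rel \<subseteq> ?K"
    unfolding H.lie_rel_def using eval_decoration_rel by (intro Inter_lower) auto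
  then show ?thesis using assms by blast
qed

lemma eval_cls_cong: "H.cls p = H.cls q \<Longrightarrow> eval_poly a p = eval_poly a q"
  using eval_lie_rel[of "p - q" a] by (simp add: H.cls_eq_iff L.lin_ext_diff)

text \<open>Evaluation at \<open>a\<close> kills the defining relations, hence factors through the free algebra.\<close>

lemma exists_H_lie_hom: "\<exists>\<psi>. H_lie_hom \<psi> \<and> (\<forall>p. \<psi> (H.cls p) = eval_poly a p)"
proof -
  define \<psi> where "\<psi> C = eval_poly a (SOME p. H.cls p = C)" for C
  have "\<psi> (H.cls p) = eval_poly a p" for p
    unfolding \<psi>_def by (rule eval_cls_cong) (rule someI[of "\<lambda>q. H.cls q = H.cls p" p], simp)
  then show ?thesis
    by (intro exI[of _ \<psi>])
       (auto simp: H_lie_hom_def L.lin_ext_add L.lin_ext_smult eval_mult_free eval_act_free)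
qed

text \<open>Conversely, a homomorphism is determined by its values on the letters \<open>x\<^sub>i\<^sup>1\<close>, because
  \<open>x\<^sub>i\<^sup>h = h x\<^sub>i\<^sup>1\<close>.\<close>

lemma H_lie_hom_eval:
  assumes "H_lie_hom \<psi>"
  shows "\<psi> (H.cls p) = eval_poly (\<lambda>i. \<psi> (H.cls (basis_vec (Letter i 1)))) p"
proof -
  define a where "a = (\<lambda>i. \<psi> (H.cls (basis_vec (Letter i 1))))"
  have add: "\<psi> (H.cls (p + q)) = \<psi> (H.cls p) + \<psi> (H.cls q)"
    and smult: "\<psi> (H.cls (smult_free c p)) = scaleL c (\<psi> (H.cls p))"
    and mult: "\<psi> (H.cls (mult_free p q)) = bracket (\<psi> (H.cls p)) (\<psi> (H.cls q))"
    and act: "\<psi> (H.cls (H.act_free h p)) = act h (\<psi> (H.cls p))" for p q c h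
    using assms by (auto simp: H_lie_hom_def)
  have 0: "\<psi> (H.cls 0) = 0" using smult[of 0 0] by simp
  have mono: "\<psi> (H.cls (basis_vec m)) = eval_monomial a m" for m
  proof (induction m)
    case (Letter i h)
    have "basis_vec (Letter i h) = H.act_free h (basis_vec (Letter i 1))"
      by (simp add: H.act_free_def)
    then show ?case by (simp add: act a_def)
  next
    case (Prod s t)
    have "basis_vec (Prod s t) = (mult_free (basis_vec s) (basis_vec t) :: _ \<Rightarrow>\<^sub>0 'f)"
      by (simp add: mult_free_def)
    then show ?case by (simp add: mult Prod)
  qed
  have sum: "\<psi> (H.cls (\<Sum>m\<in>A. f m)) = (\<Sum>m\<in>A. \<psi> (H.cls (f m)))"
    for A and f :: "'h monomial \<Rightarrow> ('h monomial \<Rightarrow>\<^sub>0 'f)"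
    by (induction A rule: infinite_finite_induct) (auto simp: 0 add)
  show ?thesis
    using arg_cong[OF L.poly_mapping_expand[of p], of "\<lambda>p. \<psi> (H.cls p)"]
    unfolding a_def[symmetric] by (simp only: sum smult mono L.lin_ext_def)
qed

definition commutator_span :: "nat \<Rightarrow> ('h monomial \<Rightarrow>\<^sub>0 'f) set" where
  "commutator_span n = free.span {basis_vec (H.long_commutator n \<sigma> h) |\<sigma> h. \<sigma> permutes {..<n}}"

text \<open>Classes of the free algebra are handled through representatives: the span of the long
  commutators is enlarged by all relations.\<close>

definition commutator_preimage :: "nat \<Rightarrow> ('h monomial \<Rightarrow>\<^sub>0 'f) set" where
  "commutator_preimage n = {p. \<exists>q\<in>commutator_span n. p - q \<in> H.lie_rel}"

lemma subspace_lie_rel: "free.subspace H.lie_rel"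
  using H.H_ideal_lie_rel by (simp add: H.H_ideal_def)

lemma commutator_span_subset: "commutator_span n \<subseteq> commutator_preimage n"
  using free.subspace_0[OF subspace_lie_rel] by (force simp: commutator_preimage_def)

lemma subspace_commutator_span: "free.subspace (commutator_span n)"
  by (simp add: commutator_span_def)

lemma subspace_commutator_preimage: "free.subspace (commutator_preimage n)"
proof -
  note V = subspace_commutator_span[of n]
  note R = subspace_lie_rel
  show ?thesis
  proof (rule free.subspaceI)
    show "0 \<in> commutator_preimage n"
      using commutator_span_subset free.subspace_0[OF V] by blast
  next
    fix x y assume "x \<in> commutator_preimage n" "y \<in> commutator_preimage n"
    then obtain p q where "p \<in> commutator_span n" "q \<in> commutator_span n"
        "x - p \<in> H.lie_rel" "y - q \<in> H.lie_rel" by (auto simp: commutator_preimage_def)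
    then have "p + q \<in> commutator_span n" "(x + y) - (p + q) \<in> H.lie_rel"
      using free.subspace_add[OF V] free.subspace_add[OF R, of "x - p" "y - q"]
      by (auto simp: algebra_simps)
    then show "x + y \<in> commutator_preimage n" by (auto simp: commutator_preimage_def)
  next
    fix c x assume "x \<in> commutator_preimage n"
    then obtain p where "p \<in> commutator_span n" "x - p \<in> H.lie_rel"
      by (auto simp: commutator_preimage_def)
    then have "smult_free c p \<in> commutator_span n" "smult_free c x - smult_free c p \<in> H.lie_rel"
      using free.subspace_scale[OF V] free.subspace_scale[OF R, of "x - p" c]
      by (auto simp: free.scale_right_diff_distrib)
    then show "smult_free c x \<in> commutator_preimage n" by (auto simp: commutator_preimage_def)
  qed
qed

text \<open>The homomorphisms are the evaluations, so a polynomial is an identity if and only if it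
  represents the zero function.\<close>

lemma H_codim_eq:
  "H_codim n = quotient_dim (commutator_preimage n)
     {p\<in>commutator_preimage n. \<forall>a. eval_poly a p = 0}"
proof -
  have *: "H.cls -` H.multilinear_H_polys n = commutator_preimage n"
    by (auto simp: H.multilinear_H_polys_def commutator_preimage_def commutator_span_def H.cls_eq_iff
        image_iff)
  have "H.cls p \<in> H_identities \<longleftrightarrow> (\<forall>a. eval_poly a p = 0)" for p
  proof
    assume p: "H.cls p \<in> H_identities"
    show "\<forall>a. eval_poly a p = 0"
    proof
      fix a
      obtain \<psi> where "H_lie_hom \<psi>" "\<psi> (H.cls p) = eval_poly a p" using exists_H_lie_hom[of a] by auto
      moreover have "\<psi> (H.cls p) = 0" using p \<open>H_lie_hom \<psi>\<close> by (auto simp: H_identities_def)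
      ultimately show "eval_poly a p = 0" by simp
    qed
  next
    assume "\<forall>a. eval_poly a p = 0"
    then show "H.cls p \<in> H_identities"
      using H_lie_hom_eval[of _ p] by (simp add: H_identities_def H.free_H_lie_def)
  qed
  then have "H.cls -` (H.multilinear_H_polys n \<inter> H_identities)
      = {p\<in>commutator_preimage n. \<forall>a. eval_poly a p = 0}"
    using * by (auto simp: vimage_Int)
  then show ?thesis unfolding H_codim_def * by simp
qed

lemma multilin_eval_monomial:
  assumes "distinct (letters m)"
  shows "multilin scaleL (set (letters m)) (\<lambda>a. eval_monomial a m)"
  using assms
proof (induction m)
  case (Letter i h)
  show ?case by (auto simp: multilin_def act_add_right act_scale_right)
next
  case (Prod s t)
  then show ?case using L.multilin_bracket[of "set (letters s)" _ "set (letters t)"] by simp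
qed

lemma letters_long_commutator:
  assumes "n \<ge> 1"
  shows "letters (H.long_commutator n \<sigma> h) = map \<sigma> [0..<n]"
  using assms by (simp add: H.long_commutator_def letters_foldl upt_conv_Cons)

lemma multilin_commutator_span:
  assumes n: "n \<ge> 1" and q: "q \<in> commutator_span n"
  shows "multilin scaleL {..<n} (\<lambda>a. eval_poly a q)"
  using q unfolding commutator_span_def
proof (induction rule: free.span_induct_alt)
  case base
  show ?case by (simp add: L.multilin_0)
next
  case (step c x y)
  then obtain \<sigma> h where x: "x = basis_vec (H.long_commutator n \<sigma> h)" "\<sigma> permutes {..<n}" by auto
  have "distinct (letters (H.long_commutator n \<sigma> h))"
    unfolding letters_long_commutator[OF n] distinct_map using x(2) by (auto intro: permutes_inj_on)
  moreover have "set (letters (H.long_commutator n \<sigma> h)) = {..<n}"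
    unfolding letters_long_commutator[OF n] using permutes_image[OF x(2)] by (simp add: atLeast0LessThan)
  ultimately have "multilin scaleL {..<n} (\<lambda>a. eval_monomial a (H.long_commutator n \<sigma> h))"
    using multilin_eval_monomial by metis
  from L.multilin_lincomb[OF step(2) this, of c] show ?case
    by (simp add: x L.lin_ext_add L.lin_ext_smult L.lin_ext_single add.commute)
qed

end

locale fd_H_module_lie_algebra =
  H_module_lie_algebra scaleH comult counit antipode scaleL bracket act +
  L: fd_lie_algebra scaleL bracket Basis
  for scaleH :: "'f::{alg_closed_field, field_char_0} \<Rightarrow> 'h::ring_1 \<Rightarrow> 'h"
    and comult counit antipode
    and scaleL :: "'f \<Rightarrow> 'l::ab_group_add \<Rightarrow> 'l"
    and bracket act Basis
begin

text \<open>Test tuples from a basis and coordinates of the value at a tuple separate the multilinear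
  functions represented by commutators.\<close>

lemma commutator_coordinates:
  assumes n: "n \<ge> 1" and B: "L.is_basis B" and G: "G \<subseteq> PiE {..<n} (\<lambda>_. B)"
    and vanish: "\<And>w \<sigma> h. w \<in> PiE {..<n} (\<lambda>_. B) - G \<Longrightarrow> \<sigma> permutes {..<n} \<Longrightarrow>
      eval_monomial w (H.long_commutator n \<sigma> h) = 0"
  shows "coordinate_functionals (commutator_preimage n)
     {p\<in>commutator_preimage n. \<forall>a. eval_poly a p = 0} (G \<times> B)
     (\<lambda>(w, b) p. L.representation B (eval_poly w p) b)"
proof
  have finB: "finite B" using B by (rule L.is_basis_finite)
  then show "finite (G \<times> B)" using G finite_PiE[of "{..<n}" "\<lambda>_. B"] by (auto intro: finite_subset)
  show "free.subspace (commutator_preimage n)" by (rule subspace_commutator_preimage)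
  then show "free.subspace {p\<in>commutator_preimage n. \<forall>a. eval_poly a p = 0}"
    by (auto simp: free.subspace_def L.lin_ext_add L.lin_ext_smult)
next
  fix s x y
  show "(case s of (w, b) \<Rightarrow> \<lambda>p. L.representation B (eval_poly w p) b) (x + y)
      = (case s of (w, b) \<Rightarrow> \<lambda>p. L.representation B (eval_poly w p) b) x
        + (case s of (w, b) \<Rightarrow> \<lambda>p. L.representation B (eval_poly w p) b) y"
    by (cases s) (simp add: L.lin_ext_add L.coord_add[OF B])
next
  fix s c x
  show "(case s of (w, b) \<Rightarrow> \<lambda>p. L.representation B (eval_poly w p) b) (smult_free c x)
      = c * (case s of (w, b) \<Rightarrow> \<lambda>p. L.representation B (eval_poly w p) b) x"
    by (cases s) (simp add: L.lin_ext_smult L.coord_scale[OF B])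
next
  fix u assume u: "u \<in> commutator_preimage n"
    and zero: "\<And>s. s \<in> G \<times> B \<Longrightarrow> (case s of (w, b) \<Rightarrow> \<lambda>p. L.representation B (eval_poly w p) b) u = 0"
  obtain q where q: "q \<in> commutator_span n" "u - q \<in> H.lie_rel"
    using u by (auto simp: commutator_preimage_def)
  have uq: "eval_poly a u = eval_poly a q" for a
    using eval_lie_rel[OF q(2), of a] by (simp add: L.lin_ext_diff)
  note multi = multilin_commutator_span[OF n q(1)]
  have PiE_zero: "eval_poly w q = 0" if w: "w \<in> PiE {..<n} (\<lambda>_. B)" for w
  proof (cases "w \<in> G")
    case True
    have "L.representation B (eval_poly w q) b = L.representation B 0 b" if "b \<in> B" for b
      using zero[of "(w, b)"] True that by (simp add: uq L.coord_0[OF B])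
    then show ?thesis by (rule L.coord_eqI[OF B])
  next
    case False
    show ?thesis
      using q(1) unfolding commutator_span_def
    proof (induction rule: free.span_induct_alt)
      case (step c x y)
      then show ?case using vanish[of w] w False
        by (auto simp: L.lin_ext_add L.lin_ext_smult L.lin_ext_single)
    qed simp
  qed
  have "eval_poly a q = 0" for a
  proof (rule L.multilin_zero[OF multi, of B])
    show "L.span B = UNIV" using B by (simp add: L.is_basis_def)
    fix a assume "\<forall>i\<in>{..<n}. a i \<in> B"
    then have "restrict a {..<n} \<in> PiE {..<n} (\<lambda>_. B)" by auto
    moreover have "eval_poly (restrict a {..<n}) q = eval_poly a q"
      by (rule L.multilin_cong[OF multi]) auto
    ultimately show "eval_poly a q = 0" using PiE_zero by metis
  qed simp
  then show "u \<in> {p\<in>commutator_preimage n. \<forall>a. eval_poly a p = 0}" using u uq by simp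
qed

lemma H_codim_le:
  assumes "n \<ge> 1" "L.is_basis B" "G \<subseteq> PiE {..<n} (\<lambda>_. B)"
    and "\<And>w \<sigma> h. w \<in> PiE {..<n} (\<lambda>_. B) - G \<Longrightarrow> \<sigma> permutes {..<n} \<Longrightarrow>
      eval_monomial w (H.long_commutator n \<sigma> h) = 0"
  shows "H_codim n \<le> card G * card B"
  unfolding H_codim_eq
  using coordinate_functionals.quotient_dim_le[OF commutator_coordinates[OF assms]]
  by (simp add: card_cartesian_product)

lemma H_codim_ge:
  assumes n: "n \<ge> 1" and J: "finite J" "\<And>j. j \<in> J \<Longrightarrow> p j \<in> commutator_span n"
    and indep: "\<And>c. (\<And>a. (\<Sum>j\<in>J. scaleL (c j) (eval_poly a (p j))) = 0) \<Longrightarrow> \<forall>j\<in>J. c j = 0"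
  shows "card J \<le> H_codim n"
proof -
  have *: "coordinate_functionals (commutator_preimage n)
     {p\<in>commutator_preimage n. \<forall>a. eval_poly a p = 0} (PiE {..<n} (\<lambda>_. Basis) \<times> Basis)
     (\<lambda>(w, b) p. L.representation Basis (eval_poly w p) b)"
    by (rule commutator_coordinates[OF n L.is_basis_Basis]) auto
  show ?thesis
    unfolding H_codim_eq
  proof (rule coordinate_functionals.quotient_dim_ge[OF * J(1)])
    show "p j \<in> commutator_preimage n" if "j \<in> J" for j
      using commutator_span_subset J(2)[OF that] by blast
    fix c assume "(\<Sum>j\<in>J. smult_free (c j) (p j)) \<in> {p\<in>commutator_preimage n. \<forall>a. eval_poly a p = 0}"
    then show "\<forall>j\<in>J. c j = 0"
      using indep[of c] by (simp add: L.lin_ext_sum L.lin_ext_smult)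
  qed
qed

lemma H_codim_le_dim_power:
  assumes "n \<ge> 1"
  shows "H_codim n \<le> L.dim UNIV ^ n * L.dim UNIV"
proof -
  have "H_codim n \<le> card (PiE {..<n} (\<lambda>_. Basis)) * card Basis"
    by (rule H_codim_le[OF assms L.is_basis_Basis]) auto
  then show ?thesis by (simp add: card_PiE L.dim_UNIV)
qed

end

section \<open>Upper bounds for codimensions\<close>

text \<open>A tensor identity may be applied to every multilinear function; here the function is given
  on lists, that is, on all tensor powers at once.\<close>

lemma (in H_module_lie_algebra) tensor_eq_sum:
  assumes add: "\<And>xs a b ys. f (xs @ (a + b) # ys) = f (xs @ a # ys) + f (xs @ b # ys)"
    and scale: "\<And>xs c a ys. f (xs @ scaleH c a # ys) = scaleL c (f (xs @ a # ys))"
    and eq: "H.tensor_eq ts us"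
  shows "(\<Sum>t\<leftarrow>ts. f t) = (\<Sum>t\<leftarrow>us. f t)"
proof -
  have zero: "L.lin_ext f r = 0" if "r \<in> H.tensor_rel" for r
    using that unfolding H.tensor_rel_def
  proof (induction rule: free.span_induct_alt)
    case (step c x y)
    have "L.lin_ext f x = 0"
      using step(1) by (auto simp: L.lin_ext_diff L.lin_ext_smult L.lin_ext_single add scale)
    then show ?case using step(2) by (simp add: L.lin_ext_add L.lin_ext_smult)
  qed simp
  have "L.lin_ext f ((\<Sum>t\<leftarrow>ts. basis_vec t) - (\<Sum>t\<leftarrow>us. basis_vec t)) = 0"
    using eq zero by (simp add: H.tensor_eq_def)
  then show ?thesis by (simp add: L.lin_ext_diff L.lin_ext_sum_list L.lin_ext_single)
qed

lemma sum_list_concat: "sum_list (concat xss) = (\<Sum>xs\<leftarrow>xss. sum_list xs)"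
  for xss :: "'a::monoid_add list list"
  by (induction xss) auto

text \<open>By the antipode axiom and coassociativity
  \<open>[h c, j] = \<Sum> [h\<^sub>(\<^sub>1\<^sub>) c, h\<^sub>(\<^sub>2\<^sub>) S(h\<^sub>(\<^sub>3\<^sub>)) j] = \<Sum> h\<^sub>(\<^sub>1\<^sub>) [c, S(h\<^sub>(\<^sub>2\<^sub>)) j]\<close>.\<close>

lemma (in H_module_lie_algebra) centralizer_H_invariant:
  assumes J: "H_invariant J"
  shows "H_invariant {c. \<forall>j\<in>J. bracket c j = 0}"
  unfolding H_invariant_def
proof (intro allI ballI CollectI)
  fix h c j assume "c \<in> {c. \<forall>j\<in>J. bracket c j = 0}" and j: "j \<in> J"
  then have c: "bracket c (act g j) = 0" for g using J by (simp add: H_invariant_def)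
  define f where "f t = (case t of [x, y, z] \<Rightarrow> bracket (act x c) (act y (act (antipode z) j)) | _ \<Rightarrow> 0)" for t
  have "f (xs @ (a + b) # ys) = f (xs @ a # ys) + f (xs @ b # ys)"
    and "f (xs @ scaleH r a # ys) = scaleL r (f (xs @ a # ys))" for xs a b ys r
    by (auto simp: f_def Cons_eq_append_conv append_eq_Cons_conv act_add_left act_scale_left
        act_add_right act_scale_right H.antipode_add H.antipode_scale L.bracket_add_left
        L.bracket_add_right L.bracket_scale_left L.bracket_scale_right split: list.splits)
  from tensor_eq_sum[of f, OF this H.coassoc[of h]]
  have "(\<Sum>(a, b)\<leftarrow>comult h. \<Sum>(p, q)\<leftarrow>comult a. bracket (act p c) (act q (act (antipode b) j)))
      = (\<Sum>(a, b)\<leftarrow>comult h. \<Sum>(p, q)\<leftarrow>comult b. bracket (act a c) (act p (act (antipode q) j)))"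
    by (simp add: f_def map_concat comp_def split_def sum_list_concat)
  also have "(\<Sum>(a, b)\<leftarrow>comult h. \<Sum>(p, q)\<leftarrow>comult a. bracket (act p c) (act q (act (antipode b) j)))
      = (\<Sum>(a, b)\<leftarrow>comult h. act a (bracket c (act (antipode b) j)))"
    by (simp add: act_bracket)
  also have "\<dots> = 0" by (simp add: c split_def)
  also have "(\<Sum>(a, b)\<leftarrow>comult h. \<Sum>(p, q)\<leftarrow>comult b. bracket (act a c) (act p (act (antipode q) j)))
      = (\<Sum>(a, b)\<leftarrow>comult h. bracket (act a c) (act (\<Sum>(p, q)\<leftarrow>comult b. p * antipode q) j))"
    by (simp add: bracket_sum_list_right act_sum_list split_def act_mult)
  also have "\<dots> = (\<Sum>(a, b)\<leftarrow>comult h. bracket (act (scaleH (counit b) a) c) j)"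
    by (simp add: H.antipode_right act_scale_left act_one L.bracket_scale_left L.bracket_scale_right)
  also have "\<dots> = bracket (act (\<Sum>(a, b)\<leftarrow>comult h. scaleH (counit b) a) c) j"
    by (simp add: bracket_sum_list_left act_sum_list split_def)
  also have "\<dots> = bracket (act h c) j" by (simp add: H.counit_right)
  finally show "bracket (act h c) j = 0" by simp
qed

lemma root_limit_less:
  fixes c :: "nat \<Rightarrow> nat" and C r d :: real
  assumes "0 \<le> r" "r < d" and bound: "\<And>n. n \<ge> 1 \<Longrightarrow> real (c n) \<le> C * r ^ n"
  shows "\<not> (\<lambda>n. root n (real (c n))) \<longlonglongrightarrow> d"
proof
  assume lim: "(\<lambda>n. root n (real (c n))) \<longlonglongrightarrow> d"
  define C' where "C' = max C 1"
  have "(\<lambda>n. root n C' * r) \<longlonglongrightarrow> 1 * r"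
    by (intro tendsto_intros LIMSEQ_root_const) (simp add: C'_def)
  moreover have "root n (real (c n)) \<le> root n C' * r" if "n \<ge> 1" for n
  proof -
    have "C * r ^ n \<le> C' * r ^ n"
      using assms(1) by (intro mult_right_mono) (auto simp: C'_def)
    then have "real (c n) \<le> C' * r ^ n" using bound[OF that] by linarith
    then have "root n (real (c n)) \<le> root n (C' * r ^ n)" using that by simp
    also have "\<dots> = root n C' * r"
      using that assms(1) by (simp add: real_root_mult real_root_power_cancel)
    finally show ?thesis .
  qed
  ultimately have "d \<le> 1 * r" using lim by (intro LIMSEQ_le) auto
  then show False using assms(2) by simp
qed

text \<open>Weighting the letter \<open>x\<close> by \<open>1/2\<close> and the other letters by \<open>1\<close>, the weights of all words of
  length \<open>n\<close> sum to \<open>(card B - 1/2)\<^sup>n\<close>, and a word in which \<open>x\<close> occurs at most \<open>p\<close> times has weight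
  at least \<open>(1/2)\<^sup>p\<close>.\<close>

lemma card_words_with_few_occurrences:
  assumes "finite B" "x \<in> B"
  shows "real (card {w \<in> PiE {..<n} (\<lambda>_. B). card {i\<in>{..<n}. w i = x} \<le> p})
    \<le> 2 ^ p * (real (card B) - 1/2) ^ n"
proof -
  let ?P = "PiE {..<n} (\<lambda>_. B)"
  let ?G = "{w \<in> ?P. card {i\<in>{..<n}. w i = x} \<le> p}"
  define g :: "_ \<Rightarrow> real" where "g b = (if b = x then 1/2 else 1)" for b
  have fin: "finite ?P" using assms by (intro finite_PiE) auto
  have "(\<Sum>b\<in>B. g b) = 1/2 + (\<Sum>b\<in>B - {x}. 1)"
    using assms by (subst sum.remove[of B x]) (auto simp: g_def intro!: sum.cong)
  also have "\<dots> = real (card B) - 1/2"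
    using assms card_gt_0_iff[of B] by (auto simp: of_nat_diff)
  finally have sum_g: "(\<Sum>b\<in>B. g b) = real (card B) - 1/2" .
  have prod_g: "(\<Prod>i<n. g (w i)) = (1/2) ^ card {i\<in>{..<n}. w i = x}" for w
  proof -
    have "(\<Prod>i<n. g (w i)) = (\<Prod>i\<in>{i\<in>{..<n}. w i = x}. 1/2)"
      unfolding g_def by (subst prod.inter_filter[symmetric]) auto
    then show ?thesis by simp
  qed
  have "real (card ?G) * (1/2) ^ p = (\<Sum>w\<in>?G. (1/2) ^ p)" by simp
  also have "\<dots> \<le> (\<Sum>w\<in>?G. \<Prod>i<n. g (w i))"
    unfolding prod_g by (intro sum_mono power_decreasing) simp_all
  also have "\<dots> \<le> (\<Sum>w\<in>?P. \<Prod>i<n. g (w i))"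
  proof (rule sum_mono2[OF fin])
    show "0 \<le> (\<Prod>i<n. g (w i))" for w by (intro prod_nonneg) (simp add: g_def)
  qed blast
  also have "\<dots> = (\<Prod>i<n. \<Sum>b\<in>B. g b)"
    using assms(1) by (intro prod_sum_PiE[symmetric]) auto
  also have "\<dots> = (real (card B) - 1/2) ^ n" by (simp add: sum_g)
  finally show ?thesis by (simp add: field_simps)
qed

lemma length_filter_upt: "length (filter P [0..<n]) = card {i\<in>{..<n}. P i}"
  using distinct_card[of "filter P [0..<n]"] by (auto intro: arg_cong[of _ _ card])

lemma card_filter_permutes:
  assumes "\<sigma> permutes {..<n}"
  shows "card {i\<in>{..<n}. P (\<sigma> i)} = card {i\<in>{..<n::nat}. P i}"
proof (rule bij_betw_same_card)
  have "\<sigma> ` {i\<in>{..<n}. P (\<sigma> i)} = {i\<in>{..<n}. P i}"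
  proof (intro equalityI subsetI)
    fix i assume "i \<in> {i\<in>{..<n}. P i}"
    then have "inv \<sigma> i < n" "\<sigma> (inv \<sigma> i) = i" "P i"
      using permutes_in_image[OF permutes_inv[OF assms]] permutes_inverses[OF assms] by auto
    then show "i \<in> \<sigma> ` {i\<in>{..<n}. P (\<sigma> i)}" by (intro image_eqI[of _ _ "inv \<sigma> i"]) auto
  qed (use permutes_in_image[OF assms] in auto)
  then show "bij_betw \<sigma> {i\<in>{..<n}. P (\<sigma> i)} {i\<in>{..<n}. P i}"
    using permutes_inj[OF assms] by (simp add: bij_betw_def inj_on_def inj_def)
qed

context fd_H_module_lie_algebra
begin

lemma eval_in_ideal:
  assumes "L.lie_ideal J" "H_invariant J" "i \<in> set (letters m)" "a i \<in> J"
  shows "eval_monomial a m \<in> J"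
  using assms(3)
proof (induction m)
  case (Letter k h)
  then show ?case using assms by (auto simp: H_invariant_def)
next
  case (Prod s t)
  then show ?case
    using L.lie_ideal_bracket_left[OF assms(1)] L.lie_ideal_bracket_right[OF assms(1)] by auto
qed

lemma eval_foldl_ideal_power:
  assumes N: "L.lie_ideal N" "H_invariant N" and m: "eval_monomial a m \<in> L.ideal_power N k"
  shows "eval_monomial a (foldl Prod m (map (\<lambda>i. Letter (\<sigma> i) (h i)) is))
    \<in> L.ideal_power N (k + length (filter (\<lambda>i. a (\<sigma> i) \<in> N) is))"
  using m
proof (induction "is" arbitrary: m k)
  case (Cons i "is")
  let ?m = "Prod m (Letter (\<sigma> i) (h i))"
  show ?case
  proof (cases "a (\<sigma> i) \<in> N")
    case True
    then have "act (h i) (a (\<sigma> i)) \<in> N" using N(2) by (simp add: H_invariant_def)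
    then have "eval_monomial a ?m \<in> L.ideal_power N (Suc k)"
      using Cons.prems by (simp add: L.bracket_ideal_power[OF N(1)])
    from Cons.IH[OF this] True show ?thesis by simp
  next
    case False
    have "eval_monomial a ?m \<in> L.ideal_power N k"
      using Cons.prems by (simp add: L.lie_ideal_bracket_left L.lie_ideal_ideal_power N(1))
    from Cons.IH[OF this] False show ?thesis by simp
  qed
qed simp

lemma ideal_power_eventually_zero:
  assumes "L.lower_central N p = {0}" "k > p"
  shows "L.ideal_power N k = {0}"
proof -
  have "L.lower_central N (p + j) = {0}" for j
  proof (induction j)
    case (Suc j)
    have "L.bracket_space {0} N \<subseteq> {0}" by (intro L.bracket_space_minimal) auto
    then have "L.bracket_space {0} N = {0}"
      using L.subspace_0[OF L.subspace_bracket_space] by blast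
    then show ?case using Suc by simp
  qed (simp add: assms)
  from this[of "k - 1 - p"] assms(2) show ?thesis
    by (cases k) (auto simp: L.ideal_power_def)
qed

text \<open>Each entry in \<open>N\<close> raises by one the power of \<open>N\<close> that contains the partial commutators.\<close>

lemma eval_long_commutator_zero:
  assumes N: "L.lie_ideal N" "H_invariant N" "L.lower_central N p = {0}"
    and n: "n \<ge> 1" and \<sigma>: "\<sigma> permutes {..<n}" and many: "card {i\<in>{..<n}. a i \<in> N} > p"
  shows "eval_monomial a (H.long_commutator n \<sigma> h) = 0"
proof -
  let ?m = "Letter (\<sigma> 0) (h 0)"
  let ?k = "if a (\<sigma> 0) \<in> N then 1 else 0 :: nat"
  have "eval_monomial a ?m \<in> L.ideal_power N ?k"
    using N(2) by (auto simp: L.ideal_power_def H_invariant_def)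
  from eval_foldl_ideal_power[OF N(1,2) this, of \<sigma> h "[1..<n]"]
  have "eval_monomial a (H.long_commutator n \<sigma> h)
      \<in> L.ideal_power N (?k + length (filter (\<lambda>i. a (\<sigma> i) \<in> N) [1..<n]))"
    by (simp add: H.long_commutator_def)
  also have "?k + length (filter (\<lambda>i. a (\<sigma> i) \<in> N) [1..<n]) = length (filter (\<lambda>i. a (\<sigma> i) \<in> N) [0..<n])"
    using n by (simp add: upt_conv_Cons)
  also have "\<dots> = card {i\<in>{..<n}. a i \<in> N}"
    using card_filter_permutes[OF \<sigma>, of "\<lambda>i. a i \<in> N"] by (simp add: length_filter_upt)
  also have "L.ideal_power N \<dots> = {0}" using ideal_power_eventually_zero[OF N(3) many] .
  finally show ?thesis by simp
qed

text \<open>In a basis that contains an element \<open>x\<close> of the ideal only the words with few occurrences of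
  \<open>x\<close> matter.\<close>

lemma codim_growth_nilpotent_ideal:
  assumes N: "L.lie_ideal N" "H_invariant N" "L.lower_central N p = {0}" and "N \<noteq> {0}"
  shows "\<not> (\<lambda>n. root n (real (H_codim n))) \<longlonglongrightarrow> real (L.dim UNIV)"
proof -
  obtain x where x: "x \<in> N" "x \<noteq> 0" using L.lie_ideal_subspace[OF N(1)] L.subspace_0 assms(4) by blast
  have "L.independent {x}" using x by simp
  then obtain B where B: "x \<in> B" "L.is_basis B" using L.is_basis_extend by blast
  have finB: "finite B" using B L.is_basis_finite by blast
  then have d: "card B = L.dim UNIV" "card B \<ge> 1" using B L.is_basis_card[of B] card_gt_0_iff[of B] by auto
  show ?thesis
  proof (rule root_limit_less)
    show "0 \<le> real (L.dim UNIV) - 1/2" "real (L.dim UNIV) - 1/2 < real (L.dim UNIV)"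
      using d by auto
    fix n :: nat assume n: "n \<ge> 1"
    let ?G = "{w \<in> PiE {..<n} (\<lambda>_. B). card {i\<in>{..<n}. w i = x} \<le> p}"
    have "H_codim n \<le> card ?G * card B"
    proof (rule H_codim_le[OF n B(2)])
      fix w \<sigma> h assume w: "w \<in> PiE {..<n} (\<lambda>_. B) - ?G" and \<sigma>: "\<sigma> permutes {..<n}"
      have "card {i\<in>{..<n}. w i = x} \<le> card {i\<in>{..<n}. w i \<in> N}"
        using x by (intro card_mono) auto
      moreover have "\<not> card {i\<in>{..<n}. w i = x} \<le> p" using w by blast
      ultimately have "card {i\<in>{..<n}. w i \<in> N} > p" by linarith
      then show "eval_monomial w (H.long_commutator n \<sigma> h) = 0"
        by (rule eval_long_commutator_zero[OF N n \<sigma>])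
    qed blast
    then have "real (H_codim n) \<le> real (card ?G) * real (card B)"
      by (simp only: of_nat_mult[symmetric] of_nat_le_iff)
    also have "\<dots> \<le> (2 ^ p * (real (card B) - 1/2) ^ n) * real (card B)"
      by (rule mult_right_mono[OF card_words_with_few_occurrences[OF finB B(1)]]) simp
    finally show "real (H_codim n) \<le> (2 ^ p * real (card B)) * (real (L.dim UNIV) - 1/2) ^ n"
      using d by (simp add: mult_ac)
  qed
qed

text \<open>A commutator with an entry in each of the two ideals lies in their intersection. Choose a basis
  that contains some \<open>j \<in> J\<close> and some \<open>c \<in> C\<close>; then only words avoiding \<open>j\<close> or avoiding \<open>c\<close>
  matter, and there are at most \<open>2 (d - 1)\<^sup>n\<close> of them.\<close>

lemma codim_growth_disjoint_ideals:
  assumes J: "L.lie_ideal J" "H_invariant J" and C: "L.lie_ideal C" "H_invariant C"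
    and JC: "J \<inter> C = {0}" "J \<noteq> {0}" "C \<noteq> {0}"
  shows "\<not> (\<lambda>n. root n (real (H_codim n))) \<longlonglongrightarrow> real (L.dim UNIV)"
proof -
  obtain j where j: "j \<in> J" "j \<noteq> 0" using L.lie_ideal_subspace[OF J(1)] L.subspace_0 JC(2) by blast
  obtain c where c: "c \<in> C" "c \<noteq> 0" using L.lie_ideal_subspace[OF C(1)] L.subspace_0 JC(3) by blast
  have "j \<notin> L.span {c}"
  proof
    assume "j \<in> L.span {c}"
    then have "j \<in> C" using L.span_minimal[of "{c}" C] L.lie_ideal_subspace[OF C(1)] c by blast
    then show False using j JC(1) by blast
  qed
  then have "L.independent {j, c}" using c by (intro L.independent_insertI) (auto simp: L.independent_empty)
  then obtain B where B: "{j, c} \<subseteq> B" "L.is_basis B" using L.is_basis_extend by blast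
  have finB: "finite B" using B L.is_basis_finite by blast
  then have d: "card B = L.dim UNIV" "card B \<ge> 1" using B L.is_basis_card[of B] card_gt_0_iff[of B] by auto
  show ?thesis
  proof (rule root_limit_less)
    show "0 \<le> real (L.dim UNIV) - 1" "real (L.dim UNIV) - 1 < real (L.dim UNIV)"
      using d by auto
    fix n :: nat assume n: "n \<ge> 1"
    let ?A = "\<lambda>b. PiE {..<n} (\<lambda>_. B - {b})"
    have card_A: "card (?A b) = (card B - 1) ^ n" if "b \<in> B" for b
      using finB that by (simp add: card_PiE)
    have "H_codim n \<le> card (?A j \<union> ?A c) * card B"
    proof (rule H_codim_le[OF n B(2)])
      show "?A j \<union> ?A c \<subseteq> PiE {..<n} (\<lambda>_. B)" by (auto simp: PiE_iff)
      fix w \<sigma> h assume w: "w \<in> PiE {..<n} (\<lambda>_. B) - (?A j \<union> ?A c)" and \<sigma>: "\<sigma> permutes {..<n}"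
      then obtain k l where kl: "k < n" "w k = j" "l < n" "w l = c"
        unfolding PiE_iff by blast
      have "set (letters (H.long_commutator n \<sigma> h)) = {..<n}"
        unfolding letters_long_commutator[OF n] using permutes_image[OF \<sigma>]
        by (simp add: atLeast0LessThan)
      then have "eval_monomial w (H.long_commutator n \<sigma> h) \<in> J \<inter> C"
        using eval_in_ideal[OF J, of k _ w] eval_in_ideal[OF C, of l _ w] kl j c by auto
      then show "eval_monomial w (H.long_commutator n \<sigma> h) = 0" using JC by auto
    qed
    also have "\<dots> \<le> (card (?A j) + card (?A c)) * card B"
      by (intro mult_right_mono card_Un_le) auto
    also have "\<dots> = 2 * card B * (card B - 1) ^ n" using B by (simp add: card_A)
    finally have "real (H_codim n) \<le> real (2 * card B * (card B - 1) ^ n)" by (rule of_nat_mono)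
    also have "\<dots> = 2 * real (card B) * (real (L.dim UNIV) - 1) ^ n"
      using d by (simp add: of_nat_diff)
    finally show "real (H_codim n) \<le> (2 * real (card B)) * (real (L.dim UNIV) - 1) ^ n" .
  qed
qed

text \<open>A proper nonzero \<open>H\<close>-invariant ideal \<open>J\<close> and its centralizer are disjoint ideals: their
  intersection is abelian.\<close>

theorem maximal_growth_imp_H_simple:
  assumes lim: "(\<lambda>n. root n (real (H_codim n))) \<longlonglongrightarrow> real (L.dim UNIV)"
    and nonzero: "\<exists>a::'l. a \<noteq> 0" and inv: "H_invariant L.nilpotent_radical"
  shows "H_simple \<and> L.semisimple"
proof -
  have "L.nilpotent_radical = {0}"
    using codim_growth_nilpotent_ideal[OF L.nilpotent_radical(1) inv] L.nilpotent_radical(2) lim by blast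
  then have ss: "L.no_abelian_ideals" by (rule L.no_abelian_ideals_if_nilpotent_radical_zero)
  have "L.bracket_space UNIV UNIV \<noteq> {0}"
  proof
    assume "L.bracket_space UNIV UNIV = {0}"
    then have "bracket a b = 0" for a b using L.bracket_spaceI[of a UNIV b UNIV] by simp
    then show False using L.no_abelian_idealsD[OF ss L.lie_ideal_UNIV] nonzero by blast
  qed
  moreover have "J = {0} \<or> J = UNIV" if J: "L.lie_ideal J" "H_invariant J" for J
  proof (rule ccontr)
    assume contra: "\<not> ?thesis"
    let ?C = "{c. \<forall>j\<in>J. bracket c j = 0}"
    have C: "L.lie_ideal ?C"
      unfolding L.lie_ideal_def
    proof (intro conjI allI ballI CollectI)
      show "L.subspace ?C"
        by (auto simp: L.subspace_def L.bracket_add_left L.bracket_scale_left)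
      fix a c j assume c: "c \<in> ?C" and j: "j \<in> J"
      have "bracket a (bracket c j) = bracket (bracket a c) j + bracket c (bracket a j)"
        by (rule L.bracket_derivation)
      then show "bracket (bracket a c) j = 0" using c j L.lie_ideal_bracket_right[OF J(1) j] by simp
    qed
    have "L.lie_ideal (J \<inter> ?C)" using J(1) C by (rule L.lie_ideal_Int)
    then have "J \<inter> ?C = {0}" by (rule L.no_abelian_idealsD[OF ss]) auto
    moreover have "?C \<noteq> {0}" using L.proper_ideal_centralizer_nonzero[OF ss J(1)] contra by blast
    ultimately show False
      using codim_growth_disjoint_ideals[OF J C centralizer_H_invariant[OF J(2)]] contra lim by blast
  qed
  ultimately show ?thesis
    using ss by (simp add: H_simple_def L.semisimple_iff_no_abelian_ideals)
qed

end

section \<open>Multilinear functions represented by polynomials\<close>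

text \<open>The lower bound is proved by building functions, so commutators are replaced by the closure
  of the variables under all operations. The index set records the variables, each of which
  occurs in every term exactly once.\<close>

inductive (in H_module_lie_algebra) H_poly :: "nat set \<Rightarrow> ((nat \<Rightarrow> 'l) \<Rightarrow> 'l) \<Rightarrow> bool" where
  var: "H_poly {i} (\<lambda>a. a i)"
| zero: "H_poly A (\<lambda>a. 0)"
| add: "H_poly A F \<Longrightarrow> H_poly A G \<Longrightarrow> H_poly A (\<lambda>a. F a + G a)"
| scale: "H_poly A F \<Longrightarrow> H_poly A (\<lambda>a. scaleL c (F a))"
| act: "H_poly A F \<Longrightarrow> H_poly A (\<lambda>a. act h (F a))"
| bracket: "H_poly A F \<Longrightarrow> H_poly B G \<Longrightarrow> A \<inter> B = {} \<Longrightarrow> H_poly (A \<union> B) (\<lambda>a. bracket (F a) (G a))"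

context H_module_lie_algebra
begin

lemma H_poly_sum: "(\<And>i. i \<in> I \<Longrightarrow> H_poly A (F i)) \<Longrightarrow> H_poly A (\<lambda>a. \<Sum>i\<in>I. F i a)"
  by (induction I rule: infinite_finite_induct) (auto intro: H_poly.zero H_poly.add)

lemma H_poly_multilin: "H_poly A F \<Longrightarrow> multilin scaleL A F"
proof (induction rule: H_poly.induct)
  case (add A F G)
  then show ?case using L.multilin_lincomb[of A F G 1] by simp
next
  case (scale A F c)
  then show ?case using L.multilin_lincomb[OF L.multilin_0, of A F c] by simp
next
  case (act A F h)
  show ?case
    unfolding multilin_def
  proof (intro conjI allI impI)
    fix a i x y c assume "i \<in> A"
    then show "act h (F (a(i := scaleL c x + y))) = scaleL c (act h (F (a(i := x)))) + act h (F (a(i := y)))"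
      by (simp only: L.multilin_step[OF act.IH] act_add_right act_scale_right)
  next
    fix a b :: "nat \<Rightarrow> 'l" assume "\<forall>i\<in>A. a i = b i"
    then show "act h (F a) = act h (F b)" using L.multilin_cong[OF act.IH, of a b] by simp
  qed
next
  case (var i)
  show ?case by (simp add: multilin_def)
qed (auto intro: L.multilin_0 L.multilin_bracket)

lemma H_poly_subst:
  assumes "H_poly A F" "H_poly B G"
  shows "i \<in> A \<Longrightarrow> (A - {i}) \<inter> B = {} \<Longrightarrow> H_poly (A - {i} \<union> B) (\<lambda>a. F (a(i := G a)))"
  using assms(1)
proof (induction rule: H_poly.induct)
  case (bracket A1 F1 A2 F2)
  show ?case
  proof (cases "i \<in> A1")
    case True
    then have "F2 (a(i := x)) = F2 a" for a x
      using bracket.hyps by (intro L.multilin_cong[OF H_poly_multilin[OF bracket.hyps(2)]]) auto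
    moreover have "H_poly ((A1 - {i} \<union> B) \<union> A2) (\<lambda>a. bracket (F1 (a(i := G a))) (F2 a))"
      using bracket.prems True bracket.hyps by (intro H_poly.bracket bracket.IH) auto
    moreover have "(A1 - {i} \<union> B) \<union> A2 = A1 \<union> A2 - {i} \<union> B" using True bracket.hyps by auto
    ultimately show ?thesis by (simp only:)
  next
    case False
    then have "F1 (a(i := x)) = F1 a" for a x
      by (intro L.multilin_cong[OF H_poly_multilin[OF bracket.hyps(1)]]) auto
    moreover have "H_poly (A1 \<union> (A2 - {i} \<union> B)) (\<lambda>a. bracket (F1 a) (F2 (a(i := G a))))"
      using bracket.prems False bracket.hyps by (intro H_poly.bracket bracket.IH) auto
    moreover have "A1 \<union> (A2 - {i} \<union> B) = A1 \<union> A2 - {i} \<union> B" using False by auto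
    ultimately show ?thesis by (simp only:)
  qed
qed (auto intro: H_poly.intros assms(2))

lemma H_poly_rename:
  assumes "H_poly A F" "inj \<sigma>"
  shows "H_poly (\<sigma> ` A) (\<lambda>a. F (a \<circ> \<sigma>))"
  using assms(1)
proof (induction rule: H_poly.induct)
  case (var i)
  show ?case using H_poly.var[of "\<sigma> i"] by simp
next
  case (bracket A F B G)
  then have "\<sigma> ` A \<inter> \<sigma> ` B = {}" using assms(2) by (auto dest: injD)
  then show ?case using bracket.IH by (simp add: image_Un H_poly.bracket)
qed (auto intro: H_poly.intros)

section \<open>Reduction to long commutators\<close>

definition left_normed :: "(nat \<times> 'h) list \<Rightarrow> 'h monomial" where
  "left_normed l = foldl Prod (Letter (fst (hd l)) (snd (hd l))) (map (\<lambda>(i, h). Letter i h) (tl l))"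

definition is_word_on :: "nat set \<Rightarrow> (nat \<times> 'h) list \<Rightarrow> bool" where
  "is_word_on A l \<longleftrightarrow> l \<noteq> [] \<and> distinct (map fst l) \<and> set (map fst l) = A"

definition left_normed_span :: "nat set \<Rightarrow> ('h monomial \<Rightarrow>\<^sub>0 'f) set" where
  "left_normed_span A = free.span {basis_vec (left_normed l) |l. is_word_on A l}"

definition left_normed_fun :: "nat set \<Rightarrow> ((nat \<Rightarrow> 'l) \<Rightarrow> 'l) \<Rightarrow> bool" where
  "left_normed_fun A F \<longleftrightarrow> (\<exists>q\<in>left_normed_span A. \<forall>a. eval_poly a q = F a)"

lemma left_normed_single: "left_normed [(i, h)] = Letter i h"
  by (simp add: left_normed_def)

lemma left_normed_snoc: "l \<noteq> [] \<Longrightarrow> left_normed (l @ [(i, h)]) = Prod (left_normed l) (Letter i h)"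
  by (cases l) (auto simp: left_normed_def)

lemma left_normed_fun_word: "is_word_on A l \<Longrightarrow> left_normed_fun A (\<lambda>a. eval_monomial a (left_normed l))"
  unfolding left_normed_fun_def left_normed_span_def
  by (intro bexI[of _ "basis_vec (left_normed l)"] free.span_base) (auto simp: L.lin_ext_single)

lemma left_normed_fun_zero: "left_normed_fun A (\<lambda>a. 0)"
  unfolding left_normed_fun_def left_normed_span_def by (intro bexI[of _ 0] free.span_zero) auto

lemma left_normed_fun_lincomb:
  assumes "left_normed_fun A F" "left_normed_fun A G"
  shows "left_normed_fun A (\<lambda>a. scaleL c (F a) + G a)"
proof -
  obtain p q where "p \<in> left_normed_span A" "q \<in> left_normed_span A"
    "\<And>a. eval_poly a p = F a" "\<And>a. eval_poly a q = G a"
    using assms by (auto simp: left_normed_fun_def)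
  then show ?thesis
    unfolding left_normed_fun_def left_normed_span_def
    by (intro bexI[of _ "smult_free c p + q"] free.span_add free.span_scale)
       (auto simp: L.lin_ext_add L.lin_ext_smult)
qed

lemma left_normed_fun_add:
  "left_normed_fun A F \<Longrightarrow> left_normed_fun A G \<Longrightarrow> left_normed_fun A (\<lambda>a. F a + G a)"
  using left_normed_fun_lincomb[of A F G 1] by simp

lemma left_normed_fun_sum_list:
  "(\<And>x. left_normed_fun A (F x)) \<Longrightarrow> left_normed_fun A (\<lambda>a. \<Sum>x\<leftarrow>xs. F x a)"
  by (induction xs) (auto intro: left_normed_fun_zero left_normed_fun_add)

text \<open>Operations that are linear in the value of the polynomial need to be checked on single
  commutators only. The operation may depend on further variables.\<close>

lemma left_normed_fun_linear:
  assumes F: "left_normed_fun A F"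
    and linear: "\<And>a c x y. \<Phi> a (scaleL c x + y) = scaleL c (\<Phi> a x) + \<Phi> a y"
    and words: "\<And>l. is_word_on A l \<Longrightarrow> left_normed_fun A' (\<lambda>a. \<Phi> a (eval_monomial a (left_normed l)))"
  shows "left_normed_fun A' (\<lambda>a. \<Phi> a (F a))"
proof -
  obtain q where q: "q \<in> left_normed_span A" "\<And>a. eval_poly a q = F a"
    using F by (auto simp: left_normed_fun_def)
  have "left_normed_fun A' (\<lambda>a. \<Phi> a (eval_poly a q))"
    using q(1) unfolding left_normed_span_def
  proof (induction rule: free.span_induct_alt)
    case base
    have "\<Phi> a 0 = 0" for a using linear[of a 1 0 0] by simp
    then show ?case by (simp add: left_normed_fun_zero)
  next
    case (step c x y)
    then obtain l where l: "x = basis_vec (left_normed l)" "is_word_on A l" by auto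
    show ?case
      using left_normed_fun_lincomb[OF words[OF l(2)] step(2), of c]
      by (simp add: l(1) L.lin_ext_add L.lin_ext_smult L.lin_ext_single linear)
  qed
  then show ?thesis by (simp add: q)
qed

lemma left_normed_fun_letter: "left_normed_fun {i} (\<lambda>a. act h (a i))"
  using left_normed_fun_word[of "{i}" "[(i, h)]"] by (simp add: is_word_on_def left_normed_single)

lemma left_normed_fun_append_letter:
  assumes "left_normed_fun A F" "i \<notin> A"
  shows "left_normed_fun (insert i A) (\<lambda>a. bracket (F a) (act h (a i)))"
proof (rule left_normed_fun_linear[OF assms(1)])
  fix l assume l: "is_word_on A l"
  then have "is_word_on (insert i A) (l @ [(i, h)])" using assms(2) by (auto simp: is_word_on_def)
  from left_normed_fun_word[OF this] l
  show "left_normed_fun (insert i A) (\<lambda>a. bracket (eval_monomial a (left_normed l)) (act h (a i)))"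
    by (simp add: left_normed_snoc is_word_on_def)
qed (simp add: L.bracket_add_left L.bracket_scale_left)

lemma left_normed_fun_act_word:
  "is_word_on A l \<Longrightarrow> left_normed_fun A (\<lambda>a. act h (eval_monomial a (left_normed l)))"
proof (induction l arbitrary: A h rule: rev_induct)
  case Nil
  then show ?case by (simp add: is_word_on_def)
next
  case (snoc x l)
  obtain i g where x: "x = (i, g)" by (cases x)
  show ?case
  proof (cases "l = []")
    case True
    then show ?thesis
      using snoc.prems left_normed_fun_letter[of i "h * g"]
      by (auto simp: x is_word_on_def left_normed_single act_mult)
  next
    case False
    define A' where "A' = set (map fst l)"
    have A: "A = insert i A'" "i \<notin> A'" and l: "is_word_on A' l"
      using snoc.prems False by (auto simp: is_word_on_def A'_def x)
    have "left_normed_fun A (\<lambda>a. bracket (act p (eval_monomial a (left_normed l))) (act (q * g) (a i)))"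
      for p q
      unfolding A(1) by (rule left_normed_fun_append_letter[OF snoc.IH[OF l] A(2)])
    then have "left_normed_fun A (\<lambda>a. \<Sum>y\<leftarrow>comult h. bracket (act (fst y) (eval_monomial a (left_normed l)))
        (act (snd y * g) (a i)))"
      by (intro left_normed_fun_sum_list) auto
    then show ?thesis
      by (simp add: x left_normed_snoc[OF False] act_bracket act_mult split_def)
  qed
qed

lemma left_normed_fun_act:
  "left_normed_fun A F \<Longrightarrow> left_normed_fun A (\<lambda>a. act h (F a))"
  by (rule left_normed_fun_linear)
     (auto simp: act_add_right act_scale_right intro: left_normed_fun_act_word)

text \<open>Induction on the second word with \<open>[u, [v, x]] = [[u, v], x] - [[u, x], v]\<close>.\<close>

lemma left_normed_fun_bracket_word:
  "is_word_on B l \<Longrightarrow> left_normed_fun A F \<Longrightarrow> A \<inter> B = {} \<Longrightarrow>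
    left_normed_fun (A \<union> B) (\<lambda>a. bracket (F a) (eval_monomial a (left_normed l)))"
proof (induction l arbitrary: A B F rule: rev_induct)
  case Nil
  then show ?case by (simp add: is_word_on_def)
next
  case (snoc x l)
  obtain i g where x: "x = (i, g)" by (cases x)
  show ?case
  proof (cases "l = []")
    case True
    then show ?thesis
      using snoc.prems left_normed_fun_append_letter[of A F i g]
      by (auto simp: x is_word_on_def left_normed_single)
  next
    case False
    define B' where "B' = set (map fst l)"
    have B: "B = insert i B'" "i \<notin> B'" and l: "is_word_on B' l"
      using snoc.prems False by (auto simp: is_word_on_def B'_def x)
    let ?v = "\<lambda>a. eval_monomial a (left_normed l)" and ?x = "\<lambda>a. act g (a i)"
    have "left_normed_fun (insert i (A \<union> B')) (\<lambda>a. bracket (bracket (F a) (?v a)) (?x a))"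
      using snoc.prems B by (intro left_normed_fun_append_letter snoc.IH[OF l]) auto
    moreover have "left_normed_fun (insert i A \<union> B') (\<lambda>a. bracket (bracket (F a) (?x a)) (?v a))"
      using snoc.prems B by (intro left_normed_fun_append_letter snoc.IH[OF l]) auto
    ultimately have "left_normed_fun (A \<union> B) (\<lambda>a. scaleL (- 1) (bracket (bracket (F a) (?x a)) (?v a))
        + bracket (bracket (F a) (?v a)) (?x a))"
      unfolding B(1) by (intro left_normed_fun_lincomb) simp_all
    moreover have "scaleL (- 1) (bracket (bracket u y) v) + bracket (bracket u v) y = bracket u (bracket v y)"
      for u v y
      using L.bracket_derivation[of u v y] L.bracket_anticommute[of v "bracket u y"] by simp
    ultimately show ?thesis by (simp add: x left_normed_snoc[OF False])
  qed
qed

lemma left_normed_fun_bracket: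
  assumes "left_normed_fun A F" "left_normed_fun B G" "A \<inter> B = {}"
  shows "left_normed_fun (A \<union> B) (\<lambda>a. bracket (F a) (G a))"
  using assms(2)
  by (rule left_normed_fun_linear)
     (auto simp: L.bracket_add_right L.bracket_scale_right
       intro: left_normed_fun_bracket_word[OF _ assms(1,3)])

lemma H_poly_left_normed_fun: "H_poly A F \<Longrightarrow> left_normed_fun A F"
proof (induction rule: H_poly.induct)
  case (var i)
  show ?case using left_normed_fun_letter[of i 1] by (simp add: act_one)
next
  case (scale A F c)
  then show ?case using left_normed_fun_lincomb[OF _ left_normed_fun_zero, of A F c] by simp
qed (auto intro: left_normed_fun_zero left_normed_fun_add left_normed_fun_act left_normed_fun_bracket)

lemma left_normed_span_commutator_span:
  "left_normed_span {..<n} \<subseteq> commutator_span n"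
  unfolding left_normed_span_def commutator_span_def
proof (rule free.span_mono, rule subsetI)
  fix x :: "'h monomial \<Rightarrow>\<^sub>0 'f" assume "x \<in> {basis_vec (left_normed l) |l. is_word_on {..<n} l}"
  then obtain l where x: "x = basis_vec (left_normed l)" and l: "l \<noteq> []" "distinct (map fst l)"
      "set (map fst l) = {..<n}"
    by (auto simp: is_word_on_def)
  have len: "length l = n" using distinct_card[OF l(2)] l(3) by simp
  define \<sigma> where "\<sigma> i = (if i < n then fst (l ! i) else i)" for i
  define h where "h i = snd (l ! i)" for i
  have "\<sigma> permutes {..<n}"
  proof (rule bij_imp_permutes)
    have "\<sigma> ` {..<n} = (\<lambda>i. fst (l ! i)) ` {..<n}" by (rule image_cong) (auto simp: \<sigma>_def)
    also have "\<dots> = fst ` set l" using len by (auto simp: set_conv_nth)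
    also have "\<dots> = {..<n}" using l(3) by simp
    finally have "\<sigma> ` {..<n} = {..<n}" .
    moreover have "inj_on \<sigma> {..<n}"
      using l(2) len by (auto simp: inj_on_def \<sigma>_def distinct_conv_nth)
    ultimately show "bij_betw \<sigma> {..<n} {..<n}" by (simp add: bij_betw_def)
  qed (simp add: \<sigma>_def)
  moreover have "left_normed l = H.long_commutator n \<sigma> h"
  proof -
    have "map (\<lambda>(i, h). Letter i h) (tl l) = map (\<lambda>i. Letter (\<sigma> i) (h i)) [1..<n]"
      using len by (intro nth_equalityI) (auto simp: \<sigma>_def h_def nth_tl split_def)
    moreover have "n > 0" using l(1) len by auto
    ultimately show ?thesis
      using l(1) by (simp add: left_normed_def H.long_commutator_def \<sigma>_def h_def hd_conv_nth)
  qed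
  ultimately show "x \<in> {basis_vec (H.long_commutator n \<sigma> h) |\<sigma> h. \<sigma> permutes {..<n}}"
    using x by auto
qed

lemma H_poly_commutator_span:
  assumes "H_poly {..<n} F"
  shows "\<exists>q\<in>commutator_span n. \<forall>a. eval_poly a q = F a"
  using H_poly_left_normed_fun[OF assms] left_normed_span_commutator_span
  by (auto simp: left_normed_fun_def)

end

section \<open>Alternating functions\<close>

context lie_algebra
begin

lemma multilin_sum:
  "(\<And>i. i \<in> I \<Longrightarrow> multilin scale A (F i)) \<Longrightarrow> multilin scale A (\<lambda>a. \<Sum>i\<in>I. F i a)"
proof (induction I rule: infinite_finite_induct)
  case (insert i I)
  then show ?case using multilin_lincomb[of A "\<lambda>a. \<Sum>i\<in>I. F i a" "F i" 1] by (simp add: add.commute)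
qed (auto intro: multilin_0)

lemma multilin_scale: "multilin scale A F \<Longrightarrow> multilin scale A (\<lambda>a. scale c (F a))"
  using multilin_lincomb[OF multilin_0, of A F c] by simp

lemma multilin_permute:
  assumes F: "multilin scale A F" and \<sigma>: "\<sigma> permutes S" "S \<subseteq> A"
  shows "multilin scale A (\<lambda>a. F (a \<circ> \<sigma>))"
  unfolding multilin_def
proof (intro conjI allI impI)
  have A: "\<sigma> i \<in> A \<longleftrightarrow> i \<in> A" for i
    using permutes_in_image[OF permutes_subset[OF \<sigma>]] .
  fix a :: "nat \<Rightarrow> 'l" and i x y c assume i: "i \<in> A"
  have "a(i := v) \<circ> \<sigma> = (a \<circ> \<sigma>)(inv \<sigma> i := v)" for v
    using permutes_inverses[OF \<sigma>(1)] by (auto simp: fun_eq_iff)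
  moreover have "inv \<sigma> i \<in> A" using A[of "inv \<sigma> i"] i permutes_inverses[OF \<sigma>(1)] by simp
  ultimately show "F (a(i := scale c x + y) \<circ> \<sigma>) = scale c (F (a(i := x) \<circ> \<sigma>)) + F (a(i := y) \<circ> \<sigma>)"
    by (simp add: multilin_step[OF F])
next
  fix a b :: "nat \<Rightarrow> 'l" assume "\<forall>i\<in>A. a i = b i"
  then show "F (a \<circ> \<sigma>) = F (b \<circ> \<sigma>)"
    using permutes_in_image[OF permutes_subset[OF \<sigma>]] by (intro multilin_cong[OF F]) simp
qed

lemma multilin_restrict:
  assumes F: "multilin scale A F" and "S \<subseteq> A"
  shows "multilin scale S (\<lambda>b. F (\<lambda>i. if i \<in> S then b i else a i))"
  unfolding multilin_def
proof (intro conjI allI impI)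
  fix b i x y c assume i: "i \<in> S"
  have "(\<lambda>k. if k \<in> S then (b(i := v)) k else a k) = (\<lambda>k. if k \<in> S then b k else a k)(i := v)" for v
    using i by (auto simp: fun_eq_iff)
  then show "F (\<lambda>k. if k \<in> S then (b(i := scale c x + y)) k else a k)
      = scale c (F (\<lambda>k. if k \<in> S then (b(i := x)) k else a k)) + F (\<lambda>k. if k \<in> S then (b(i := y)) k else a k)"
    using i assms(2) by (simp only: multilin_step[OF F] subsetD)
next
  fix b b' :: "nat \<Rightarrow> 'l" assume "\<forall>i\<in>S. b i = b' i"
  then have "(\<lambda>i. if i \<in> S then b i else a i) = (\<lambda>i. if i \<in> S then b' i else a i)" by auto
  then show "F (\<lambda>i. if i \<in> S then b i else a i) = F (\<lambda>i. if i \<in> S then b' i else a i)" by simp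
qed

definition antisym_fun :: "nat \<Rightarrow> ((nat \<Rightarrow> 'l) \<Rightarrow> 'l) \<Rightarrow> bool" where
  "antisym_fun k F \<longleftrightarrow> (\<forall>\<sigma> a. \<sigma> permutes {..<k} \<longrightarrow> F (a \<circ> \<sigma>) = scale (of_int (sign \<sigma>)) (F a))"

definition alternation :: "nat \<Rightarrow> ((nat \<Rightarrow> 'l) \<Rightarrow> 'l) \<Rightarrow> (nat \<Rightarrow> 'l) \<Rightarrow> 'l" where
  "alternation k F a = (\<Sum>\<sigma> | \<sigma> permutes {..<k}. scale (of_int (sign \<sigma>)) (F (a \<circ> \<sigma>)))"

lemma antisym_funD:
  "antisym_fun k F \<Longrightarrow> \<sigma> permutes {..<k} \<Longrightarrow> F (a \<circ> \<sigma>) = scale (of_int (sign \<sigma>)) (F a)"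
  by (simp add: antisym_fun_def)

lemma antisym_fun_alternation: "antisym_fun k (alternation k F)"
  unfolding antisym_fun_def
proof (intro allI impI)
  fix \<tau> a assume \<tau>: "\<tau> permutes {..<k}"
  have perm: "permutation \<sigma>" if "\<sigma> permutes {..<k}" for \<sigma>
    using that permutation_permutes by blast
  have "scale (of_int (sign \<tau>)) (alternation k F a)
      = (\<Sum>\<sigma> | \<sigma> permutes {..<k}. scale (of_int (sign \<tau> * sign (\<tau> \<circ> \<sigma>))) (F (a \<circ> (\<tau> \<circ> \<sigma>))))"
    unfolding alternation_def
    by (subst setum_permutations_compose_left[OF \<tau>]) (simp add: scale_sum_right)
  also have "\<dots> = alternation k F (a \<circ> \<tau>)"
    unfolding alternation_def
  proof (rule sum.cong)
    fix \<sigma> assume "\<sigma> \<in> {\<sigma>. \<sigma> permutes {..<k}}"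
    then have "sign \<tau> * sign (\<tau> \<circ> \<sigma>) = sign \<sigma>"
      using perm[OF \<tau>] perm[of \<sigma>] by (simp add: sign_compose mult.assoc[symmetric] sign_idempotent)
    then show "scale (of_int (sign \<tau> * sign (\<tau> \<circ> \<sigma>))) (F (a \<circ> (\<tau> \<circ> \<sigma>)))
        = scale (of_int (sign \<sigma>)) (F (a \<circ> \<tau> \<circ> \<sigma>))" by (simp add: o_assoc)
  qed simp
  finally show "alternation k F (a \<circ> \<tau>) = scale (of_int (sign \<tau>)) (alternation k F a)" by simp
qed

lemma multilin_alternation:
  assumes "multilin scale A F" "{..<k} \<subseteq> A"
  shows "multilin scale A (alternation k F)"
  unfolding alternation_def
  by (intro multilin_sum multilin_scale multilin_permute[OF assms(1) _ assms(2)]) simp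

lemma antisym_fun_lincomb:
  assumes "antisym_fun k F" "antisym_fun k G"
  shows "antisym_fun k (\<lambda>a. F a + scale c (G a))"
  using assms by (simp add: antisym_fun_def scale_right_distrib mult.commute)

end

context fd_lie_algebra
begin

lemma antisym_fun_repeated:
  assumes F: "antisym_fun k F" and "p < k" "q < k" "p \<noteq> q" "a p = a q"
  shows "F a = 0"
proof -
  have "transpose p q permutes {..<k}" using assms by (intro permutes_swap_id) auto
  moreover have "a \<circ> transpose p q = a" using assms(5) by (auto simp: fun_eq_iff transpose_def)
  ultimately have "F a = scale (of_int (sign (transpose p q))) (F a)"
    using antisym_funD[OF F, of "transpose p q" a] by simp
  then have "F a + F a = 0" using assms(4) by (simp add: sign_swap_id eq_neg_iff_add_eq_0)
  then have "scale 2 (F a) = 0" by (simp only: one_add_one[symmetric] scale_left_distrib scale_one)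
  then show ?thesis by simp
qed

text \<open>An enumeration of the basis; the slots \<open>0, \<dots>, d - 1\<close> are the ones that alternate.\<close>

definition basis_enum :: "nat \<Rightarrow> 'b" where
  "basis_enum = (SOME e. bij_betw e {..<card Basis} Basis)"

lemma basis_enum: "bij_betw basis_enum {..<card Basis} Basis"
proof -
  have "\<exists>e. bij_betw e {..<card Basis} Basis"
    using ex_bij_betw_nat_finite[OF finite_Basis] by (simp add: atLeast0LessThan)
  then show ?thesis unfolding basis_enum_def by (rule someI_ex)
qed

lemma basis_enum_in: "i < card Basis \<Longrightarrow> basis_enum i \<in> Basis"
  using basis_enum by (auto simp: bij_betw_def)

lemma basis_enum_eq_iff: "i < card Basis \<Longrightarrow> k < card Basis \<Longrightarrow> basis_enum i = basis_enum k \<longleftrightarrow> i = k"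
  using basis_enum by (auto simp: bij_betw_def inj_on_def)

abbreviation coord :: "nat \<Rightarrow> 'b \<Rightarrow> 'f" where
  "coord i v \<equiv> representation Basis v (basis_enum i)"

lemma coord_basis_enum:
  "i < card Basis \<Longrightarrow> k < card Basis \<Longrightarrow> coord i (basis_enum k) = (if i = k then 1 else 0)"
  using coord_basis[OF is_basis_Basis basis_enum_in, of k "basis_enum i"] basis_enum_eq_iff[of i k]
  by simp

lemma sum_Basis: "(\<Sum>b\<in>Basis. f b) = (\<Sum>i<card Basis. f (basis_enum i))"
  by (rule sum.reindex_bij_betw[OF basis_enum, symmetric])

text \<open>A tuple of basis vectors either has a repetition or is a permutation of the enumerated basis.\<close>

lemma antisym_fun_zero:
  assumes F: "multilin scale A F" "antisym_fun (card Basis) F" and A: "{..<card Basis} \<subseteq> A"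
    and zero: "\<And>a. (\<And>i. i < card Basis \<Longrightarrow> a i = basis_enum i) \<Longrightarrow> F a = 0"
  shows "F a = 0"
proof -
  let ?d = "card Basis"
  let ?o = "\<lambda>b i. if i \<in> {..<?d} then b i else a i"
  have "F (?o b) = 0" for b
  proof (rule multilin_zero[OF multilin_restrict[OF F(1) A], of Basis])
    fix b assume b: "\<forall>i\<in>{..<?d}. b i \<in> Basis"
    show "F (?o b) = 0"
    proof (cases "inj_on b {..<?d}")
      case False
      then obtain p q where "p < ?d" "q < ?d" "p \<noteq> q" "b p = b q" by (auto simp: inj_on_def)
      then show ?thesis by (intro antisym_fun_repeated[OF F(2), of p q]) auto
    next
      case True
      define inv_e where "inv_e = inv_into {..<?d} basis_enum"
      have inv_e: "inv_e v < ?d" "basis_enum (inv_e v) = v" if "v \<in> Basis" for v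
        using that basis_enum inv_into_into[of v basis_enum "{..<?d}"] f_inv_into_f[of v basis_enum "{..<?d}"]
        by (auto simp: inv_e_def bij_betw_def)
      define \<sigma> where "\<sigma> i = (if i < ?d then inv_e (b i) else i)" for i
      have "\<sigma> permutes {..<?d}"
      proof (rule bij_imp_permutes)
        have inj: "inj_on \<sigma> {..<?d}"
        proof (rule inj_onI)
          fix i j assume ij: "i \<in> {..<?d}" "j \<in> {..<?d}" "\<sigma> i = \<sigma> j"
          then have "inv_e (b i) = inv_e (b j)" by (simp add: \<sigma>_def)
          moreover have "basis_enum (inv_e (b i)) = b i" "basis_enum (inv_e (b j)) = b j"
            using b ij(1,2) inv_e(2) by blast+
          ultimately have "b i = b j" by metis
          then show "i = j" using True ij by (simp add: inj_on_eq_iff)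
        qed
        moreover have "\<sigma> ` {..<?d} \<subseteq> {..<?d}" using inv_e b by (auto simp: \<sigma>_def)
        ultimately show "bij_betw \<sigma> {..<?d} {..<?d}"
          by (simp add: bij_betw_def endo_inj_surj)
      qed (simp add: \<sigma>_def)
      moreover have "?o b = ?o basis_enum \<circ> \<sigma>"
        using inv_e b by (auto simp: fun_eq_iff \<sigma>_def)
      ultimately show ?thesis using antisym_funD[OF F(2)] zero[of "?o basis_enum"] by simp
    qed
  qed (use span_Basis in auto)
  from this[of a] show ?thesis by simp
qed

section \<open>Determinants\<close>

text \<open>The alternation of a product of linear forms: the determinant of the matrix \<open>\<phi> j (x i)\<close>.\<close>

definition form_det :: "(nat \<Rightarrow> 'b \<Rightarrow> 'f) \<Rightarrow> (nat \<Rightarrow> 'b) \<Rightarrow> 'f" where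
  "form_det \<phi> x = (\<Sum>\<sigma> | \<sigma> permutes {..<card Basis}.
     of_int (sign \<sigma>) * (\<Prod>j<card Basis. \<phi> j (x (\<sigma> j))))"

abbreviation basis_det :: "(nat \<Rightarrow> 'b) \<Rightarrow> 'f" where
  "basis_det \<equiv> form_det coord"

definition linear_form :: "('b \<Rightarrow> 'f) \<Rightarrow> bool" where
  "linear_form f \<longleftrightarrow> (\<forall>c x y. f (scale c x + y) = c * f x + f y)"

lemma form_det_alternation:
  "scale (form_det \<phi> x) v = alternation (card Basis) (\<lambda>x. scale (\<Prod>j<card Basis. \<phi> j (x j)) v) x"
  by (simp add: form_det_def alternation_def scale_sum_left)

lemma multilin_form_prod:
  assumes "\<And>j. j < k \<Longrightarrow> linear_form (\<phi> j)"
  shows "multilin scale {..<k} (\<lambda>x. scale (\<Prod>j<k. \<phi> j (x j)) v)"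
  unfolding multilin_def
proof (intro conjI allI impI)
  fix a i x y c assume i: "i \<in> {..<k}"
  have split: "(\<Prod>j<k. \<phi> j ((a(i := z)) j)) = \<phi> i z * (\<Prod>j\<in>{..<k} - {i}. \<phi> j (a j))" for z
    using i by (subst prod.remove[of _ i]) (auto intro!: prod.cong)
  show "scale (\<Prod>j<k. \<phi> j ((a(i := scale c x + y)) j)) v
      = scale c (scale (\<Prod>j<k. \<phi> j ((a(i := x)) j)) v) + scale (\<Prod>j<k. \<phi> j ((a(i := y)) j)) v"
    unfolding split using assms[of i] i
    by (simp add: linear_form_def scale_left_distrib distrib_right mult.assoc)
next
  fix a b :: "nat \<Rightarrow> 'b" assume "\<forall>i\<in>{..<k}. a i = b i"
  then have "(\<Prod>j<k. \<phi> j (a j)) = (\<Prod>j<k. \<phi> j (b j))" by (intro prod.cong) auto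
  then show "scale (\<Prod>j<k. \<phi> j (a j)) v = scale (\<Prod>j<k. \<phi> j (b j)) v" by simp
qed

lemma linear_form_coord: "linear_form (coord i)"
  by (simp add: linear_form_def coord_add[OF is_basis_Basis] coord_scale[OF is_basis_Basis])

lemma form_det_cong:
  assumes "\<And>i. i < card Basis \<Longrightarrow> x i = y i"
  shows "form_det \<phi> x = form_det \<phi> y"
  unfolding form_det_def
  using assms permutes_in_image by (intro sum.cong prod.cong arg_cong2[of _ _ _ _ "(*)"] refl) fastforce

lemma basis_det_letters:
  assumes "\<And>j. j < card Basis \<Longrightarrow> c j < card Basis" "basis_det (\<lambda>j. basis_enum (c j)) \<noteq> 0"
  shows "inj_on c {..<card Basis}"
proof -
  obtain \<sigma> where \<sigma>: "\<sigma> permutes {..<card Basis}" "(\<Prod>j<card Basis. coord j (basis_enum (c (\<sigma> j)))) \<noteq> 0"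
    using assms(2) unfolding form_det_def by (metis (no_types, lifting) mem_Collect_eq mult_zero_right sum.neutral)
  have \<sigma>_less: "\<sigma> j < card Basis" if "j < card Basis" for j
    using permutes_in_image[OF \<sigma>(1)] that by auto
  have "c (\<sigma> j) = j" if "j < card Basis" for j
  proof -
    have "coord j (basis_enum (c (\<sigma> j))) \<noteq> 0" using \<sigma>(2) that by auto
    then show ?thesis using coord_basis_enum[OF that assms(1)[OF \<sigma>_less[OF that]]] by (auto split: if_splits)
  qed
  then have "c ` {..<card Basis} = {..<card Basis}"
    using assms(1) \<sigma>_less by (auto simp: image_iff) (metis lessThan_iff)
  then show ?thesis by (simp add: eq_card_imp_inj_on)
qed

lemma basis_det_enum: "basis_det basis_enum = 1"
proof -
  have "(\<Prod>j<card Basis. coord j (basis_enum (\<sigma> j))) = (if \<sigma> = id then 1 else 0)"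
    if \<sigma>: "\<sigma> permutes {..<card Basis}" for \<sigma>
  proof (cases "\<sigma> = id")
    case True
    then show ?thesis by (auto simp: coord_basis_enum intro: prod.neutral)
  next
    case False
    then obtain j where "\<sigma> j \<noteq> j" by (auto simp: fun_eq_iff)
    then have j: "j < card Basis" "\<sigma> j \<noteq> j" using \<sigma> by (auto simp: permutes_def)
    then have "\<sigma> j < card Basis" using permutes_in_image[OF \<sigma>, of j] by simp
    then have "coord j (basis_enum (\<sigma> j)) = 0" using coord_basis_enum[OF j(1)] j by auto
    then show ?thesis using j False by auto
  qed
  then have "basis_det basis_enum
      = (\<Sum>\<sigma> | \<sigma> permutes {..<card Basis}. if \<sigma> = id then 1 else 0)"
    unfolding form_det_def by (intro sum.cong) auto
  also have "\<dots> = 1" by (subst sum.delta) (auto simp: finite_permutations permutes_id)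
  finally show ?thesis .
qed

text \<open>Both sides, times a fixed vector, are alternating multilinear functions that agree on the
  enumerated basis.\<close>

lemma form_det_basis_det:
  assumes "\<And>j. linear_form (\<phi> j)"
  shows "form_det \<phi> x = basis_det x * form_det \<phi> basis_enum"
proof (cases "Basis = {}")
  case True
  then have "card Basis = 0" by simp
  then show ?thesis by (simp add: form_det_def del: card_eq_0_iff)
next
  case False
  then obtain v where v: "v \<in> Basis" by auto
  then have "v \<noteq> 0" using independent_Basis dependent_zero by blast
  let ?F = "\<lambda>x. scale (form_det \<phi> x) v + scale (- form_det \<phi> basis_enum) (scale (basis_det x) v)"
  have "multilin scale {..<card Basis} (\<lambda>x. scale (form_det \<phi> x) v)"
    if "\<And>j. linear_form (\<phi> j)" for \<phi>
    unfolding form_det_alternation using that by (intro multilin_alternation multilin_form_prod) auto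
  then have "multilin scale {..<card Basis} ?F"
    using assms linear_form_coord by (intro multilin_lincomb) auto
  moreover have "antisym_fun (card Basis) ?F"
    by (intro antisym_fun_lincomb) (unfold form_det_alternation, (rule antisym_fun_alternation)+)
  ultimately have "?F x = 0"
  proof (rule antisym_fun_zero)
    fix a assume "\<And>i. i < card Basis \<Longrightarrow> a i = basis_enum i"
    then have "form_det \<phi> a = form_det \<phi> basis_enum" for \<phi> by (rule form_det_cong)
    then show "?F a = 0" by (simp add: basis_det_enum)
  qed auto
  then have "scale (form_det \<phi> x - form_det \<phi> basis_enum * basis_det x) v = 0"
    by (simp add: scale_left_diff_distrib)
  then show ?thesis using \<open>v \<noteq> 0\<close> by (simp add: mult.commute)
qed

lemma linear_form_killing: "linear_form (\<lambda>v. killing v y)"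
  by (simp add: linear_form_def killing_add_left killing_scale_left)

definition killing_det :: "(nat \<Rightarrow> 'b) \<Rightarrow> (nat \<Rightarrow> 'b) \<Rightarrow> 'f" where
  "killing_det x y = form_det (\<lambda>j v. killing v (y j)) x"

lemma killing_det_commute: "killing_det x y = killing_det y x"
proof -
  have "(\<Prod>j<card Basis. killing (x (inv \<sigma> j)) (y j)) = (\<Prod>j<card Basis. killing (y (\<sigma> j)) (x j))"
    if \<sigma>: "\<sigma> permutes {..<card Basis}" for \<sigma>
    using prod.permute[OF \<sigma>, of "\<lambda>j. killing (x (inv \<sigma> j)) (y j)"] permutes_inverses[OF \<sigma>]
    by (simp add: comp_def killing_commute)
  moreover have "sign (inv \<sigma>) = sign \<sigma>" if "\<sigma> permutes {..<card Basis}" for \<sigma>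
    using that permutation_permutes by (intro sign_inverse) blast
  ultimately show ?thesis
    unfolding killing_det_def form_det_def
    by (subst sum_permutations_inverse) (auto intro!: sum.cong)
qed

lemma killing_det_factor:
  "killing_det x y = killing_det basis_enum basis_enum * basis_det x * basis_det y"
proof -
  have *: "killing_det x y = basis_det x * killing_det basis_enum y" for x y
    unfolding killing_det_def by (rule form_det_basis_det) (rule linear_form_killing)
  show ?thesis
    using *[of x y] *[of y basis_enum] killing_det_commute[of basis_enum y] by simp
qed

text \<open>The Killing form is nondegenerate, so the enumerated basis has a dual basis up to factors;
  its Gram matrix with the basis is diagonal.\<close>

lemma killing_det_nonzero:
  assumes ss: "no_abelian_ideals"
  shows "killing_det basis_enum basis_enum \<noteq> 0"
proof -
  let ?d = "card Basis"
  have "\<exists>y. killing (basis_enum j) y \<noteq> 0 \<and> (\<forall>i<?d. i \<noteq> j \<longrightarrow> killing (basis_enum i) y = 0)"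
    if j: "j < ?d" for j
  proof -
    obtain c where c: "\<exists>k\<in>{..<?d}. c k \<noteq> 0"
        "\<forall>i\<in>{..<?d} - {j}. (\<Sum>k\<in>{..<?d}. killing (basis_enum i) (basis_enum k) * c k) = 0"
      using homogeneous_system_nontrivial_solution[of "{..<?d} - {j}" "{..<?d}"
          "\<lambda>i k. killing (basis_enum i) (basis_enum k)"] j by auto
    define y where "y = (\<Sum>k<?d. scale (c k) (basis_enum k))"
    have "coord k y = c k" if "k < ?d" for k
      using that by (simp add: y_def coord_sum[OF is_basis_Basis] coord_scale[OF is_basis_Basis]
          coord_basis_enum sum.delta' if_distrib[of "(*) _"] cong: if_cong)
    then have "y \<noteq> 0" using c(1) coord_0[OF is_basis_Basis] by auto
    have k0: "killing x 0 = 0" for x using killing_scale_right[of x 0 0] by simp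
    have "killing x (\<Sum>k\<in>K. scale (c k) (basis_enum k)) = (\<Sum>k\<in>K. killing x (basis_enum k) * c k)" for x K
      by (induction K rule: infinite_finite_induct) (auto simp: k0 killing_add_right killing_scale_right)
    then have orth: "killing (basis_enum i) y = 0" if "i < ?d" "i \<noteq> j" for i
      using c(2) that by (simp add: y_def)
    have "killing (basis_enum j) y \<noteq> 0"
    proof
      assume 0: "killing (basis_enum j) y = 0"
      have "killing x y = 0" for x
      proof -
        have "killing (\<Sum>k\<in>K. scale (r k) (basis_enum k)) y = (\<Sum>k\<in>K. r k * killing (basis_enum k) y)" for r K
          using killing_scale_left[of 0 0 y]
          by (induction K rule: infinite_finite_induct) (auto simp: killing_add_left killing_scale_left)
        moreover have "(\<Sum>k<?d. scale (coord k x) (basis_enum k)) = x"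
          using coord_expand[OF is_basis_Basis, of x] by (simp add: sum_Basis)
        moreover have "(\<Sum>k<?d. coord k x * killing (basis_enum k) y) = 0"
          using orth 0 by (intro sum.neutral) (metis lessThan_iff mult_zero_right)
        ultimately show ?thesis by metis
      qed
      then have "killing y x = 0" for x by (simp add: killing_commute)
      then show False using killing_nondegenerate[OF ss] \<open>y \<noteq> 0\<close> by blast
    qed
    then show ?thesis using orth by blast
  qed
  then obtain y where y: "\<And>j. j < ?d \<Longrightarrow> killing (basis_enum j) (y j) \<noteq> 0"
      "\<And>i j. i < ?d \<Longrightarrow> j < ?d \<Longrightarrow> i \<noteq> j \<Longrightarrow> killing (basis_enum i) (y j) = 0"
    by metis
  have "(\<Prod>j<?d. killing (basis_enum (\<sigma> j)) (y j)) = 0" if \<sigma>: "\<sigma> permutes {..<?d}" "\<sigma> \<noteq> id" for \<sigma>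
  proof -
    obtain j where "\<sigma> j \<noteq> j" using \<sigma>(2) by (auto simp: fun_eq_iff)
    then have j: "j < ?d" "\<sigma> j \<noteq> j" using \<sigma>(1) by (auto simp: permutes_def)
    then have "\<sigma> j < ?d" using permutes_in_image[OF \<sigma>(1), of j] by simp
    then show ?thesis using y(2)[of "\<sigma> j" j] j by auto
  qed
  then have "killing_det basis_enum y
      = (\<Sum>\<sigma> | \<sigma> permutes {..<?d}. if \<sigma> = id then (\<Prod>j<?d. killing (basis_enum j) (y j)) else 0)"
    unfolding killing_det_def form_det_def by (intro sum.cong) auto
  also have "\<dots> = (\<Prod>j<?d. killing (basis_enum j) (y j))"
    by (subst sum.delta) (auto simp: finite_permutations permutes_id)
  also have "\<dots> \<noteq> 0" using y(1) by auto
  finally show ?thesis using killing_det_factor[of basis_enum y] by auto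
qed

end

section \<open>Multiplication by Killing determinants\<close>

context fd_lie_algebra
begin

lemma multilin_subst_endo:
  assumes F: "multilin scale A F" and T: "endo T"
  shows "multilin scale A (\<lambda>a. F (a(i := T (a i))))"
  unfolding multilin_def
proof (intro conjI allI impI)
  fix a :: "nat \<Rightarrow> 'b" and k x y c assume k: "k \<in> A"
  show "F ((a(k := scale c x + y))(i := T ((a(k := scale c x + y)) i)))
      = scale c (F ((a(k := x))(i := T ((a(k := x)) i)))) + F ((a(k := y))(i := T ((a(k := y)) i)))"
  proof (cases "k = i")
    case True
    then show ?thesis using k by (simp add: endo_add[OF T] endo_scale[OF T] multilin_step[OF F])
  next
    case False
    then have "(a(k := z))(i := T ((a(k := z)) i)) = (a(i := T (a i)))(k := z)" for z
      by (auto simp: fun_eq_iff)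
    then show ?thesis using k by (simp only: multilin_step[OF F])
  qed
next
  fix a b :: "nat \<Rightarrow> 'b" assume "\<forall>i\<in>A. a i = b i"
  then show "F (a(i := T (a i))) = F (b(i := T (b i)))"
    by (intro multilin_cong[OF F]) auto
qed

lemma multilin_sum_slot:
  assumes F: "multilin scale A F" and i: "i \<in> A"
  shows "F (a(i := \<Sum>k\<in>K. scale (c k) (x k))) = (\<Sum>k\<in>K. scale (c k) (F (a(i := x k))))"
proof (induction K rule: infinite_finite_induct)
  case (insert k K)
  show ?case unfolding sum.insert[OF insert(1,2)] multilin_step[OF F i] insert(3) ..
next
  case (infinite K)
  show ?case unfolding sum.infinite[OF infinite] multilin_zero_slot[OF F i] ..
next
  case empty
  show ?case unfolding sum.empty multilin_zero_slot[OF F i] ..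
qed

text \<open>Razmyslov's trick. Both sides are alternating and multilinear, so they need to be compared at
  the enumerated basis only. There the substitution of \<open>T e\<^sub>i\<close> for \<open>e\<^sub>i\<close> contributes the diagonal
  entry of \<open>T\<close>, as the other components of \<open>T e\<^sub>i\<close> are repetitions.\<close>

lemma trace_insertion:
  assumes F: "multilin scale A F" "antisym_fun (card Basis) F" and A: "{..<card Basis} \<subseteq> A"
    and T: "endo T"
  shows "(\<Sum>i<card Basis. F (a(i := T (a i)))) = scale (trace T) (F a)"
proof -
  let ?d = "card Basis"
  let ?G = "\<lambda>a. (\<Sum>i<?d. F (a(i := T (a i)))) + scale (- trace T) (F a)"
  have "antisym_fun ?d (\<lambda>a. \<Sum>i<?d. F (a(i := T (a i))))"
    unfolding antisym_fun_def
  proof (intro allI impI)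
    fix \<sigma> a assume \<sigma>: "\<sigma> permutes {..<?d}"
    have "(a \<circ> \<sigma>)(i := T ((a \<circ> \<sigma>) i)) = a(\<sigma> i := T (a (\<sigma> i))) \<circ> \<sigma>" for i
      using permutes_inj[OF \<sigma>] by (auto simp: fun_eq_iff inj_eq)
    then have "(\<Sum>i<?d. F ((a \<circ> \<sigma>)(i := T ((a \<circ> \<sigma>) i))))
        = scale (of_int (sign \<sigma>)) (\<Sum>i<?d. F (a(\<sigma> i := T (a (\<sigma> i)))))"
      by (simp only: antisym_funD[OF F(2) \<sigma>] scale_sum_right)
    also have "(\<Sum>i<?d. F (a(\<sigma> i := T (a (\<sigma> i))))) = (\<Sum>i<?d. F (a(i := T (a i))))"
      using sum.permute[OF \<sigma>, of "\<lambda>i. F (a(i := T (a i)))"] by (simp add: comp_def)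
    finally show "(\<Sum>i<?d. F ((a \<circ> \<sigma>)(i := T ((a \<circ> \<sigma>) i))))
        = scale (of_int (sign \<sigma>)) (\<Sum>i<?d. F (a(i := T (a i))))" .
  qed
  then have anti: "antisym_fun ?d ?G" using F(2) by (intro antisym_fun_lincomb)
  have multi: "multilin scale A ?G"
    by (intro multilin_lincomb multilin_sum multilin_subst_endo F T)
  have "?G a = 0"
  proof (rule antisym_fun_zero[OF multi anti A])
    fix a assume a: "\<And>i. i < ?d \<Longrightarrow> a i = basis_enum i"
    have "F (a(i := T (a i))) = scale (coord i (T (basis_enum i))) (F a)" if i: "i < ?d" for i
    proof -
      have "T (a i) = (\<Sum>k<?d. scale (coord k (T (a i))) (basis_enum k))"
        using coord_expand[OF is_basis_Basis, of "T (a i)"] by (simp add: sum_Basis)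
      then have "F (a(i := T (a i))) = (\<Sum>k<?d. scale (coord k (T (a i))) (F (a(i := basis_enum k))))"
        using multilin_sum_slot[OF F(1), of i a "\<lambda>k. coord k (T (a i))" basis_enum "{..<?d}"] i A
        by auto
      also have "\<dots> = (\<Sum>k<?d. if k = i then scale (coord k (T (a i))) (F a) else 0)"
      proof (rule sum.cong)
        fix k assume k: "k \<in> {..<?d}"
        show "scale (coord k (T (a i))) (F (a(i := basis_enum k)))
            = (if k = i then scale (coord k (T (a i))) (F a) else 0)"
        proof (cases "k = i")
          case True
          then have "a(i := basis_enum k) = a" using a i by (auto simp: fun_eq_iff)
          then show ?thesis using True by simp
        next
          case False
          then have "F (a(i := basis_enum k)) = 0"
            using a i k by (intro antisym_fun_repeated[OF F(2), of i k]) auto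
          then show ?thesis using False by simp
        qed
      qed simp
      finally show ?thesis using a i by simp
    qed
    then have "(\<Sum>i<?d. F (a(i := T (a i)))) = scale (trace T) (F a)"
      by (simp add: trace_def sum_Basis scale_sum_left)
    then show "?G a = 0" by simp
  qed
  then show ?thesis by (simp add: eq_neg_iff_add_eq_0[symmetric])
qed

lemma antisym_fun_scalar:
  assumes "antisym_fun k F" "\<And>a \<sigma>. \<sigma> permutes {..<k} \<Longrightarrow> c (a \<circ> \<sigma>) = c a"
  shows "antisym_fun k (\<lambda>a. scale (c a) (F a))"
  using assms by (simp add: antisym_fun_def mult.commute)

end

context fd_H_module_lie_algebra
begin

abbreviation d :: nat where "d \<equiv> card Basis"

text \<open>The trick for \<open>T = ad x\<^sub>u \<circ> ad x\<^sub>v\<close>, whose trace is the value of the Killing form.\<close>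

lemma H_poly_killing:
  assumes F: "H_poly A F" "L.antisym_fun d F" and A: "{..<d} \<subseteq> A" and uv: "u \<noteq> v" "u \<notin> A" "v \<notin> A"
  shows "H_poly (A \<union> {u, v}) (\<lambda>a. scaleL (L.killing (a u) (a v)) (F a))"
proof -
  have "H_poly (A \<union> {u, v}) (\<lambda>a. F (a(i := bracket (a u) (bracket (a v) (a i)))))" if "i < d" for i
  proof -
    have i: "i \<in> A" using that A by auto
    have "H_poly ({u} \<union> ({v} \<union> {i})) (\<lambda>a. bracket (a u) (bracket (a v) (a i)))"
      using uv i by (intro H_poly.bracket H_poly.var) auto
    then have "H_poly (A - {i} \<union> ({u} \<union> ({v} \<union> {i}))) (\<lambda>a. F (a(i := bracket (a u) (bracket (a v) (a i)))))"
      using uv i by (intro H_poly_subst[OF F(1)]) auto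
    moreover have "A - {i} \<union> ({u} \<union> ({v} \<union> {i})) = A \<union> {u, v}" using i by auto
    ultimately show ?thesis by simp
  qed
  then have "H_poly (A \<union> {u, v}) (\<lambda>a. \<Sum>i<d. F (a(i := bracket (a u) (bracket (a v) (a i)))))"
    by (intro H_poly_sum) auto
  moreover have "(\<Sum>i<d. F (a(i := bracket (a u) (bracket (a v) (a i)))))
      = scaleL (L.killing (a u) (a v)) (F a)" for a
    unfolding L.killing_def
    by (rule L.trace_insertion[OF H_poly_multilin[OF F(1)] F(2) A, of "\<lambda>x. bracket (a u) (bracket (a v) x)"])
       (rule L.endo_comp[OF L.endo_bracket L.endo_bracket])
  ultimately show ?thesis by simp
qed

lemma H_poly_killing_prod:
  fixes u v :: "nat \<Rightarrow> nat"
  assumes F: "H_poly A F" "L.antisym_fun d F" and A: "{..<d} \<subseteq> A"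
    and u: "inj_on u {..<k}" and v: "inj_on v {..<k}"
    and disj: "u ` {..<k} \<inter> A = {}" "v ` {..<k} \<inter> A = {}" "u ` {..<k} \<inter> v ` {..<k} = {}"
  shows "H_poly (A \<union> u ` {..<k} \<union> v ` {..<k})
      (\<lambda>a. scaleL (\<Prod>j<k. L.killing (a (u j)) (a (v j))) (F a))"
    and "L.antisym_fun d (\<lambda>a. scaleL (\<Prod>j<k. L.killing (a (u j)) (a (v j))) (F a))"
proof -
  have fixed: "a (\<sigma> i) = a i" if "\<sigma> permutes {..<d}" "i \<notin> A" for \<sigma> i and a :: "nat \<Rightarrow> 'l"
    using that A permutes_not_in[of \<sigma> "{..<d}" i] by (metis subsetD)
  have anti: "L.antisym_fun d (\<lambda>a. scaleL (\<Prod>j<l. L.killing (a (u j)) (a (v j))) (F a))" if "l \<le> k" for l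
  proof (rule L.antisym_fun_scalar[OF F(2)])
    fix a :: "nat \<Rightarrow> 'l" and \<sigma> assume \<sigma>: "\<sigma> permutes {..<d}"
    have "u j \<notin> A \<and> v j \<notin> A" if j: "j < l" for j
    proof -
      have "u j \<in> u ` {..<k}" "v j \<in> v ` {..<k}" using j \<open>l \<le> k\<close> by auto
      then show ?thesis using disj by blast
    qed
    then show "(\<Prod>j<l. L.killing ((a \<circ> \<sigma>) (u j)) ((a \<circ> \<sigma>) (v j))) = (\<Prod>j<l. L.killing (a (u j)) (a (v j)))"
      by (intro prod.cong) (auto simp: fixed[OF \<sigma>])
  qed
  have "H_poly (A \<union> u ` {..<l} \<union> v ` {..<l}) (\<lambda>a. scaleL (\<Prod>j<l. L.killing (a (u j)) (a (v j))) (F a))"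
    if "l \<le> k" for l
    using that
  proof (induction l)
    case 0
    then show ?case using F(1) by simp
  next
    case (Suc l)
    have lk: "l < k" using Suc.prems by simp
    have l: "u l \<noteq> v l" "u l \<notin> A \<union> u ` {..<l} \<union> v ` {..<l}" "v l \<notin> A \<union> u ` {..<l} \<union> v ` {..<l}"
    proof -
      have in_im: "u l \<in> u ` {..<k}" "v l \<in> v ` {..<k}" "u ` {..<l} \<subseteq> u ` {..<k}" "v ` {..<l} \<subseteq> v ` {..<k}"
        using lk by auto
      have "u l \<noteq> u x \<and> v l \<noteq> v x" if "x < l" for x
        using inj_onD[OF u, of l x] inj_onD[OF v, of l x] lk that by auto
      then have "u l \<notin> u ` {..<l}" "v l \<notin> v ` {..<l}" by auto
      moreover have "u l \<notin> A" "u l \<notin> v ` {..<l}" using disj(1,3) in_im(1,4) by (meson disjoint_iff subsetD)+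
      moreover have "v l \<notin> A" "v l \<notin> u ` {..<l}" using disj(2,3) in_im(2,3) by (meson disjoint_iff subsetD)+
      moreover show "u l \<noteq> v l" using disj(3) in_im(1,2) by (metis disjoint_iff)
      ultimately show "u l \<notin> A \<union> u ` {..<l} \<union> v ` {..<l}" "v l \<notin> A \<union> u ` {..<l} \<union> v ` {..<l}"
        by simp_all
    qed
    have "H_poly (A \<union> u ` {..<l} \<union> v ` {..<l} \<union> {u l, v l}) (\<lambda>a. scaleL (L.killing (a (u l)) (a (v l)))
        (scaleL (\<Prod>j<l. L.killing (a (u j)) (a (v j))) (F a)))"
      using Suc l A by (intro H_poly_killing anti) auto
    moreover have "A \<union> u ` {..<l} \<union> v ` {..<l} \<union> {u l, v l} = A \<union> u ` {..<Suc l} \<union> v ` {..<Suc l}"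
      by (auto simp: lessThan_Suc)
    ultimately show ?case by (simp add: mult.commute)
  qed
  from this[of k] show "H_poly (A \<union> u ` {..<k} \<union> v ` {..<k})
      (\<lambda>a. scaleL (\<Prod>j<k. L.killing (a (u j)) (a (v j))) (F a))" by simp
  show "L.antisym_fun d (\<lambda>a. scaleL (\<Prod>j<k. L.killing (a (u j)) (a (v j))) (F a))"
    using anti[of k] by simp
qed

text \<open>Alternating the product of Killing forms over the first group of variables gives the
  determinant of the matrix of Killing forms, a nonzero multiple of the product of the two
  determinants of coordinates.\<close>

lemma H_poly_two_dets:
  assumes ss: "L.no_abelian_ideals"
    and F: "H_poly A F" "L.antisym_fun d F" and A: "{..<d} \<subseteq> A"
    and u: "inj_on u {..<d}" and v: "inj_on v {..<d}"
    and disj: "u ` {..<d} \<inter> A = {}" "v ` {..<d} \<inter> A = {}" "u ` {..<d} \<inter> v ` {..<d} = {}"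
  shows "H_poly (A \<union> u ` {..<d} \<union> v ` {..<d})
      (\<lambda>a. scaleL (L.basis_det (a \<circ> u) * L.basis_det (a \<circ> v)) (F a))"
proof -
  let ?\<gamma> = "L.killing_det L.basis_enum L.basis_enum"
  let ?A = "A \<union> u ` {..<d} \<union> v ` {..<d}"
  have "H_poly ?A (\<lambda>a. scaleL (\<Prod>j<d. L.killing (a (u (\<sigma> j))) (a (v j))) (F a))"
    if \<sigma>: "\<sigma> permutes {..<d}" for \<sigma>
  proof -
    have im: "(u \<circ> \<sigma>) ` {..<d} = u ` {..<d}"
      using permutes_image[OF \<sigma>] by (simp only: image_comp[symmetric])
    have "inj_on (u \<circ> \<sigma>) {..<d}"
      using u permutes_inj_on[OF \<sigma>] permutes_image[OF \<sigma>] by (intro comp_inj_on) auto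
    then have "H_poly (A \<union> (u \<circ> \<sigma>) ` {..<d} \<union> v ` {..<d})
        (\<lambda>a. scaleL (\<Prod>j<d. L.killing (a ((u \<circ> \<sigma>) j)) (a (v j))) (F a))"
      using disj im by (intro H_poly_killing_prod(1)[OF F A _ v]) auto
    then show ?thesis unfolding im by simp
  qed
  then have "H_poly ?A (\<lambda>a. \<Sum>\<sigma> | \<sigma> permutes {..<d}. scaleL (of_int (sign \<sigma>))
      (scaleL (\<Prod>j<d. L.killing (a (u (\<sigma> j))) (a (v j))) (F a)))"
    by (intro H_poly_sum H_poly.scale) auto
  moreover have "(\<Sum>\<sigma> | \<sigma> permutes {..<d}. scaleL (of_int (sign \<sigma>))
      (scaleL (\<Prod>j<d. L.killing (a (u (\<sigma> j))) (a (v j))) (F a)))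
      = scaleL (L.killing_det (a \<circ> u) (a \<circ> v)) (F a)" for a
    by (simp add: L.killing_det_def L.form_det_def L.scale_sum_left)
  ultimately have "H_poly ?A (\<lambda>a. scaleL (L.killing_det (a \<circ> u) (a \<circ> v)) (F a))"
    by (simp only:)
  then have "H_poly ?A (\<lambda>a. scaleL (1 / ?\<gamma>) (scaleL (L.killing_det (a \<circ> u) (a \<circ> v)) (F a)))"
    by (rule H_poly.scale)
  moreover have "1 / ?\<gamma> * L.killing_det (a \<circ> u) (a \<circ> v) = L.basis_det (a \<circ> u) * L.basis_det (a \<circ> v)" for a
    using L.killing_det_nonzero[OF ss] by (subst L.killing_det_factor) simp
  ultimately show ?thesis by (simp only: L.scale_scale)
qed

lemma H_poly_many_dets:
  fixes blk :: "nat \<Rightarrow> nat \<Rightarrow> nat" and l :: nat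
  assumes ss: "L.no_abelian_ideals"
    and F: "H_poly A F" "L.antisym_fun d F" and A: "{..<d} \<subseteq> A"
    and inj: "inj_on (\<lambda>(j, r). blk j r) ({..<2 * l} \<times> {..<d})"
    and disj: "(\<lambda>(j, r). blk j r) ` ({..<2 * l} \<times> {..<d}) \<inter> A = {}"
  shows "H_poly (A \<union> (\<lambda>(j, r). blk j r) ` ({..<2 * l} \<times> {..<d}))
      (\<lambda>a. scaleL (\<Prod>j<2 * l. L.basis_det (a \<circ> blk j)) (F a))"
proof -
  let ?I = "\<lambda>k. (\<lambda>(j, r). blk j r) ` ({..<2 * k} \<times> {..<d})"
  have nA: "blk j r \<notin> A" if "j < 2 * l" "r < d" for j r
    using disj that by (auto simp: disjoint_iff)
  have eq_iff: "blk j r = blk j' r' \<longleftrightarrow> j = j' \<and> r = r'"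
    if "j < 2 * l" "r < d" "j' < 2 * l" "r' < d" for j r j' r'
    using inj_onD[OF inj, of "(j, r)" "(j', r')"] that by auto
  have "H_poly (A \<union> ?I k) (\<lambda>a. scaleL (\<Prod>j<2 * k. L.basis_det (a \<circ> blk j)) (F a))" if "k \<le> l" for k :: nat
    using that
  proof (induction k)
    case 0
    then show ?case using F(1) by simp
  next
    case (Suc k)
    let ?u = "blk (2 * k)" and ?v = "blk (Suc (2 * k))"
    have k: "2 * k < 2 * l" "Suc (2 * k) < 2 * l" using Suc.prems by auto
    have "L.antisym_fun d (\<lambda>a. scaleL (\<Prod>j<2 * k. L.basis_det (a \<circ> blk j)) (F a))"
    proof (rule L.antisym_fun_scalar[OF F(2)])
      fix a :: "nat \<Rightarrow> 'l" and \<sigma> assume \<sigma>: "\<sigma> permutes {..<d}"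
      show "(\<Prod>j<2 * k. L.basis_det (a \<circ> \<sigma> \<circ> blk j)) = (\<Prod>j<2 * k. L.basis_det (a \<circ> blk j))"
      proof (intro prod.cong L.form_det_cong refl)
        fix j r assume "j \<in> {..<2 * k}" "r < d"
        then have "blk j r \<notin> {..<d}" using nA[of j r] k A by auto
        then show "(a \<circ> \<sigma> \<circ> blk j) r = (a \<circ> blk j) r" using permutes_not_in[OF \<sigma>] by simp
      qed
    qed
    then have "H_poly ((A \<union> ?I k) \<union> ?u ` {..<d} \<union> ?v ` {..<d})
        (\<lambda>a. scaleL (L.basis_det (a \<circ> ?u) * L.basis_det (a \<circ> ?v))
          (scaleL (\<Prod>j<2 * k. L.basis_det (a \<circ> blk j)) (F a)))"
    proof (intro H_poly_two_dets[OF ss])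
      show "H_poly (A \<union> ?I k) (\<lambda>a. scaleL (\<Prod>j<2 * k. L.basis_det (a \<circ> blk j)) (F a))"
        using Suc.IH[OF Suc_leD[OF Suc.prems]] .
      show "?u ` {..<d} \<inter> (A \<union> ?I k) = {}" "?v ` {..<d} \<inter> (A \<union> ?I k) = {}"
        using k nA eq_iff by fastforce+
      show "inj_on ?u {..<d}" "inj_on ?v {..<d}" "?u ` {..<d} \<inter> ?v ` {..<d} = {}"
        using k eq_iff by (auto simp: inj_on_def)
      show "{..<d} \<subseteq> A \<union> ?I k" using A by auto
    qed
    moreover have "(A \<union> ?I k) \<union> ?u ` {..<d} \<union> ?v ` {..<d} = A \<union> ?I (Suc k)"
      by (auto simp: lessThan_Suc image_iff)
    moreover have "scaleL (L.basis_det (a \<circ> ?u) * L.basis_det (a \<circ> ?v))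
        (scaleL (\<Prod>j<2 * k. L.basis_det (a \<circ> blk j)) (F a))
      = scaleL (\<Prod>j<2 * Suc k. L.basis_det (a \<circ> blk j)) (F a)" for a
      by (simp add: mult_ac)
    ultimately show ?case by (simp only:)
  qed
  then show ?thesis by simp
qed

section \<open>Density\<close>

text \<open>The operators \<open>x \<mapsto> [z, x]\<close> and \<open>x \<mapsto> h x\<close> generate an algebra for which the
  invariant subspaces of \<open>L\<close> are the \<open>H\<close>-invariant ideals.\<close>

inductive op_monomial :: "('l \<Rightarrow> 'l) \<Rightarrow> bool" where
  ident: "op_monomial (\<lambda>x. x)"
| ad: "op_monomial T \<Longrightarrow> op_monomial (\<lambda>x. bracket z (T x))"
| act: "op_monomial T \<Longrightarrow> op_monomial (\<lambda>x. act h (T x))"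

inductive op_span :: "('l \<Rightarrow> 'l) \<Rightarrow> bool" where
  zero: "op_span (\<lambda>x. 0)"
| step: "op_span T \<Longrightarrow> op_monomial S \<Longrightarrow> op_span (\<lambda>x. T x + scaleL c (S x))"

lemma op_span_monomial: "op_monomial S \<Longrightarrow> op_span S"
  using op_span.step[OF op_span.zero, of S 1] by simp

lemma op_span_lincomb: "op_span T \<Longrightarrow> op_span S \<Longrightarrow> op_span (\<lambda>x. S x + scaleL c (T x))"
proof (induction rule: op_span.induct)
  case (step T R r)
  from op_span.step[OF step.IH[OF step.prems] step.hyps(2), of "c * r"] show ?case
    by (simp add: L.scale_right_distrib add.assoc)
qed simp

lemma op_span_sum: "(\<And>i. i \<in> I \<Longrightarrow> op_span (T i)) \<Longrightarrow> op_span (\<lambda>x. \<Sum>i\<in>I. T i x)"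
proof (induction I rule: infinite_finite_induct)
  case (insert i I)
  then show ?case using op_span_lincomb[of "\<lambda>x. \<Sum>i\<in>I. T i x" "T i" 1] by simp
qed (simp_all add: op_span.zero)

lemma op_span_ad: "op_span T \<Longrightarrow> op_span (\<lambda>x. bracket z (T x))"
proof (induction rule: op_span.induct)
  case (step T S c)
  from op_span.step[OF step.IH op_monomial.ad[OF step.hyps(2), of z], of c] show ?case
    by (simp add: L.bracket_add_right L.bracket_scale_right)
qed (simp add: op_span.zero)

lemma op_span_act: "op_span T \<Longrightarrow> op_span (\<lambda>x. act h (T x))"
proof (induction rule: op_span.induct)
  case (step T S c)
  from op_span.step[OF step.IH op_monomial.act[OF step.hyps(2), of h], of c] show ?case
    by (simp add: act_add_right act_scale_right)
qed (simp add: op_span.zero)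

lemma op_monomial_endo: "op_monomial T \<Longrightarrow> L.endo T"
proof (induction rule: op_monomial.induct)
  case ident
  show ?case by (rule L.linearI) auto
next
  case (ad T z)
  show ?case by (rule L.endo_comp[OF L.endo_bracket ad.IH])
next
  case (act T h)
  then show ?case
    by (intro L.linearI) (auto simp: L.endo_add L.endo_scale act_add_right act_scale_right)
qed

lemma op_span_endo: "op_span T \<Longrightarrow> L.endo T"
proof (induction rule: op_span.induct)
  case zero
  show ?case by (rule L.linearI) auto
next
  case (step T S c)
  note S = op_monomial_endo[OF step.hyps(2)]
  show ?case
    by (rule L.linearI) (auto simp: L.endo_add[OF S] L.endo_scale[OF S] L.endo_add[OF step.IH]
        L.endo_scale[OF step.IH] L.scale_right_distrib mult.commute add_ac)
qed

definition orbit :: "'l set \<Rightarrow> 'l \<Rightarrow> 'l set" where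
  "orbit S w = {T w |T. op_span T \<and> (\<forall>s\<in>S. T s = 0)}"

lemma orbitI: "op_span T \<Longrightarrow> (\<And>s. s \<in> S \<Longrightarrow> T s = 0) \<Longrightarrow> T w \<in> orbit S w"
  unfolding orbit_def by blast

lemma orbit_invariant: "L.lie_ideal (orbit S w)" "H_invariant (orbit S w)"
proof -
  show "H_invariant (orbit S w)"
    unfolding H_invariant_def orbit_def using op_span_act by fastforce
  have "L.subspace (orbit S w)"
  proof (rule L.subspaceI)
    show "0 \<in> orbit S w" using orbitI[OF op_span.zero] by simp
  next
    fix x y assume "x \<in> orbit S w" "y \<in> orbit S w"
    then obtain T R where TR: "op_span T" "\<forall>s\<in>S. T s = 0" "x = T w" "op_span R" "\<forall>s\<in>S. R s = 0" "y = R w"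
      unfolding orbit_def by blast
    then show "x + y \<in> orbit S w"
      using orbitI[OF op_span_lincomb[OF TR(4,1), of 1], of S w] by simp
  next
    fix c x assume "x \<in> orbit S w"
    then obtain T where T: "op_span T" "\<forall>s\<in>S. T s = 0" "x = T w" unfolding orbit_def by blast
    then show "scaleL c x \<in> orbit S w"
      using orbitI[OF op_span_lincomb[OF T(1) op_span.zero, of c], of S w] by simp
  qed
  moreover have "bracket z x \<in> orbit S w" if "x \<in> orbit S w" for z x
    using that op_span_ad unfolding orbit_def by fastforce
  ultimately show "L.lie_ideal (orbit S w)" by (simp add: L.lie_ideal_def)
qed

context
  assumes simple: H_simple
begin

lemma orbit_UNIV:
  assumes "op_span T" "\<And>s. s \<in> S \<Longrightarrow> T s = 0" "T w \<noteq> 0"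
  shows "orbit S w = UNIV"
proof -
  have "T w \<in> orbit S w" using assms(1,2) by (rule orbitI)
  then have "orbit S w \<noteq> {0}" using assms(3) by auto
  then show ?thesis using simple orbit_invariant[of S w] unfolding H_simple_def by blast
qed

text \<open>Jacobson density. If every operator that kills \<open>S\<close> and \<open>w\<close> also kills \<open>v\<close>, then
  \<open>T w \<mapsto> T v\<close>, for \<open>T\<close> killing \<open>S\<close>, is a well defined endomorphism of \<open>L\<close> that commutes with
  all operators, hence a scalar \<open>c\<close>. Then every operator that kills \<open>S\<close> kills \<open>v - c w\<close>.\<close>

lemma density:
  assumes "finite S" "v \<notin> L.span S"
  shows "\<exists>T. op_span T \<and> (\<forall>s\<in>S. T s = 0) \<and> T v \<noteq> 0"
  using assms
proof (induction S arbitrary: v rule: finite_induct)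
  case empty
  then have "v \<noteq> 0" using L.span_zero by blast
  then show ?case using op_span_monomial[OF op_monomial.ident] by auto
next
  case (insert w S)
  show ?case
  proof (cases "w \<in> L.span S")
    case True
    then have "v \<notin> L.span S" using insert.prems L.span_redundant by metis
    then obtain T where T: "op_span T" "\<forall>s\<in>S. T s = 0" "T v \<noteq> 0" using insert.IH by blast
    have "T w = 0"
      using True
    proof (induction rule: L.span_induct_alt)
      case (step c x y)
      then show ?case using T(2) by (simp add: L.endo_add[OF op_span_endo[OF T(1)]] L.endo_scale[OF op_span_endo[OF T(1)]])
    qed (simp add: L.endo_0[OF op_span_endo[OF T(1)]])
    then show ?thesis using T by auto
  next
    case False
    show ?thesis
    proof (rule ccontr)
      assume contra: "\<not> ?thesis"
      have kill: "T v = 0" if "op_span T" "\<forall>s\<in>S. T s = 0" "T w = 0" for T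
        using contra that by auto
      obtain T0 where "op_span T0" "\<forall>s\<in>S. T0 s = 0" "T0 w \<noteq> 0" using insert.IH[OF False] by blast
      then have orbit: "orbit S w = UNIV" using orbit_UNIV by blast
      have same: "T v = R v" if T: "op_span T" "\<forall>s\<in>S. T s = 0" and R: "op_span R" "\<forall>s\<in>S. R s = 0"
        and eq: "T w = R w" for T R
        using kill[OF op_span_lincomb[OF R(1) T(1), of "- 1"]] T R eq by simp
      define \<theta> where "\<theta> x = (SOME y. \<exists>T. op_span T \<and> (\<forall>s\<in>S. T s = 0) \<and> T w = x \<and> T v = y)" for x
      have \<theta>: "\<theta> (T w) = T v" if T: "op_span T" "\<forall>s\<in>S. T s = 0" for T
      proof -
        have "\<exists>y. \<exists>R. op_span R \<and> (\<forall>s\<in>S. R s = 0) \<and> R w = T w \<and> R v = y" using T by blast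
        from someI_ex[OF this] obtain R where "op_span R" "\<forall>s\<in>S. R s = 0" "R w = T w" "R v = \<theta> (T w)"
          unfolding \<theta>_def by blast
        then show ?thesis using same[OF _ _ T] by metis
      qed
      have rep: "\<exists>T. op_span T \<and> (\<forall>s\<in>S. T s = 0) \<and> x = T w" for x
      proof -
        have "x \<in> orbit S w" using orbit by simp
        then show ?thesis unfolding orbit_def by blast
      qed
      have \<theta>_lin: "\<theta> (x + scaleL c y) = \<theta> x + scaleL c (\<theta> y)" for x y c
      proof -
        obtain T R where T: "op_span T" "\<forall>s\<in>S. T s = 0" "x = T w" and R: "op_span R" "\<forall>s\<in>S. R s = 0" "y = R w"
          using rep by metis
        show ?thesis
          using \<theta>[OF op_span_lincomb[OF R(1) T(1), of c]] \<theta>[OF T(1,2)] \<theta>[OF R(1,2)] T R by simp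
      qed
      have \<theta>0: "\<theta> 0 = 0" using \<theta>[OF op_span.zero] by simp
      have endo: "L.endo \<theta>"
      proof (rule L.linearI)
        show "\<theta> (x + y) = \<theta> x + \<theta> y" for x y using \<theta>_lin[of x 1 y] by simp
        show "\<theta> (scaleL c x) = scaleL c (\<theta> x)" for c x using \<theta>_lin[of 0 c x] \<theta>0 by simp
      qed
      have \<theta>_ad: "\<theta> (bracket z x) = bracket z (\<theta> x)" for z x
      proof -
        obtain T where T: "op_span T" "\<forall>s\<in>S. T s = 0" "x = T w" using rep by metis
        then show ?thesis using \<theta>[OF op_span_ad[OF T(1), of z]] \<theta>[OF T(1,2)] by simp
      qed
      have \<theta>_act: "\<theta> (act h x) = act h (\<theta> x)" for h x
      proof -
        obtain T where T: "op_span T" "\<forall>s\<in>S. T s = 0" "x = T w" using rep by metis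
        then show ?thesis using \<theta>[OF op_span_act[OF T(1), of h]] \<theta>[OF T(1,2)] by simp
      qed
      have "w \<noteq> 0" using False L.span_zero by blast
      then obtain c x where x: "x \<noteq> 0" "\<theta> x = scaleL c x" using L.exists_eigenvector[OF endo] by blast
      let ?E = "{x. \<theta> x = scaleL c x}"
      have "L.lie_ideal ?E"
        unfolding L.lie_ideal_def
        by (auto intro!: L.subspaceI simp: \<theta>0 L.endo_add[OF endo] L.endo_scale[OF endo]
            L.scale_right_distrib mult.commute \<theta>_ad L.bracket_scale_right)
      moreover have "H_invariant ?E"
        by (auto simp: H_invariant_def \<theta>_act act_scale_right)
      ultimately have E: "?E = UNIV" using simple x unfolding H_simple_def by blast
      have "T (v - scaleL c w) = 0" if T: "op_span T" "\<forall>s\<in>S. T s = 0" for T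
      proof -
        have "T w \<in> ?E" unfolding E ..
        then have "T v = scaleL c (T w)" using \<theta>[OF T] by simp
        then show ?thesis
          by (simp add: L.endo_diff[OF op_span_endo[OF T(1)]] L.endo_scale[OF op_span_endo[OF T(1)]])
      qed
      then have "v - scaleL c w \<in> L.span S" using insert.IH[of "v - scaleL c w"] by blast
      then show False using insert.prems L.span_breakdown_eq by blast
    qed
  qed
qed

text \<open>By density some operator kills all basis vectors but \<open>b\<close>, and then \<open>b\<close> can be moved to any
  vector by simplicity; the required operator is a sum of such operators.\<close>

lemma op_span_rank_one:
  assumes \<phi>: "L.linear_form \<phi>"
  shows "\<exists>T. op_span T \<and> (\<forall>x. T x = scaleL (\<phi> x) u)"
proof -
  have "\<exists>T. op_span T \<and> (\<forall>s\<in>Basis - {b}. T s = 0) \<and> T b = scaleL (\<phi> b) u" if b: "b \<in> Basis" for b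
  proof -
    have "b \<notin> L.span (Basis - {b})" using L.independent_Basis b L.dependent_def by blast
    then obtain T where "op_span T" "\<forall>s\<in>Basis - {b}. T s = 0" "T b \<noteq> 0"
      using density[of "Basis - {b}" b] L.finite_Basis by auto
    then have "scaleL (\<phi> b) u \<in> orbit (Basis - {b}) b" using orbit_UNIV[of T "Basis - {b}" b] by blast
    then obtain R where "op_span R" "\<forall>s\<in>Basis - {b}. R s = 0" "scaleL (\<phi> b) u = R b"
      unfolding orbit_def by blast
    then show ?thesis by metis
  qed
  then obtain T where T: "\<And>b. b \<in> Basis \<Longrightarrow> op_span (T b)"
      "\<And>b s. b \<in> Basis \<Longrightarrow> s \<in> Basis - {b} \<Longrightarrow> T b s = 0" "\<And>b. b \<in> Basis \<Longrightarrow> T b b = scaleL (\<phi> b) u"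
    by metis
  let ?T = "\<lambda>x. \<Sum>b\<in>Basis. T b x"
  have endo: "L.endo ?T" and op: "op_span ?T"
    using op_span_sum[of Basis T] T(1) op_span_endo by auto
  have on_basis: "?T b = scaleL (\<phi> b) u" if b: "b \<in> Basis" for b
  proof -
    have "?T b = (\<Sum>c\<in>Basis. if c = b then scaleL (\<phi> b) u else 0)"
      using T(2,3) b by (intro sum.cong) auto
    then show ?thesis using b L.finite_Basis by simp
  qed
  have "?T x = scaleL (\<phi> x) u" for x
  proof -
    have "x \<in> L.span Basis" using L.span_Basis by simp
    then show ?thesis
    proof (induction rule: L.span_induct_alt)
      case base
      have "\<phi> 0 = 0" using \<phi> unfolding L.linear_form_def by (metis L.scale_zero_right add_cancel_left_left mult_cancel_right1 add_0)
      then show ?case using L.endo_0[OF endo] by simp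
    next
      case (step c b y)
      have "?T (scaleL c b + y) = scaleL c (?T b) + ?T y" by (simp only: L.endo_add[OF endo] L.endo_scale[OF endo])
      also have "\<dots> = scaleL (c * \<phi> b + \<phi> y) u" using on_basis[OF step(1)] step(2) by (simp add: L.scale_left_distrib)
      also have "c * \<phi> b + \<phi> y = \<phi> (scaleL c b + y)" using \<phi> by (simp add: L.linear_form_def)
      finally show ?case .
    qed
  qed
  then show ?thesis using op by blast
qed

end

text \<open>An operator monomial becomes a polynomial operation when its coefficients are replaced by
  fresh variables \<open>x\<^sub>k, \<dots>, x\<^bsub>k'-1\<^esub>\<close>; \<open>z\<close> gives their values.\<close>

lemma op_monomial_H_poly:
  assumes "op_monomial T"
  shows "\<exists>k'\<ge>k. \<exists>\<Theta> z. (\<forall>A F. H_poly A F \<longrightarrow> A \<inter> {k..<k'} = {} \<longrightarrow> H_poly (A \<union> {k..<k'}) (\<lambda>a. \<Theta> a (F a))) \<and>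
    (\<forall>a. (\<forall>i\<in>{k..<k'}. a i = z i) \<longrightarrow> \<Theta> a = T) \<and>
    (\<forall>a b. (\<forall>i\<in>{k..<k'}. a i = b i) \<longrightarrow> \<Theta> a = \<Theta> b)"
  using assms
proof (induction rule: op_monomial.induct)
  case ident
  show ?case by (intro exI[of _ k] conjI exI[of _ "\<lambda>a x. x"]) auto
next
  case (ad T y)
  then obtain k' \<Theta> z where k': "k' \<ge> k"
    and poly: "\<And>A F. H_poly A F \<Longrightarrow> A \<inter> {k..<k'} = {} \<Longrightarrow> H_poly (A \<union> {k..<k'}) (\<lambda>a. \<Theta> a (F a))"
    and val: "\<And>a. (\<forall>i\<in>{k..<k'}. a i = z i) \<Longrightarrow> \<Theta> a = T"
    and cong: "\<And>a b. (\<forall>i\<in>{k..<k'}. a i = b i) \<Longrightarrow> \<Theta> a = \<Theta> b"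
    by auto
  have ivl: "{k..<Suc k'} = insert k' {k..<k'}" using k' by auto
  let ?\<Theta> = "\<lambda>a x. bracket (a k') (\<Theta> a x)" and ?z = "z(k' := y)"
  show ?case
  proof (rule exI[of _ "Suc k'"], intro conjI exI[of _ ?\<Theta>] exI[of _ ?z] allI impI)
    fix A F assume A: "H_poly A F" "A \<inter> {k..<Suc k'} = {}"
    have "H_poly ({k'} \<union> (A \<union> {k..<k'})) (\<lambda>a. bracket (a k') (\<Theta> a (F a)))"
      using A ivl by (intro H_poly.bracket H_poly.var poly) auto
    then show "H_poly (A \<union> {k..<Suc k'}) (\<lambda>a. bracket (a k') (\<Theta> a (F a)))" by (simp add: ivl)
  next
    fix a assume "\<forall>i\<in>{k..<Suc k'}. a i = ?z i"
    then have "a k' = y" "\<Theta> a = T" using val[of a] k' by auto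
    then show "?\<Theta> a = (\<lambda>x. bracket y (T x))" by simp
  next
    fix a b :: "nat \<Rightarrow> 'l" assume "\<forall>i\<in>{k..<Suc k'}. a i = b i"
    then have "a k' = b k'" "\<Theta> a = \<Theta> b" using cong[of a b] k' by auto
    then show "?\<Theta> a = ?\<Theta> b" by simp
  qed (use k' in simp)
next
  case (act T h)
  then obtain k' \<Theta> z where k': "k' \<ge> k"
    and poly: "\<And>A F. H_poly A F \<Longrightarrow> A \<inter> {k..<k'} = {} \<Longrightarrow> H_poly (A \<union> {k..<k'}) (\<lambda>a. \<Theta> a (F a))"
    and val: "\<And>a. (\<forall>i\<in>{k..<k'}. a i = z i) \<Longrightarrow> \<Theta> a = T"
    and cong: "\<And>a b. (\<forall>i\<in>{k..<k'}. a i = b i) \<Longrightarrow> \<Theta> a = \<Theta> b"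
    by auto
  let ?\<Theta> = "\<lambda>a x. act h (\<Theta> a x)"
  show ?case
  proof (rule exI[of _ k'], intro conjI exI[of _ ?\<Theta>] exI[of _ z] allI impI)
    show "H_poly (A \<union> {k..<k'}) (\<lambda>a. act h (\<Theta> a (F a)))" if "H_poly A F" "A \<inter> {k..<k'} = {}" for A F
      using that by (intro H_poly.act poly)
    show "?\<Theta> a = (\<lambda>x. act h (T x))" if "\<forall>i\<in>{k..<k'}. a i = z i" for a
      using val[OF that] by simp
    show "?\<Theta> a = ?\<Theta> b" if "\<forall>i\<in>{k..<k'}. a i = b i" for a b
      using cong[OF that] by simp
  qed (use k' in simp)
qed

lemma H_poly_alternation:
  assumes F: "H_poly A F" and "{..<k} \<subseteq> A"
  shows "H_poly A (L.alternation k F)"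
  unfolding L.alternation_def
proof (intro H_poly_sum H_poly.scale)
  fix \<sigma> assume "\<sigma> \<in> {\<sigma>. \<sigma> permutes {..<k}}"
  then have \<sigma>: "\<sigma> permutes {..<k}" by simp
  have "\<sigma> permutes A" using \<sigma> assms(2) by (rule permutes_subset)
  then have "\<sigma> ` A = A" by (rule permutes_image)
  then show "H_poly A (\<lambda>a. F (a \<circ> \<sigma>))" using H_poly_rename[OF F permutes_inj[OF \<sigma>]] by simp
qed

text \<open>One more alternating variable. With \<open>T = \<phi>(\<cdot>) u\<close> of rank one, the alternation of
  \<open>[x\<^sub>m, T F(x\<^sub>0, \<dots>, x\<^bsub>m-1\<^esub>)]\<close> takes at the basis the value \<open>[y, u]\<close>, where \<open>y\<close> is a linear
  combination of basis vectors in which the \<open>m\<close>-th one has the coefficient \<open>m! \<phi>(F) \<noteq> 0\<close>. As the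
  alternation is linear in \<open>T\<close>, it is nonzero for some operator monomial \<open>T\<close> as well.\<close>

lemma alternating_poly_step:
  assumes simple: H_simple and ss: "L.no_abelian_ideals"
    and F: "H_poly ({..<m} \<union> {d..<k}) F" "L.antisym_fun m F" and mk: "m < d" "d \<le> k"
    and a: "\<And>i. i < d \<Longrightarrow> a i = L.basis_enum i" "F a \<noteq> 0"
  shows "\<exists>k' G b. k \<le> k' \<and> H_poly ({..<Suc m} \<union> {d..<k'}) G \<and> L.antisym_fun (Suc m) G \<and>
    (\<forall>i<d. b i = L.basis_enum i) \<and> G b \<noteq> 0"
proof -
  let ?P = "{\<sigma>. \<sigma> permutes {..<Suc m}}"
  have \<sigma>_less: "\<sigma> i < Suc m \<longleftrightarrow> i < Suc m" if "\<sigma> permutes {..<Suc m}" for \<sigma> i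
    using permutes_in_image[OF that, of i] by simp
  obtain j where "L.representation Basis (F a) j \<noteq> 0" "j \<in> Basis"
    using a(2) L.coord_eqI[OF L.is_basis_Basis, of "F a" 0] L.coord_0[OF L.is_basis_Basis] by metis
  define \<phi> where "\<phi> v = L.representation Basis v j" for v
  have \<phi>: "L.linear_form \<phi>" "\<phi> (F a) \<noteq> 0"
    using \<open>L.representation Basis (F a) j \<noteq> 0\<close>
    by (simp_all add: \<phi>_def L.linear_form_def L.coord_add[OF L.is_basis_Basis] L.coord_scale[OF L.is_basis_Basis])
  define \<Omega> where "\<Omega> T = (\<Sum>\<sigma>\<in>?P. scaleL (of_int (sign \<sigma>)) (bracket (a (\<sigma> m)) (T (F (a \<circ> \<sigma>)))))" for T
  define y where "y = (\<Sum>\<sigma>\<in>?P. scaleL (of_int (sign \<sigma>) * \<phi> (F (a \<circ> \<sigma>))) (a (\<sigma> m)))"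
  have "L.coord m y = (\<Sum>\<sigma>\<in>?P. if \<sigma> m = m then of_int (sign \<sigma>) * \<phi> (F (a \<circ> \<sigma>)) else 0)"
    unfolding y_def L.coord_sum[OF L.is_basis_Basis] L.coord_scale[OF L.is_basis_Basis]
  proof (rule sum.cong)
    fix \<sigma> assume "\<sigma> \<in> ?P"
    then have "\<sigma> m < Suc m" using \<sigma>_less by auto
    then have "\<sigma> m < d" using mk by simp
    then show "of_int (sign \<sigma>) * \<phi> (F (a \<circ> \<sigma>)) * L.coord m (a (\<sigma> m))
        = (if \<sigma> m = m then of_int (sign \<sigma>) * \<phi> (F (a \<circ> \<sigma>)) else 0)"
      using mk a(1)[of "\<sigma> m"] L.coord_basis_enum[of m "\<sigma> m"] by auto
  qed simp
  also have "\<dots> = (\<Sum>\<sigma>\<in>{\<sigma>\<in>?P. \<sigma> m = m}. of_int (sign \<sigma>) * \<phi> (F (a \<circ> \<sigma>)))"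
    by (subst sum.inter_filter) (auto simp: finite_permutations)
  also have "{\<sigma>\<in>?P. \<sigma> m = m} = {\<sigma>. \<sigma> permutes {..<m}}"
  proof (intro equalityI subsetI)
    fix \<sigma> assume "\<sigma> \<in> {\<sigma>\<in>?P. \<sigma> m = m}"
    then show "\<sigma> \<in> {\<sigma>. \<sigma> permutes {..<m}}"
      using permutes_superset[of \<sigma> "{..<Suc m}" "{..<m}"] by (auto simp: less_Suc_eq)
  next
    fix \<sigma> assume "\<sigma> \<in> {\<sigma>. \<sigma> permutes {..<m}}"
    then show "\<sigma> \<in> {\<sigma>\<in>?P. \<sigma> m = m}"
      using permutes_subset[of \<sigma> "{..<m}" "{..<Suc m}"] permutes_not_in[of \<sigma> "{..<m}" m] by auto
  qed
  also have "(\<Sum>\<sigma> | \<sigma> permutes {..<m}. of_int (sign \<sigma>) * \<phi> (F (a \<circ> \<sigma>))) = (\<Sum>\<sigma> | \<sigma> permutes {..<m}. \<phi> (F a))"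
  proof (rule sum.cong)
    fix \<sigma> assume "\<sigma> \<in> {\<sigma>. \<sigma> permutes {..<m}}"
    then have "F (a \<circ> \<sigma>) = scaleL (of_int (sign \<sigma>)) (F a)" using L.antisym_funD[OF F(2)] by simp
    then have "\<phi> (F (a \<circ> \<sigma>)) = of_int (sign \<sigma>) * \<phi> (F a)"
      by (simp add: \<phi>_def L.coord_scale[OF L.is_basis_Basis])
    moreover have "of_int (sign \<sigma>) * (of_int (sign \<sigma>) :: 'f) = 1"
      by (metis of_int_1 of_int_mult sign_idempotent)
    ultimately show "of_int (sign \<sigma>) * \<phi> (F (a \<circ> \<sigma>)) = \<phi> (F a)" by (simp add: mult.assoc[symmetric])
  qed simp
  also have "\<dots> = fact m * \<phi> (F a)"
    using card_permutations[of "{..<m}" m] by simp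
  finally have "L.coord m y \<noteq> 0" using \<phi>(2) by simp
  then have "y \<noteq> 0" using L.coord_0[OF L.is_basis_Basis] by auto
  then obtain u where u: "bracket y u \<noteq> 0" using L.center_zero[OF ss] by blast
  obtain T0 where T0: "op_span T0" "\<And>x. T0 x = scaleL (\<phi> x) u" using op_span_rank_one[OF simple \<phi>(1)] by blast
  have "\<Omega> T0 = bracket y u"
    by (simp add: \<Omega>_def y_def T0(2) L.bracket_sum_left L.bracket_scale_left L.bracket_scale_right)
  then have \<Omega>0: "\<Omega> T0 \<noteq> 0" using u by simp
  have "\<exists>T. op_monomial T \<and> \<Omega> T \<noteq> 0"
  proof (rule ccontr)
    assume none: "\<not> ?thesis"
    have "\<Omega> T0 = 0"
      using T0(1)
    proof (induction rule: op_span.induct)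
      case zero
      show ?case by (simp add: \<Omega>_def)
    next
      case (step T S c)
      have "\<Omega> (\<lambda>x. T x + scaleL c (S x)) = \<Omega> T + scaleL c (\<Omega> S)"
        by (simp add: \<Omega>_def L.bracket_add_right L.bracket_scale_right L.scale_right_distrib sum.distrib
            L.scale_sum_right mult.commute)
      then show ?case using step none by simp
    qed
    then show False using \<Omega>0 by simp
  qed
  then obtain T where T: "op_monomial T" "\<Omega> T \<noteq> 0" by blast
  obtain k' \<Theta> z where k': "k' \<ge> k"
    and poly: "\<And>A F. H_poly A F \<Longrightarrow> A \<inter> {k..<k'} = {} \<Longrightarrow> H_poly (A \<union> {k..<k'}) (\<lambda>a. \<Theta> a (F a))"
    and val: "\<And>a. (\<forall>i\<in>{k..<k'}. a i = z i) \<Longrightarrow> \<Theta> a = T"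
    using op_monomial_H_poly[OF T(1), of k] by auto
  let ?G = "\<lambda>a. bracket (a m) (\<Theta> a (F a))"
  let ?A = "{..<Suc m} \<union> {d..<k'}"
  have "H_poly ({m} \<union> ({..<m} \<union> {d..<k} \<union> {k..<k'})) ?G"
    using mk by (intro H_poly.bracket H_poly.var poly F) auto
  moreover have "{m} \<union> ({..<m} \<union> {d..<k} \<union> {k..<k'}) = ?A" using mk k' by auto
  ultimately have "H_poly ?A ?G" by simp
  then have "H_poly ?A (L.alternation (Suc m) ?G)" by (rule H_poly_alternation) auto
  define b where "b i = (if i \<in> {k..<k'} then z i else a i)" for i
  have "L.alternation (Suc m) ?G b = \<Omega> T"
    unfolding L.alternation_def \<Omega>_def
  proof (rule sum.cong)
    fix \<sigma> assume "\<sigma> \<in> ?P"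
    then have \<sigma>: "\<sigma> permutes {..<Suc m}" by simp
    have fix_k: "\<sigma> i = i" if "i \<ge> k" for i using permutes_not_in[OF \<sigma>, of i] that mk by auto
    have less_k: "\<sigma> i < k" if "i < k" for i
      using \<sigma>_less[OF \<sigma>, of i] permutes_not_in[OF \<sigma>, of i] that mk by (cases "i < Suc m") auto
    have "\<Theta> (b \<circ> \<sigma>) = T" by (rule val) (auto simp: b_def fix_k)
    moreover have "F (b \<circ> \<sigma>) = F (a \<circ> \<sigma>)"
      by (rule L.multilin_cong[OF H_poly_multilin[OF F(1)]])
         (use less_k mk in \<open>auto simp: b_def not_less[symmetric]\<close>)
    moreover have "(b \<circ> \<sigma>) m = a (\<sigma> m)" using less_k[of m] mk by (auto simp: b_def)
    ultimately show "scaleL (of_int (sign \<sigma>)) (bracket ((b \<circ> \<sigma>) m) (\<Theta> (b \<circ> \<sigma>) (F (b \<circ> \<sigma>))))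
        = scaleL (of_int (sign \<sigma>)) (bracket (a (\<sigma> m)) (T (F (a \<circ> \<sigma>))))" by simp
  qed simp
  then have "L.alternation (Suc m) ?G b \<noteq> 0" using T(2) by simp
  moreover have "\<forall>i<d. b i = L.basis_enum i" using mk a(1) by (auto simp: b_def)
  ultimately show ?thesis
    using k' \<open>H_poly ?A (L.alternation (Suc m) ?G)\<close> L.antisym_fun_alternation by blast
qed

text \<open>Alternating variables are added one at a time. The variables after the first \<open>d\<close> are an initial
  argument and the coefficients of the operators; as the center is zero, bracketing with further
  variables makes their number arbitrarily large.\<close>

lemma exists_alternating_poly:
  assumes simple: H_simple and ss: "L.no_abelian_ideals" and nonzero: "\<exists>v::'l. v \<noteq> 0"
  shows "\<exists>k0\<ge>d. \<forall>k\<ge>k0. \<exists>F a. H_poly {..<k} F \<and> L.antisym_fun d F \<and> F a \<noteq> 0"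
proof -
  obtain v :: 'l where v: "v \<noteq> 0" using nonzero by blast
  have "\<exists>k F a. d \<le> k \<and> H_poly ({..<m} \<union> {d..<k}) F \<and> L.antisym_fun m F \<and>
      (\<forall>i<d. a i = L.basis_enum i) \<and> F a \<noteq> 0" if "m \<le> d" for m
    using that
  proof (induction m)
    case 0
    have "H_poly ({..<0} \<union> {d..<Suc d}) (\<lambda>a. a d)" using H_poly.var[of d] by (simp add: atLeastLessThanSuc)
    moreover have "L.antisym_fun 0 (\<lambda>a. a d)" by (simp add: L.antisym_fun_def)
    ultimately show ?case
      using v by (intro exI[of _ "Suc d"] exI[of _ "\<lambda>a. a d"] exI[of _ "\<lambda>i. if i < d then L.basis_enum i else v"]) auto
  next
    case (Suc m)
    then obtain k F a where "d \<le> k" "H_poly ({..<m} \<union> {d..<k}) F" "L.antisym_fun m F"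
        "\<And>i. i < d \<Longrightarrow> a i = L.basis_enum i" "F a \<noteq> 0" by auto
    from alternating_poly_step[OF simple ss this(2,3) _ this(1,4,5)] Suc.prems
    show ?case using order.trans[OF \<open>d \<le> k\<close>] by (metis Suc_le_lessD)
  qed
  from this[of d] obtain k0 F0 a0 where k0: "d \<le> k0" "H_poly ({..<d} \<union> {d..<k0}) F0" "L.antisym_fun d F0" "F0 a0 \<noteq> 0"
    by auto
  have "{..<d} \<union> {d..<k0} = {..<k0}" using k0(1) by auto
  then have F0: "H_poly {..<k0} F0" using k0(2) by simp
  have "\<exists>F a. H_poly {..<k} F \<and> L.antisym_fun d F \<and> F a \<noteq> 0" if "k \<ge> k0" for k
    using that
  proof (induction rule: dec_induct)
    case base
    then show ?case using F0 k0 by blast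
  next
    case (step k)
    then obtain F a where F: "H_poly {..<k} F" "L.antisym_fun d F" "F a \<noteq> 0" by blast
    obtain u where u: "bracket (F a) u \<noteq> 0" using L.center_zero[OF ss] F(3) by blast
    have "H_poly ({..<k} \<union> {k}) (\<lambda>a. bracket (F a) (a k))"
      by (intro H_poly.bracket F H_poly.var) auto
    moreover have "L.antisym_fun d (\<lambda>a. bracket (F a) (a k))"
      unfolding L.antisym_fun_def
    proof (intro allI impI)
      fix \<sigma> and a :: "nat \<Rightarrow> 'l" assume \<sigma>: "\<sigma> permutes {..<d}"
      have "\<sigma> k = k" using permutes_not_in[OF \<sigma>, of k] step k0 by simp
      then show "bracket (F (a \<circ> \<sigma>)) ((a \<circ> \<sigma>) k) = scaleL (of_int (sign \<sigma>)) (bracket (F a) (a k))"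
        using L.antisym_funD[OF F(2) \<sigma>] by (simp add: L.bracket_scale_left)
    qed
    moreover have "F (a(k := u)) = F a"
      by (rule L.multilin_cong[OF H_poly_multilin[OF F(1)]]) auto
    then have "bracket (F (a(k := u))) ((a(k := u)) k) \<noteq> 0" using u by simp
    moreover have "{..<k} \<union> {k} = {..<Suc k}" by auto
    ultimately have "H_poly {..<Suc k} (\<lambda>a. bracket (F a) (a k)) \<and> L.antisym_fun d (\<lambda>a. bracket (F a) (a k))
        \<and> bracket (F (a(k := u))) ((a(k := u)) k) \<noteq> 0" by (simp only: simp_thms)
    then show ?case
      by (intro exI[of _ "\<lambda>a. bracket (F a) (a k)"] exI[of _ "a(k := u)"])
  qed
  then show ?thesis using k0(1) by blast
qed

end

section \<open>Balanced words\<close>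

definition balanced_words :: "nat \<Rightarrow> nat \<Rightarrow> nat list set" where
  "balanced_words d q = permutations_of_multiset (\<Sum>r<d. replicate_mset q r)"

lemma count_balanced: "count (\<Sum>r<d. replicate_mset q r) x = (if x < d then q else 0)"
  for d x :: nat
  by (simp add: count_sum)

lemma size_balanced: "size (\<Sum>r<d. replicate_mset q r) = d * q"
  for d :: nat
  by (induction d) auto

lemma balanced_words_mset: "l \<in> balanced_words d q \<Longrightarrow> mset l = (\<Sum>r<d. replicate_mset q r)"
  by (simp add: balanced_words_def permutations_of_multisetD)

lemma balanced_words_length: "l \<in> balanced_words d q \<Longrightarrow> length l = d * q"
  using balanced_words_mset[of l d q] size_mset[of l] by (simp add: size_balanced)

lemma balanced_words_letter:
  assumes l: "l \<in> balanced_words d q" and "x < d * q"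
  shows "l ! x < d"
proof -
  have "l ! x \<in># mset l" using assms balanced_words_length[OF l] by simp
  then show ?thesis
    unfolding balanced_words_mset[OF l] by (simp add: count_balanced flip: count_greater_zero_iff split: if_splits)
qed

lemma balanced_words_card_letter:
  assumes l: "l \<in> balanced_words d q" and "r < d"
  shows "card {x. x < d * q \<and> l ! x = r} = q"
proof -
  have "card {x. x < length l \<and> l ! x = r} = length (filter ((=) r) l)"
    by (simp add: length_filter_conv_card eq_commute[of r])
  also have "\<dots> = count (mset l) r" by (simp add: count_mset count_list_eq_length_filter)
  also have "\<dots> = q" using assms(2) by (simp add: balanced_words_mset[OF l] count_balanced)
  finally show ?thesis by (simp add: balanced_words_length[OF l])
qed

lemma balanced_words_occurrences:
  assumes l: "l \<in> balanced_words d q"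
  shows "\<exists>g. bij_betw (\<lambda>(i, r). g i r) ({..<q} \<times> {..<d}) {..<d * q} \<and> (\<forall>i<q. \<forall>r<d. l ! g i r = r)"
proof -
  have "\<exists>h. bij_betw h {..<q} {x. x < d * q \<and> l ! x = r}" if "r < d" for r
    using ex_bij_betw_nat_finite[of "{x. x < d * q \<and> l ! x = r}"] balanced_words_card_letter[OF l that]
    by (simp add: atLeast0LessThan)
  then obtain h where h: "\<And>r. r < d \<Longrightarrow> bij_betw (h r) {..<q} {x. x < d * q \<and> l ! x = r}" by metis
  have in_h: "h r i < d * q" "l ! h r i = r" if "i < q" "r < d" for i r
    using bij_betwE[OF h[OF that(2)]] that by auto
  have "inj_on (\<lambda>(i, r). h r i) ({..<q} \<times> {..<d})"
  proof (rule inj_onI)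
    fix y y' assume y: "y \<in> {..<q} \<times> {..<d}" "y' \<in> {..<q} \<times> {..<d}"
      and eq: "(case y of (i, r) \<Rightarrow> h r i) = (case y' of (i, r) \<Rightarrow> h r i)"
    obtain i r i' r' where y_eq: "y = (i, r)" "y' = (i', r')" by (cases y, cases y')
    then have *: "i < q" "r < d" "i' < q" "r' < d" "h r i = h r' i'" using y eq by auto
    then have "r = r'" using in_h(2)[of i r] in_h(2)[of i' r'] by auto
    then show "y = y'"
      using * inj_onD[OF bij_betw_imp_inj_on[OF h[of r]], of i i'] by (auto simp: y_eq)
  qed
  moreover have "(\<lambda>(i, r). h r i) ` ({..<q} \<times> {..<d}) = {..<d * q}"
  proof (intro equalityI subsetI)
    fix x assume x: "x \<in> {..<d * q}"
    then have r: "l ! x < d" using balanced_words_letter[OF l] by auto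
    then have "x \<in> h (l ! x) ` {..<q}" using bij_betw_imp_surj_on[OF h[OF r]] x by auto
    then show "x \<in> (\<lambda>(i, r). h r i) ` ({..<q} \<times> {..<d})" using r by force
  qed (use in_h in auto)
  ultimately show ?thesis using in_h by (intro exI[of _ "\<lambda>i r. h r i"]) (auto simp: bij_betw_def)
qed

lemma finite_balanced_words: "finite (balanced_words d q)"
  by (simp add: balanced_words_def)

lemma card_balanced_words:
  assumes "q \<ge> 1"
  shows "card (balanced_words d q) * fact q ^ d = fact (d * q)"
proof -
  let ?A = "\<Sum>r<d. replicate_mset q r"
  have "set_mset ?A = {..<d}"
    using assms by (auto simp: count_balanced simp flip: count_greater_zero_iff split: if_splits)
  then have "(\<Prod>x\<in>set_mset ?A. fact (count ?A x)) = (fact q :: nat) ^ d" by (simp add: count_balanced)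
  moreover have "size ?A = d * q" by (rule size_balanced)
  ultimately show ?thesis
    using card_permutations_of_multiset_aux[of ?A] by (simp add: balanced_words_def)
qed

lemma power_self_le_fact: "real n ^ n \<le> exp (real n) * fact n"
proof (induction n)
  case (Suc n)
  have "(1 + real n) ^ n \<le> exp 1 * real n ^ n"
  proof (cases "n = 0")
    case False
    have "(1 + real n) ^ n = (1 + 1 / real n) ^ n * real n ^ n"
      using False by (simp add: power_mult_distrib[symmetric] field_simps)
    then show ?thesis
      using exp_ge_one_plus_x_over_n_power_n[of n 1] False by (simp add: mult_right_mono)
  qed simp
  then have "(1 + real n) ^ n \<le> exp 1 * (exp (real n) * fact n)"
    using Suc by (meson exp_ge_zero mult_left_mono order.trans)
  then have "(1 + real n) * (1 + real n) ^ n \<le> (1 + real n) * (exp 1 * (exp (real n) * fact n))"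
    by (intro mult_left_mono) auto
  then show ?case by (simp add: exp_add mult_ac add.commute)
qed simp

lemma fact_exp_le_power_self: "n \<ge> 1 \<Longrightarrow> fact n * exp (real n) \<le> exp 1 * real n * real n ^ n"
proof (induction n rule: dec_induct)
  case (step n)
  have "(1 - 1 / real (Suc n)) ^ Suc n \<le> exp (- 1)"
    using exp_ge_one_minus_x_over_n_power_n[of 1 "Suc n"] by simp
  moreover have "1 - 1 / real (Suc n) = real n / real (Suc n)" by (simp add: field_simps)
  ultimately have "real n ^ Suc n / real (Suc n) ^ Suc n \<le> 1 / exp 1"
    by (simp only: power_divide exp_minus inverse_eq_divide)
  then have "real n ^ Suc n \<le> 1 / exp 1 * real (Suc n) ^ Suc n"
    by (subst (asm) pos_divide_le_eq) auto
  then have *: "exp 1 * real n ^ Suc n \<le> real (Suc n) ^ Suc n"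
    by (simp add: field_simps del: power_Suc of_nat_Suc)
  have "fact (Suc n) * exp (real (Suc n)) = real (Suc n) * exp 1 * (fact n * exp (real n))"
    by (simp add: exp_add mult_ac)
  also have "\<dots> \<le> real (Suc n) * exp 1 * (exp 1 * real n * real n ^ n)"
    using step by (intro mult_left_mono) auto
  also have "\<dots> = exp 1 * real (Suc n) * (exp 1 * real n ^ Suc n)" by (simp add: mult_ac)
  also have "\<dots> \<le> exp 1 * real (Suc n) * real (Suc n) ^ Suc n"
    using * by (intro mult_left_mono) auto
  finally show ?case .
qed simp

text \<open>The multinomial coefficient \<open>(d q)! / (q!)\<^sup>d\<close> is \<open>d\<^bsup>d q\<^esup>\<close> up to a factor polynomial in \<open>q\<close>,
  by the elementary bounds \<open>(n/e)\<^sup>n \<le> n! \<le> e n (n/e)\<^sup>n\<close>.\<close>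

lemma card_balanced_words_ge:
  assumes q: "q \<ge> 1"
  shows "real d ^ (d * q) \<le> real (card (balanced_words d q)) * (exp 1 * real q) ^ d"
proof -
  let ?b = "real (card (balanced_words d q))"
  have "real (card (balanced_words d q) * fact q ^ d) = real (fact (d * q))"
    unfolding card_balanced_words[OF q] ..
  then have card: "?b * fact q ^ d = fact (d * q)" by simp
  have "real d ^ (d * q) * real q ^ (d * q) = real (d * q) ^ (d * q)" by (simp add: power_mult_distrib)
  also have "\<dots> \<le> exp (real (d * q)) * fact (d * q)" by (rule power_self_le_fact)
  also have "\<dots> = ?b * (fact q * exp (real q)) ^ d"
    unfolding card[symmetric] by (simp add: power_mult_distrib exp_of_nat_mult mult_ac)
  also have "\<dots> \<le> ?b * (exp 1 * real q * real q ^ q) ^ d"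
    using fact_exp_le_power_self[OF q] by (intro mult_left_mono power_mono) auto
  also have "\<dots> = (?b * (exp 1 * real q) ^ d) * real q ^ (d * q)"
    by (simp add: power_mult_distrib power_mult[symmetric] mult_ac)
  finally show ?thesis using q by (simp add: mult_le_cancel_right)
qed

lemma exists_many_balanced_words:
  assumes "0 < \<rho>" "\<rho> < real d"
  shows "\<exists>q\<ge>1. \<rho> ^ (d * (2 * q)) \<le> real (card (balanced_words d (2 * q)))"
proof -
  have "(\<lambda>n. real n * (\<rho> / real d) ^ n) \<longlonglongrightarrow> 0"
    using assms by (intro powser_times_n_limit_0) auto
  then have "\<forall>\<^sub>F n in sequentially. real n * (\<rho> / real d) ^ n < 1 / exp 1"
    by (rule order_tendstoD) simp
  then obtain N where N: "\<And>n. n \<ge> N \<Longrightarrow> real n * (\<rho> / real d) ^ n < 1 / exp 1"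
    by (auto simp: eventually_sequentially)
  define q where "q = 2 * Suc N"
  have q: "q \<ge> 1" by (simp add: q_def)
  have "real q * (\<rho> / real d) ^ q < 1 / exp 1" by (rule N) (simp add: q_def)
  then have "exp 1 * real q * \<rho> ^ q \<le> real d ^ q"
    using assms by (simp add: power_divide field_simps)
  then have "(exp 1 * real q * \<rho> ^ q) ^ d \<le> (real d ^ q) ^ d"
    using assms by (intro power_mono) auto
  then have "\<rho> ^ (d * q) * (exp 1 * real q) ^ d \<le> real d ^ (d * q)"
    by (simp add: power_mult_distrib power_mult[symmetric] mult_ac)
  also have "\<dots> \<le> real (card (balanced_words d q)) * (exp 1 * real q) ^ d"
    by (rule card_balanced_words_ge[OF q])
  finally have "\<rho> ^ (d * q) \<le> real (card (balanced_words d q))"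
    using q by (simp add: mult_le_cancel_right)
  then show ?thesis by (intro exI[of _ "Suc N"]) (simp add: q_def)
qed

section \<open>The lower bound for codimensions\<close>

text \<open>The positions after the first \<open>m\<close> are divided into \<open>t\<close> chunks of length \<open>d q\<close>, and a family \<open>w\<close>
  of balanced words puts the word \<open>w s\<close> on the \<open>s\<close>-th chunk. The variables are distributed to
  determinants by \<open>w\<close>: the block \<open>j = g q + i\<close> takes the \<open>i\<close>-th occurrence of the letter \<open>r\<close>
  from the chunk \<open>g + r\<close>, cyclically. Thus the letters of a block stand in different chunks, and in
  increasing order unless the block wraps around.\<close>

definition chunk :: "nat \<Rightarrow> nat \<Rightarrow> nat \<Rightarrow> nat" where
  "chunk t g r = (if g + r < t then g + r else g + r - t)"

locale block_structure =
  fixes d q t m :: nat and occ :: "nat list \<Rightarrow> nat \<Rightarrow> nat \<Rightarrow> nat" and \<beta>0 :: "nat list"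
  assumes d: "d \<ge> 1" and q: "q \<ge> 1" and t: "t \<ge> d"
    and occ_bij: "\<And>l. l \<in> balanced_words d q \<Longrightarrow>
      bij_betw (\<lambda>(i, r). occ l i r) ({..<q} \<times> {..<d}) {..<d * q}"
    and occ_letter: "\<And>l i r. l \<in> balanced_words d q \<Longrightarrow> i < q \<Longrightarrow> r < d \<Longrightarrow> l ! occ l i r = r"
    and \<beta>0: "\<beta>0 \<in> balanced_words d q"
begin

definition words :: "(nat \<Rightarrow> nat list) set" where
  "words = PiE {..<t} (\<lambda>s. if s < d - 1 then {\<beta>0} else balanced_words d q)"

definition position :: "(nat \<Rightarrow> nat list) \<Rightarrow> nat \<Rightarrow> nat \<Rightarrow> nat" where
  "position w j r = m + (chunk t (j div q) r * (d * q) + occ (w (chunk t (j div q) r)) (j mod q) r)"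

definition letter_at :: "(nat \<Rightarrow> nat list) \<Rightarrow> nat \<Rightarrow> nat" where
  "letter_at w p = w ((p - m) div (d * q)) ! ((p - m) mod (d * q))"

lemma words_balanced: "w \<in> words \<Longrightarrow> s < t \<Longrightarrow> w s \<in> balanced_words d q"
  using \<beta>0 by (auto simp: words_def PiE_iff split: if_splits)

lemma finite_words: "finite words"
  unfolding words_def by (intro finite_PiE) (auto simp: finite_balanced_words)

lemma card_words: "card words = card (balanced_words d q) ^ (t - (d - 1))"
proof -
  have "card words = (\<Prod>s<t. if s < d - 1 then 1 else card (balanced_words d q))"
    unfolding words_def by (subst card_PiE) (auto intro!: prod.cong)
  also have "\<dots> = (\<Prod>s\<in>{s\<in>{..<t}. \<not> s < d - 1}. card (balanced_words d q))"
    by (subst prod.inter_filter) (auto intro!: prod.cong)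
  also have "{s\<in>{..<t}. \<not> s < d - 1} = {d - 1..<t}" by auto
  finally show ?thesis by simp
qed

lemma chunk_less: "g < t \<Longrightarrow> r < d \<Longrightarrow> chunk t g r < t"
  using t by (auto simp: chunk_def)

lemma div_less_t: "j < t * q \<Longrightarrow> j div q < t"
  by (simp add: less_mult_imp_div_less)

lemma occ_less: "l \<in> balanced_words d q \<Longrightarrow> i < q \<Longrightarrow> r < d \<Longrightarrow> occ l i r < d * q"
  using bij_betwE[OF occ_bij] by fastforce

lemma position_occ_less:
  assumes "w \<in> words" "j < t * q" "r < d"
  shows "occ (w (chunk t (j div q) r)) (j mod q) r < d * q"
  using assms q chunk_less[OF div_less_t] by (intro occ_less words_balanced) auto

lemma position_div_mod:
  assumes "w \<in> words" "j < t * q" "r < d"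
  shows "(position w j r - m) div (d * q) = chunk t (j div q) r"
    and "(position w j r - m) mod (d * q) = occ (w (chunk t (j div q) r)) (j mod q) r"
proof -
  have "d * q > 0" using d q by simp
  then show "(position w j r - m) div (d * q) = chunk t (j div q) r"
    and "(position w j r - m) mod (d * q) = occ (w (chunk t (j div q) r)) (j mod q) r"
    unfolding position_def using position_occ_less[OF assms] by (simp_all add: div_mult_self3)
qed

lemma letter_at_position:
  assumes "w \<in> words" "j < t * q" "r < d"
  shows "letter_at w' (position w j r)
    = w' (chunk t (j div q) r) ! occ (w (chunk t (j div q) r)) (j mod q) r"
  by (simp add: letter_at_def position_div_mod[OF assms])

lemma inj_position:
  assumes w: "w \<in> words"
  shows "inj_on (\<lambda>(j, r). position w j r) ({..<t * q} \<times> {..<d})"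
proof (rule inj_onI)
  fix y y' assume y: "y \<in> {..<t * q} \<times> {..<d}" "y' \<in> {..<t * q} \<times> {..<d}"
    and eq': "(case y of (j, r) \<Rightarrow> position w j r) = (case y' of (j, r) \<Rightarrow> position w j r)"
  obtain j r j' r' where y_eq: "y = (j, r)" "y' = (j', r')" by (cases y, cases y')
  have *: "j < t * q" "r < d" "j' < t * q" "r' < d" and eq: "position w j r = position w j' r'"
    using y eq' by (auto simp: y_eq)
  let ?s = "chunk t (j div q) r"
  have s: "chunk t (j' div q) r' = ?s"
    using position_div_mod(1)[OF w, of j r] position_div_mod(1)[OF w, of j' r'] * eq by simp
  have o: "occ (w ?s) (j mod q) r = occ (w ?s) (j' mod q) r'"
    using position_div_mod(2)[OF w, of j r] position_div_mod(2)[OF w, of j' r'] * eq s by simp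
  have g: "j div q < t" "j' div q < t" using * div_less_t by auto
  have "w ?s \<in> balanced_words d q" using words_balanced[OF w] chunk_less g * by simp
  from inj_onD[OF bij_betw_imp_inj_on[OF occ_bij[OF this]], of "(j mod q, r)" "(j' mod q, r')"]
  have ir: "j mod q = j' mod q" "r = r'" using o q * by auto
  have "j div q = j' div q" using s ir(2) g * t by (auto simp: chunk_def split: if_splits)
  then have "j = j'" using ir div_mult_mod_eq[of j q] div_mult_mod_eq[of j' q] by metis
  then show "y = y'" using ir by (simp add: y_eq)
qed

lemma position_image:
  assumes w: "w \<in> words"
  shows "(\<lambda>(j, r). position w j r) ` ({..<t * q} \<times> {..<d}) = {m..<m + t * (d * q)}"
proof (rule card_subset_eq)
  show "(\<lambda>(j, r). position w j r) ` ({..<t * q} \<times> {..<d}) \<subseteq> {m..<m + t * (d * q)}"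
  proof (rule image_subsetI)
    fix y assume y: "y \<in> {..<t * q} \<times> {..<d}"
    obtain j r where y_eq: "y = (j, r)" by (cases y)
    have jr: "j < t * q" "r < d" using y by (auto simp: y_eq)
    then have "chunk t (j div q) r < t" using chunk_less div_less_t by simp
    then have "chunk t (j div q) r * (d * q) + d * q \<le> t * (d * q)"
      by (metis Suc_leI mult_Suc mult_le_mono1 add.commute)
    then show "(case y of (j, r) \<Rightarrow> position w j r) \<in> {m..<m + t * (d * q)}"
      using position_occ_less[OF w, of j r] jr by (simp add: position_def y_eq)
  qed
  show "card ((\<lambda>(j, r). position w j r) ` ({..<t * q} \<times> {..<d})) = card {m..<m + t * (d * q)}"
    by (simp add: card_image[OF inj_position[OF w]] card_cartesian_product)
qed simp

text \<open>If the chunks of \<open>w'\<close> before the \<open>s\<close>-th one agree with those of \<open>w\<close>, then a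
  position of the \<open>s\<close>-th chunk with the letter \<open>r\<close> in \<open>w\<close> lies in a block whose letters
  \<open>0, \<dots>, r - 1\<close> are already used in earlier chunks, so its letter in \<open>w'\<close> is at least \<open>r\<close>. Both
  words have the same letters with the same multiplicities on the \<open>s\<close>-th chunk, hence agree there. The first \<open>d - 1\<close> chunks
  are fixed because there the blocks wrap around.\<close>

lemma words_eq_if_blocks_injective:
  assumes w: "w \<in> words" and w': "w' \<in> words"
    and inj: "\<And>j. j < t * q \<Longrightarrow> inj_on (\<lambda>r. letter_at w' (position w j r)) {..<d}"
  shows "w' = w"
proof -
  have "s < t \<longrightarrow> w' s = w s" for s
  proof (induction s rule: less_induct)
    case (less s)
    show ?case
    proof
      assume st: "s < t"
      show "w' s = w s"
      proof (cases "s < d - 1")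
        case True
        then show ?thesis using w w' st by (auto simp: words_def PiE_iff split: if_splits)
      next
        case False
        have ws: "w s \<in> balanced_words d q" "w' s \<in> balanced_words d q"
          using words_balanced w w' st by auto
        have ge: "w s ! x \<le> w' s ! x" if x: "x < d * q" for x
        proof -
          define r where "r = w s ! x"
          have r: "r < d" unfolding r_def by (rule balanced_words_letter[OF ws(1) x])
          have "x \<in> (\<lambda>(i, r). occ (w s) i r) ` ({..<q} \<times> {..<d})"
            using bij_betw_imp_surj_on[OF occ_bij[OF ws(1)]] x by simp
          then obtain i r1 where i: "i < q" "r1 < d" "occ (w s) i r1 = x" by auto
          then have "r1 = r" using occ_letter[OF ws(1) i(1,2)] by (simp add: r_def)
          define g where "g = s - r"
          have g: "g + r = s" using r False by (simp add: g_def)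
          define j where "j = g * q + i"
          have jdm: "j div q = g" "j mod q = i" using i(1) by (simp_all add: j_def)
          have "g < t" using g st by simp
          then have "g * q + q \<le> t * q" by (metis Suc_leI mult_Suc mult_le_mono1 add.commute)
          then have j: "j < t * q" using i(1) by (simp add: j_def)
          have ch: "chunk t g r' = g + r'" if "r' \<le> r" for r' using that g st by (simp add: chunk_def)
          let ?c = "\<lambda>r. letter_at w' (position w j r)"
          have cr: "?c r = w' s ! x"
            using letter_at_position[OF w j r, of w'] ch[of r] jdm g i \<open>r1 = r\<close> by simp
          have c_less: "?c r' = r'" if r': "r' < r" for r'
          proof -
            have "g + r' < s" using g r' by simp
            then have "w' (g + r') = w (g + r')" using less st by simp
            moreover have "w (g + r') \<in> balanced_words d q" using words_balanced[OF w] \<open>g + r' < s\<close> st by simp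
            ultimately show ?thesis
              using letter_at_position[OF w j, of r' w'] ch[of r'] jdm r' r i(1) occ_letter by simp
          qed
          have "\<not> ?c r < r"
          proof
            assume lt: "?c r < r"
            then have "?c (?c r) = ?c r" by (rule c_less)
            then have "?c r = r" using inj_onD[OF inj[OF j], of "?c r" r] lt r by simp
            then show False using lt by simp
          qed
          then show ?thesis using cr by (simp add: r_def)
        qed
        have "sum_list (w s) = sum_list (w' s)"
          by (metis balanced_words_mset[OF ws(1)] balanced_words_mset[OF ws(2)] sum_mset_sum_list)
        then have "(\<Sum>x<d * q. w s ! x) = (\<Sum>x<d * q. w' s ! x)"
          using ws by (simp add: sum_list_sum_nth balanced_words_length atLeast0LessThan)
        then have "w s ! x = w' s ! x" if "x < d * q" for x
          using ge that by (intro sum_mono_inv[of "(!) (w s)" "{..<d * q}" "(!) (w' s)"]) auto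
        then show ?thesis using ws by (intro nth_equalityI) (auto simp: balanced_words_length)
      qed
    qed
  qed
  then show ?thesis using w w' by (intro PiE_ext[of w' "{..<t}" _ w]) (auto simp: words_def)
qed

end

context fd_H_module_lie_algebra
begin

text \<open>Each family \<open>w\<close> of words gives the function \<open>\<Phi> w\<close>, a product of determinants over the blocks of
  \<open>w\<close> times the alternating polynomial, and the point \<open>pt w\<close>, where the variables are the basis
  vectors spelled by \<open>w\<close>. The matrix of the values \<open>\<Phi> w (pt w')\<close> is diagonal with nonzero diagonal.
  Determinants come in pairs, whence the even multiplicity \<open>2 q\<close>.\<close>

lemma H_codim_ge_words:
  assumes ss: "L.no_abelian_ideals"
    and F: "H_poly {..<m} F" "L.antisym_fun d F" "F a0 \<noteq> 0" and m: "d \<le> m" "d \<ge> 1"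
    and q: "q \<ge> 1" and t: "t \<ge> d"
  shows "card (balanced_words d (2 * q)) ^ (t - (d - 1)) \<le> H_codim (m + t * (d * (2 * q)))"
proof (cases "balanced_words d (2 * q) = {}")
  case True
  then show ?thesis using t m by (simp add: power_0_left)
next
  case False
  then obtain \<beta>0 where \<beta>0: "\<beta>0 \<in> balanced_words d (2 * q)" by blast
  let ?q = "2 * q" and ?n = "m + t * (d * (2 * q))"
  define occ where "occ l = (SOME g. bij_betw (\<lambda>(i, r). g i r) ({..<?q} \<times> {..<d}) {..<d * ?q} \<and>
      (\<forall>i<?q. \<forall>r<d. l ! g i r = r))" for l
  have occ: "bij_betw (\<lambda>(i, r). occ l i r) ({..<?q} \<times> {..<d}) {..<d * ?q} \<and> (\<forall>i<?q. \<forall>r<d. l ! occ l i r = r)"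
    if "l \<in> balanced_words d ?q" for l
    unfolding occ_def using someI_ex[OF balanced_words_occurrences[OF that]] .
  interpret B: block_structure d ?q t m occ \<beta>0
    by standard (use m q t occ \<beta>0 in auto)
  have tq: "2 * (t * q) = t * ?q" by simp
  define \<Phi> where "\<Phi> w a = scaleL (\<Prod>j<t * ?q. L.basis_det (a \<circ> B.position w j)) (F a)" for w a
  have "\<exists>p\<in>commutator_span ?n. \<forall>a. eval_poly a p = \<Phi> w a" if w: "w \<in> B.words" for w
  proof -
    have "H_poly ({..<m} \<union> (\<lambda>(j, r). B.position w j r) ` ({..<2 * (t * q)} \<times> {..<d}))
      (\<lambda>a. scaleL (\<Prod>j<2 * (t * q). L.basis_det (a \<circ> B.position w j)) (F a))"
      using m B.inj_position[OF w] B.position_image[OF w]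
      by (intro H_poly_many_dets[OF ss F(1,2)]) (auto simp: tq)
    then have "H_poly ({..<m} \<union> {m..<?n}) (\<Phi> w)"
      unfolding tq B.position_image[OF w] \<Phi>_def .
    moreover have "{..<m} \<union> {m..<?n} = {..<?n}" by auto
    ultimately show ?thesis using H_poly_commutator_span by simp
  qed
  then obtain p where p: "\<And>w. w \<in> B.words \<Longrightarrow> p w \<in> commutator_span ?n"
      "\<And>w a. w \<in> B.words \<Longrightarrow> eval_poly a (p w) = \<Phi> w a" by metis
  define pt where "pt w i = (if i < m then a0 i else L.basis_enum (B.letter_at w i))" for w i
  have F_pt: "F (pt w) = F a0" for w
    by (rule L.multilin_cong[OF H_poly_multilin[OF F(1)]]) (simp add: pt_def)
  have pt_position: "pt w' \<circ> B.position w j = (\<lambda>r. L.basis_enum (B.letter_at w' (B.position w j r)))" for w w' j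
    by (auto simp: pt_def B.position_def fun_eq_iff)
  have letters: "B.letter_at w' (B.position w j r) < d"
    if "w \<in> B.words" "w' \<in> B.words" "j < t * ?q" "r < d" for w w' j r
    unfolding B.letter_at_position[OF that(1,3,4)]
    by (rule balanced_words_letter[OF B.words_balanced[OF that(2)
          B.chunk_less[OF B.div_less_t[OF that(3)] that(4)]] B.position_occ_less[OF that(1,3,4)]])
  have diag: "\<Phi> w (pt w) \<noteq> 0" if w: "w \<in> B.words" for w
  proof -
    have "L.basis_det (pt w \<circ> B.position w j) = 1" if j: "j < t * ?q" for j
    proof -
      have "B.letter_at w (B.position w j r) = r" if "r < d" for r
        unfolding B.letter_at_position[OF w j that]
        using q j that by (intro B.occ_letter B.words_balanced[OF w] B.chunk_less B.div_less_t) auto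
      then have "L.basis_det (pt w \<circ> B.position w j) = L.basis_det L.basis_enum"
        unfolding pt_position by (intro L.form_det_cong) simp
      then show ?thesis by (simp add: L.basis_det_enum)
    qed
    then show ?thesis using F(3) by (simp add: \<Phi>_def F_pt)
  qed
  have off_diag: "\<Phi> w (pt w') = 0" if w: "w \<in> B.words" and w': "w' \<in> B.words" and ne: "w \<noteq> w'" for w w'
  proof (rule ccontr)
    assume "\<Phi> w (pt w') \<noteq> 0"
    then have "L.basis_det (pt w' \<circ> B.position w j) \<noteq> 0" if "j < t * ?q" for j
      using that by (auto simp: \<Phi>_def)
    then have "inj_on (\<lambda>r. B.letter_at w' (B.position w j r)) {..<d}" if "j < t * ?q" for j
      using that letters[OF w w'] unfolding pt_position by (intro L.basis_det_letters) auto
    then have "w' = w" by (rule B.words_eq_if_blocks_injective[OF w w'])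
    then show False using ne by simp
  qed
  have "card B.words \<le> H_codim ?n"
  proof (rule H_codim_ge[OF _ B.finite_words p(1)])
    fix c assume zero: "\<And>a. (\<Sum>w\<in>B.words. scaleL (c w) (eval_poly a (p w))) = 0"
    show "\<forall>w\<in>B.words. c w = 0"
    proof
      fix w' assume w': "w' \<in> B.words"
      have "0 = (\<Sum>w\<in>B.words. scaleL (c w) (\<Phi> w (pt w')))"
        using zero[of "pt w'"] by (simp add: p(2))
      also have "\<dots> = (\<Sum>w\<in>B.words. if w = w' then scaleL (c w') (\<Phi> w' (pt w')) else 0)"
        using off_diag w' by (intro sum.cong) auto
      also have "\<dots> = scaleL (c w') (\<Phi> w' (pt w'))" using B.finite_words w' by simp
      finally show "c w' = 0" using diag[OF w'] by simp
    qed
  qed (use m in auto)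
  then show ?thesis by (simp only: B.card_words)
qed

lemma H_codim_exponential_lower_bound:
  assumes simple: H_simple and ss: "L.no_abelian_ideals" and nonzero: "\<exists>v::'l. v \<noteq> 0"
    and \<rho>: "0 < \<rho>" "\<rho> < real d"
  shows "\<exists>C>0. \<exists>n0. \<forall>n\<ge>n0. C * \<rho> ^ n \<le> real (H_codim n)"
proof -
  have d: "d \<ge> 1" using \<rho> by (cases d) auto
  obtain q0 where q0: "q0 \<ge> 1" "\<rho> ^ (d * (2 * q0)) \<le> real (card (balanced_words d (2 * q0)))"
    using exists_many_balanced_words[OF \<rho>] by blast
  obtain k0 where k0: "k0 \<ge> d" "\<And>k. k \<ge> k0 \<Longrightarrow> \<exists>F a. H_poly {..<k} F \<and> L.antisym_fun d F \<and> F a \<noteq> 0"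
    using exists_alternating_poly[OF simple ss nonzero] by blast
  define M where "M = d * (2 * q0)"
  have M: "M > 0" using d q0 by (simp add: M_def)
  define K where "K = k0 + M + M * (d - 1)"
  \<comment> \<open>The maximum takes care of \<open>\<rho> < 1\<close>, where the powers decrease.\<close>
  define R where "R = max 1 \<rho>"
  have "1 / R ^ K * \<rho> ^ n \<le> real (H_codim n)" if n: "n \<ge> k0 + d * M" for n
  proof -
    define t where "t = (n - k0) div M"
    define m where "m = k0 + (n - k0) mod M"
    have nmt: "n = m + t * M" using n by (simp add: m_def t_def)
    have "d * M div M \<le> t" unfolding t_def using n by (intro div_le_mono) simp
    then have t: "d \<le> t" using M by simp
    obtain F a where F: "H_poly {..<m} F" "L.antisym_fun d F" "F a \<noteq> 0" using k0(2)[of m] by (auto simp: m_def)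
    have "(\<rho> ^ M) ^ (t - (d - 1)) \<le> real (card (balanced_words d (2 * q0))) ^ (t - (d - 1))"
      using q0(2) \<rho> by (intro power_mono) (auto simp: M_def)
    also have "\<dots> = real (card (balanced_words d (2 * q0)) ^ (t - (d - 1)))" by simp
    also have "\<dots> \<le> real (H_codim (m + t * (d * (2 * q0))))"
      using k0(1) d q0(1) t by (intro of_nat_mono H_codim_ge_words[OF ss F]) (auto simp: m_def)
    also have "m + t * (d * (2 * q0)) = n" using nmt by (simp add: M_def)
    finally have lower: "\<rho> ^ (M * (t - (d - 1))) \<le> real (H_codim n)" by (simp add: power_mult)
    \<comment> \<open>All but at most \<open>K\<close> of the \<open>n\<close> variables lie in chunks that carry an arbitrary word.\<close>
    have "M * t = M * (t - (d - 1)) + M * (d - 1)"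
      using t d by (simp add: distrib_left[symmetric])
    then have "n = M * (t - (d - 1)) + (m + M * (d - 1))" using nmt by (simp add: mult.commute)
    then have "\<rho> ^ n = \<rho> ^ (M * (t - (d - 1))) * \<rho> ^ (m + M * (d - 1))" by (metis power_add)
    moreover have "\<rho> ^ (m + M * (d - 1)) \<le> R ^ K"
    proof -
      have "\<rho> ^ (m + M * (d - 1)) \<le> R ^ (m + M * (d - 1))" using \<rho> by (intro power_mono) (auto simp: R_def)
      also have "\<dots> \<le> R ^ K"
        using M mod_less_divisor[OF M, of "n - k0"] by (intro power_increasing) (auto simp: R_def K_def m_def)
      finally show ?thesis .
    qed
    ultimately have "\<rho> ^ n \<le> \<rho> ^ (M * (t - (d - 1))) * R ^ K"
      using \<rho> by (simp add: mult_left_mono)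
    also have "\<dots> \<le> real (H_codim n) * R ^ K" using lower by (intro mult_right_mono) (auto simp: R_def)
    finally show ?thesis by (simp add: R_def field_simps)
  qed
  then show ?thesis by (intro exI[of _ "1 / R ^ K"] conjI exI[of _ "k0 + d * M"]) (auto simp: R_def)
qed

theorem H_simple_imp_maximal_growth:
  assumes simple: H_simple and ss: "L.semisimple" and nonzero: "\<exists>v::'l. v \<noteq> 0"
  shows "(\<lambda>n. root n (real (H_codim n))) \<longlonglongrightarrow> real (L.dim UNIV)"
proof (rule order_tendstoI)
  have ss': "L.no_abelian_ideals" using ss by (simp add: L.semisimple_iff_no_abelian_ideals)
  have dim: "L.dim UNIV = d" by (rule L.dim_UNIV)
  have dpos: "d > 0"
  proof (rule ccontr)
    assume "\<not> d > 0"
    then have "Basis = {}" using L.finite_Basis by simp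
    then have "(UNIV :: 'l set) = {0}" using L.span_Basis by simp
    then show False using nonzero by blast
  qed
  fix a :: real
  {
    assume "a < real (L.dim UNIV)"
    then obtain \<rho> where \<rho>: "max a 0 < \<rho>" "\<rho> < real d"
      using dense[of "max a 0" "real d"] dim dpos by auto
    then obtain C n0 where C: "C > 0" "\<And>n. n \<ge> n0 \<Longrightarrow> C * \<rho> ^ n \<le> real (H_codim n)"
      using H_codim_exponential_lower_bound[OF simple ss' nonzero, of \<rho>] by auto
    have "(\<lambda>n. root n C * \<rho>) \<longlonglongrightarrow> 1 * \<rho>" by (intro tendsto_intros LIMSEQ_root_const C)
    then have "\<forall>\<^sub>F n in sequentially. a < root n C * \<rho>" using \<rho> by (intro order_tendstoD) auto
    then show "\<forall>\<^sub>F n in sequentially. a < root n (real (H_codim n))"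
      using eventually_ge_at_top[of "max 1 n0"]
    proof eventually_elim
      case (elim n)
      have "root n C * \<rho> = root n (C * \<rho> ^ n)"
        using elim(2) \<rho> by (simp add: real_root_mult real_root_power_cancel)
      also have "\<dots> \<le> root n (real (H_codim n))" using elim(2) C(2)[of n] by simp
      finally show ?case using elim(1) by simp
    qed
  next
    assume a: "real (L.dim UNIV) < a"
    have "(\<lambda>n. root n (real d) * real d) \<longlonglongrightarrow> 1 * real d"
      using dpos by (intro tendsto_intros LIMSEQ_root_const) simp
    then have "\<forall>\<^sub>F n in sequentially. root n (real d) * real d < a" using a dim by (intro order_tendstoD) auto
    then show "\<forall>\<^sub>F n in sequentially. root n (real (H_codim n)) < a"
      using eventually_ge_at_top[of 1]
    proof eventually_elim
      case (elim n)
      have "real (H_codim n) \<le> real (d ^ n * d)" using H_codim_le_dim_power[OF elim(2)] dim by (intro of_nat_mono) simp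
      then have "root n (real (H_codim n)) \<le> root n (real d * real d ^ n)"
        using elim(2) by (simp add: mult.commute)
      also have "\<dots> = root n (real d) * real d"
        using elim(2) by (simp add: real_root_mult real_root_power_cancel)
      finally show ?case using elim(1) by simp
    qed
  }
qed

end

theorem theorem18:
  fixes scaleH :: "'f::{alg_closed_field, field_char_0} \<Rightarrow> 'h::ring_1 \<Rightarrow> 'h"
    and comult :: "'h \<Rightarrow> ('h \<times> 'h) list"
    and counit :: "'h \<Rightarrow> 'f"
    and antipode :: "'h \<Rightarrow> 'h"
    and scaleL :: "'f \<Rightarrow> 'l::ab_group_add \<Rightarrow> 'l"
    and bracket :: "'l \<Rightarrow> 'l \<Rightarrow> 'l"
    and act :: "'h \<Rightarrow> 'l \<Rightarrow> 'l"
  assumes "H_module_lie_algebra scaleH comult counit antipode scaleL bracket act"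
    and "\<exists>B. finite_dimensional_vector_space scaleL B"
    and "\<exists>a::'l. a \<noteq> 0"
    and "H_module_lie_algebra.H_invariant act (lie_algebra.nilpotent_radical scaleL bracket)"
  shows "(\<lambda>n. root n (real (H_module_lie_algebra.H_codim scaleH comult scaleL bracket act n)))
           \<longlonglongrightarrow> real (vector_space.dim scaleL UNIV)
         \<longleftrightarrow> H_module_lie_algebra.H_simple scaleL bracket act \<and>
             lie_algebra.semisimple scaleL bracket"
proof -
  obtain B where B: "finite_dimensional_vector_space scaleL B" using assms(2) by blast
  interpret H_module_lie_algebra scaleH comult counit antipode scaleL bracket act by (rule assms(1))
  interpret fd_H_module_lie_algebra scaleH comult counit antipode scaleL bracket act B
    by (intro fd_H_module_lie_algebra.intro fd_lie_algebra.intro alg_closed_fd_space.intro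
        assms(1) B L.lie_algebra_axioms)
  show ?thesis
    using maximal_growth_imp_H_simple[OF _ assms(3,4)] H_simple_imp_maximal_growth[OF _ _ assms(3)]
    by blast
qed

end
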